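(* Let $n\ge 2$ and let $\mathcal P_n$ be the partition monoid of degree $n$. (i) The ideals of $\mathcal P_n$ are exactly the sets $I_q=\{\alpha\in\mathcal P_n:\operatorname{rank}(\alpha)\le q\}$ for $q=0,\dots,n$, yielding the Rees congruences $R_q=R_{I_q}$. (ii) The proper IN-pairs $(I,M)$ of $\mathcal P_n$ with $M\le\overline{\mathcal S}_q$ for some $q$ are exactly the pairs $(I_{q-1},\overline N)$, for $q=2,\dots,n$ and $N$ a non-trivial normal subgroup of $\mathcal S_q$, yielding the congruences $R_N=R_{I_{q-1},\overline N}$. (iii) The retractable IN-pairs $(I,M)$ of $\mathcal P_n$ with $M\le\overline{\mathcal S}_q$ for some $q$ are exactly $\mathscr C_0=(I_0,\{\overline{\mathrm{id}}_1\})$, $\mathscr C_1=(I_1,\{\overline{\mathrm{id}}_2\})$ and $\mathscr C_{\mathcal S_2}=(I_1,\overline{\mathcal S}_2)$, yielding the congruences $\lambda_0,\rho_0,\mu_0$ (from $\mathscr C_0$), $\lambda_1,\rho_1,\mu_1$ (from $\mathscr C_1$) and $\lambda_{\mathcal S_2},\rho_{\mathcal S_2},\mu_{\mathcal S_2}$ (from $\mathscr C_{\mathcal S_2}$). (iv) The congruences $R_q$ ($0\le q\le n$), $R_N$ ($\{\mathrm{id}_q\}\ne N\trianglelefteq\mathcal S_q$, $2\le q\le n$), $\lambda_0,\rho_0,\mu_0,\lambda_1,\rho_1,\mu_1,\lambda_{\mathcal S_2},\rho_{\mathcal S_2},\mu_{\mathcal S_2}$ are pairwise distinct, and they are all the congruences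 of $\mathcal P_n$. (v) The order (inclusion) on the congruence lattice $\operatorname{Cong}(\mathcal P_n)$ is as follows. The twelve congruences $\xi_i$ with $\xi\in\{\mu,\lambda,\rho,R\}$ and $i\in\{0,1,\mathcal S_2\}$ form the direct product of the four-element diamond $\mu<\lambda,\rho<R$ (with $\lambda,\rho$ incomparable) and the three-element chain $0<1<\mathcal S_2$ (that is, $\xi_i\subseteq\zeta_j$ iff $\xi\le\zeta$ in the diamond and $i\le j$ in the chain), with bottom element $\mu_0=\Delta$ and top element $R_{\mathcal S_2}$. The remaining congruences all contain $R_{\mathcal S_2}$ and form the chain $$R_{\mathcal S_2}\subsetneq R_2\subsetneq R_{\mathcal A_3}\subsetneq R_{\mathcal S_3}\subsetneq R_3\subsetneq R_K\subsetneq R_{\mathcal A_4}\subsetneq R_{\mathcal S_4}\subsetneq R_4\subsetneq R_{\mathcal A_5}\subsetneq R_{\mathcal S_5}\subsetneq R_5\subsetneq\cdots\subsetneq R_{\mathcal S_n}\subsetneq R_n=\nabla$$ (truncated at $R_n$), where $K$ is the Klein 4-group in $\mathcal S_4$.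
   Context: **Partition monoid.** Let $\mathbf n=\{1,\dots,n\}$, $\mathbf n'=\{1',\dots,n'\}$. $\mathcal P_n$ is the set of all set partitions of $\mathbf n\cup\mathbf n'$. To form $\alpha\beta$: rename each lower point $i'$ of $\alpha$ to $i''$ and each upper point $i$ of $\beta$ to $i''$, and consider the graph on $\mathbf n\cup\mathbf n''\cup\mathbf n'$ whose edges join points lying in a common block of (renamed) $\alpha$ or of (renamed) $\beta$; two points of $\mathbf n\cup\mathbf n'$ lie in the same block of $\alpha\beta$ iff they are connected by a path in this graph. The identity is $\{\{i,i'\}:i\in\mathbf n\}$. A block is a transversal if it meets both $\mathbf n$ and $\mathbf n'$; $\operatorname{rank}(\alpha)$ is the number of transversals of $\alpha$. The $\mathscr J$-classes of $\mathcal P_n$ are $J_q=\{\alpha:\operatorname{rank}(\alpha)=q\}$, $0\le q\le n$. $\mathcal S_q$, $\mathcal A_q$ are the symmetric and alternating groups of degree $q$. For $\sigma\in\mathcal S_q$, $\overline\sigma\in J_q$ is the partition with transversals $\{i,(i\sigma)'\}$ ($1\le i\le q$) and all other blocks singletons; for $N\subseteq\mathcal S_q$, $\overline N=\{\overline\sigma:\sigma\in N\}$. Then $\overline{\mathcal S}_q$ is a maximal subgroup contained in $J_q$. **General constructions**, for a finite semigroup $S$ with minimal ideal $M$. $S^1$ is $S$ with an identity adjoined if necessary; $\mathscr R,\mathscr L,\mathscr H,\mathscr J$ are Green's relations; the $\mathscr J$-classes are ordered by $J_a\le J_b$ iff $a\in S^1bS^1$. $\Delta=\{(a,a):a\in S\}$,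 $\nabla=S\times S$. Ideals are non-empty. The Rees congruence of an ideal $I$ is $R_I=\Delta\cup(I\times I)$. An ideal $I$ is retractable if there is a homomorphism $f:I\to M$ (a retraction) with $xf=x$ for all $x\in M$; such $f$ is then unique. An IN-pair is a pair $(I,N)$ where $I$ is an ideal and $N$ is a normal subgroup of a maximal subgroup of $S$ contained in some regular $\mathscr J$-class $J$ that is minimal among the $\mathscr J$-classes contained in $S\setminus I$; it is proper if $|N|\ge2$. Put $\nu_N=\{(sxt,syt)\in J\times J: x,y\in N,\ s,t\in S^1\}$ and $R_{I,N}=\Delta\cup\nu_N\cup(I\times I)$. The IN-pair is retractable if $I$ is retractable and $|xN|=|Nx|=1$ for all $x\in M$; then, with $f:I\to M$ the retraction, $\lambda_{I,N}=\Delta\cup\nu_N\cup\{(x,y)\in I\times I:xf\mathrel{\mathscr L}yf\}$, $\rho_{I,N}=\Delta\cup\nu_N\cup\{(x,y)\in I\times I:xf\mathrel{\mathscr R}yf\}$, $\mu_{I,N}=\Delta\cup\nu_N\cup\{(x,y)\in I\times I:xf\mathrel{\mathscr H}yf\}$. **Abbreviations.** $\lambda_0=\lambda_{\mathscr C_0}$, $\lambda_1=\lambda_{\mathscr C_1}$, $\lambda_{\mathcal S_2}=\lambda_{\mathscr C_{\mathcal S_2}}$, and similarly for $\rho,\mu$. In (v), $R_{\mathcal S_2}$ is the congruence $R_N$ with $N=\mathcal S_2$. *)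

theory Defs
  imports "HOL-Algebra.Sym_Groups" "HOL-Library.Disjoint_Sets"
begin

section \<open>Ideals, Green's relations and congruences\<close>

text \<open>
  Everything in the general part is stated for a monoid \<open>S\<close> (a record of HOL-Algebra), so that
  \<open>S\<^sup>1 = S\<close>. Only the fields \<open>carrier\<close> and \<open>mult\<close> are used.
\<close>

definition sg_ideal :: "('a, 'b) monoid_scheme \<Rightarrow> 'a set \<Rightarrow> bool" where
  "sg_ideal S I \<longleftrightarrow> I \<noteq> {} \<and> I \<subseteq> carrier S \<and>
     (\<forall>x\<in>I. \<forall>s\<in>carrier S. s \<otimes>\<^bsub>S\<^esub> x \<in> I \<and> x \<otimes>\<^bsub>S\<^esub> s \<in> I)"

definition min_ideal :: "('a, 'b) monoid_scheme \<Rightarrow> 'a set" where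
  "min_ideal S = (THE M. sg_ideal S M \<and> (\<forall>I. sg_ideal S I \<and> I \<subseteq> M \<longrightarrow> I = M))"

definition green_L :: "('a, 'b) monoid_scheme \<Rightarrow> 'a rel" where
  "green_L S = {(a, b). a \<in> carrier S \<and> b \<in> carrier S \<and>
     {s \<otimes>\<^bsub>S\<^esub> a | s. s \<in> carrier S} = {s \<otimes>\<^bsub>S\<^esub> b | s. s \<in> carrier S}}"

definition green_R :: "('a, 'b) monoid_scheme \<Rightarrow> 'a rel" where
  "green_R S = {(a, b). a \<in> carrier S \<and> b \<in> carrier S \<and>
     {a \<otimes>\<^bsub>S\<^esub> t | t. t \<in> carrier S} = {b \<otimes>\<^bsub>S\<^esub> t | t. t \<in> carrier S}}"

definition green_H :: "('a, 'b) monoid_scheme \<Rightarrow> 'a rel" where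
  "green_H S = green_L S \<inter> green_R S"

definition princ_ideal :: "('a, 'b) monoid_scheme \<Rightarrow> 'a \<Rightarrow> 'a set" where
  "princ_ideal S a = {s \<otimes>\<^bsub>S\<^esub> a \<otimes>\<^bsub>S\<^esub> t | s t. s \<in> carrier S \<and> t \<in> carrier S}"

definition green_J :: "('a, 'b) monoid_scheme \<Rightarrow> 'a rel" where
  "green_J S = {(a, b). a \<in> carrier S \<and> b \<in> carrier S \<and> princ_ideal S a = princ_ideal S b}"

definition J_classes :: "('a, 'b) monoid_scheme \<Rightarrow> 'a set set" where
  "J_classes S = carrier S // green_J S"

definition J_le :: "('a, 'b) monoid_scheme \<Rightarrow> 'a set \<Rightarrow> 'a set \<Rightarrow> bool" where
  "J_le S J J' \<longleftrightarrow> (\<exists>a\<in>J. \<exists>b\<in>J'. a \<in> princ_ideal S b)"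

definition regular_set :: "('a, 'b) monoid_scheme \<Rightarrow> 'a set \<Rightarrow> bool" where
  "regular_set S J \<longleftrightarrow> (\<forall>a\<in>J. \<exists>x\<in>carrier S. a \<otimes>\<^bsub>S\<^esub> x \<otimes>\<^bsub>S\<^esub> a = a)"

definition minimal_outside :: "('a, 'b) monoid_scheme \<Rightarrow> 'a set \<Rightarrow> 'a set \<Rightarrow> bool" where
  "minimal_outside S I J \<longleftrightarrow> J \<in> J_classes S \<and> J \<subseteq> carrier S - I \<and>
     (\<forall>J'\<in>J_classes S. J' \<subseteq> carrier S - I \<and> J_le S J' J \<longrightarrow> J' = J)"

definition congruences :: "('a, 'b) monoid_scheme \<Rightarrow> 'a rel set" where
  "congruences S = {r. equiv (carrier S) r \<and>
     (\<forall>(a, b)\<in>r. \<forall>s\<in>carrier S.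
        (s \<otimes>\<^bsub>S\<^esub> a, s \<otimes>\<^bsub>S\<^esub> b) \<in> r \<and> (a \<otimes>\<^bsub>S\<^esub> s, b \<otimes>\<^bsub>S\<^esub> s) \<in> r)}"

text \<open>A subgroup of \<open>S\<close> has its own identity \<open>e\<close>, an idempotent of \<open>S\<close>.\<close>

definition subgroup_at :: "('a, 'b) monoid_scheme \<Rightarrow> 'a set \<Rightarrow> 'a \<Rightarrow> 'a monoid" where
  "subgroup_at S G e = \<lparr>carrier = G, mult = mult S, one = e\<rparr>"

definition is_subgroup_at :: "('a, 'b) monoid_scheme \<Rightarrow> 'a set \<Rightarrow> 'a \<Rightarrow> bool" where
  "is_subgroup_at S G e \<longleftrightarrow> G \<subseteq> carrier S \<and> group (subgroup_at S G e)"

definition maximal_subgroup_at :: "('a, 'b) monoid_scheme \<Rightarrow> 'a set \<Rightarrow> 'a \<Rightarrow> bool" where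
  "maximal_subgroup_at S G e \<longleftrightarrow> is_subgroup_at S G e \<and>
     (\<forall>G' e'. is_subgroup_at S G' e' \<and> G \<subseteq> G' \<longrightarrow> G' = G)"


section \<open>Retractable ideals, IN-pairs and their congruences\<close>

text \<open>The condition \<open>f \<in> extensional I\<close> makes the (unique) retraction unique as a HOL function.\<close>

definition is_retraction :: "('a, 'b) monoid_scheme \<Rightarrow> 'a set \<Rightarrow> ('a \<Rightarrow> 'a) \<Rightarrow> bool" where
  "is_retraction S I f \<longleftrightarrow>
     f \<in> hom (S\<lparr>carrier := I\<rparr>) (S\<lparr>carrier := min_ideal S\<rparr>) \<and> f \<in> extensional I \<and>
     (\<forall>x\<in>min_ideal S. f x = x)"

definition retraction_of :: "('a, 'b) monoid_scheme \<Rightarrow> 'a set \<Rightarrow> 'a \<Rightarrow> 'a" where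
  "retraction_of S I = (THE f. is_retraction S I f)"

definition retractable_ideal :: "('a, 'b) monoid_scheme \<Rightarrow> 'a set \<Rightarrow> bool" where
  "retractable_ideal S I \<longleftrightarrow> sg_ideal S I \<and> (\<exists>f. is_retraction S I f)"

definition IN_pair :: "('a, 'b) monoid_scheme \<Rightarrow> 'a set \<Rightarrow> 'a set \<Rightarrow> bool" where
  "IN_pair S I N \<longleftrightarrow> sg_ideal S I \<and>
     (\<exists>J G e. minimal_outside S I J \<and> regular_set S J \<and>
        maximal_subgroup_at S G e \<and> G \<subseteq> J \<and> normal N (subgroup_at S G e))"

definition proper_IN_pair :: "('a, 'b) monoid_scheme \<Rightarrow> 'a set \<Rightarrow> 'a set \<Rightarrow> bool" where
  "proper_IN_pair S I N \<longleftrightarrow> IN_pair S I N \<and> card N \<ge> 2"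

definition retractable_IN_pair :: "('a, 'b) monoid_scheme \<Rightarrow> 'a set \<Rightarrow> 'a set \<Rightarrow> bool" where
  "retractable_IN_pair S I N \<longleftrightarrow> IN_pair S I N \<and> retractable_ideal S I \<and>
     (\<forall>x\<in>min_ideal S. card (x <#\<^bsub>S\<^esub> N) = 1 \<and> card (N #>\<^bsub>S\<^esub> x) = 1)"

text \<open>
  The \<open>\<J>\<close>-class \<open>J\<close> of an IN-pair is the one containing \<open>N\<close>, so that membership in \<open>J\<close> means
  being \<open>\<J>\<close>-related to an element of \<open>N\<close>.
\<close>

definition nu :: "('a, 'b) monoid_scheme \<Rightarrow> 'a set \<Rightarrow> 'a rel" where
  "nu S N = {(s \<otimes>\<^bsub>S\<^esub> x \<otimes>\<^bsub>S\<^esub> t, s \<otimes>\<^bsub>S\<^esub> y \<otimes>\<^bsub>S\<^esub> t) | s t x y.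
     x \<in> N \<and> y \<in> N \<and> s \<in> carrier S \<and> t \<in> carrier S} \<inter> (green_J S `` N \<times> green_J S `` N)"

definition rees_cong :: "('a, 'b) monoid_scheme \<Rightarrow> 'a set \<Rightarrow> 'a rel" where
  "rees_cong S I = Id_on (carrier S) \<union> I \<times> I"

definition R_cong :: "('a, 'b) monoid_scheme \<Rightarrow> 'a set \<Rightarrow> 'a set \<Rightarrow> 'a rel" where
  "R_cong S I N = Id_on (carrier S) \<union> nu S N \<union> I \<times> I"

definition retr_cong :: "'a rel \<Rightarrow> ('a, 'b) monoid_scheme \<Rightarrow> 'a set \<Rightarrow> 'a set \<Rightarrow> 'a rel" where
  "retr_cong K S I N = Id_on (carrier S) \<union> nu S N \<union>
     {(x, y). x \<in> I \<and> y \<in> I \<and> (retraction_of S I x, retraction_of S I y) \<in> K}"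

definition lambda_cong :: "('a, 'b) monoid_scheme \<Rightarrow> 'a set \<Rightarrow> 'a set \<Rightarrow> 'a rel" where
  "lambda_cong S = retr_cong (green_L S) S"

definition rho_cong :: "('a, 'b) monoid_scheme \<Rightarrow> 'a set \<Rightarrow> 'a set \<Rightarrow> 'a rel" where
  "rho_cong S = retr_cong (green_R S) S"

definition mu_cong :: "('a, 'b) monoid_scheme \<Rightarrow> 'a set \<Rightarrow> 'a set \<Rightarrow> 'a rel" where
  "mu_cong S = retr_cong (green_H S) S"


section \<open>The partition monoid\<close>

text \<open>
  \<open>Up i\<close> is \<open>i\<close>, \<open>Lo i\<close> is \<open>i'\<close>; the points \<open>Mid i\<close>, standing for \<open>i''\<close>, only occur in product graphs.
\<close>

datatype pt = Up nat | Mid nat | Lo nat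

definition points :: "nat \<Rightarrow> pt set" where
  "points n = Up ` {1..n} \<union> Lo ` {1..n}"

fun lower_to_mid :: "pt \<Rightarrow> pt" where
  "lower_to_mid (Lo i) = Mid i"
| "lower_to_mid p = p"

fun upper_to_mid :: "pt \<Rightarrow> pt" where
  "upper_to_mid (Up i) = Mid i"
| "upper_to_mid p = p"

definition product_graph :: "pt set set \<Rightarrow> pt set set \<Rightarrow> pt rel" where
  "product_graph \<alpha> \<beta> =
     (\<Union>B\<in>\<alpha>. lower_to_mid ` B \<times> lower_to_mid ` B) \<union> (\<Union>B\<in>\<beta>. upper_to_mid ` B \<times> upper_to_mid ` B)"

definition part_mult :: "nat \<Rightarrow> pt set set \<Rightarrow> pt set set \<Rightarrow> pt set set" where
  "part_mult n \<alpha> \<beta> = points n // ((product_graph \<alpha> \<beta>)\<^sup>* \<inter> points n \<times> points n)"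

definition part_monoid :: "nat \<Rightarrow> pt set set monoid" where
  "part_monoid n = \<lparr>carrier = {\<alpha>. partition_on (points n) \<alpha>}, mult = part_mult n,
     one = {{Up i, Lo i} | i. i \<in> {1..n}}\<rparr>"

definition part_rank :: "pt set set \<Rightarrow> nat" where
  "part_rank \<alpha> = card {B \<in> \<alpha>. (\<exists>i. Up i \<in> B) \<and> (\<exists>j. Lo j \<in> B)}"

definition I_ideal :: "nat \<Rightarrow> nat \<Rightarrow> pt set set set" where
  "I_ideal n q = {\<alpha> \<in> carrier (part_monoid n). part_rank \<alpha> \<le> q}"

text \<open>
  Permutations act on the right in the definition of \<open>bar\<close>, whereas the product of \<open>sym_group q\<close> is
  composition of functions acting on the left. So \<open>bar n q\<close> reverses products; the subgroups and
  normal subgroups of a group and of its opposite are the same.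
\<close>

definition bar :: "nat \<Rightarrow> nat \<Rightarrow> (nat \<Rightarrow> nat) \<Rightarrow> pt set set" where
  "bar n q \<sigma> = {{Up i, Lo (\<sigma> i)} | i. i \<in> {1..q}} \<union>
     {{Up i} | i. i \<in> {q<..n}} \<union> {{Lo i} | i. i \<in> {q<..n}}"

definition S_bar :: "nat \<Rightarrow> nat \<Rightarrow> pt set set set" where
  "S_bar n q = bar n q ` carrier (sym_group q)"

definition le_S_bar :: "nat \<Rightarrow> nat \<Rightarrow> pt set set set \<Rightarrow> bool" where
  "le_S_bar n q M \<longleftrightarrow> subgroup M (subgroup_at (part_monoid n) (S_bar n q) (bar n q id))"

definition Klein4 :: "(nat \<Rightarrow> nat) set" where
  "Klein4 = {id, transpose 1 2 \<circ> transpose 3 4, transpose 1 3 \<circ> transpose 2 4,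
     transpose 1 4 \<circ> transpose 2 3}"

definition nontriv_normal :: "nat \<Rightarrow> (nat \<Rightarrow> nat) set \<Rightarrow> bool" where
  "nontriv_normal q N \<longleftrightarrow> normal N (sym_group q) \<and> N \<noteq> {id}"


section \<open>The named congruences and the order\<close>

definition R_rees :: "nat \<Rightarrow> nat \<Rightarrow> pt set set rel" where
  "R_rees n q = rees_cong (part_monoid n) (I_ideal n q)"

definition R_norm :: "nat \<Rightarrow> nat \<Rightarrow> (nat \<Rightarrow> nat) set \<Rightarrow> pt set set rel" where
  "R_norm n q N = R_cong (part_monoid n) (I_ideal n (q - 1)) (bar n q ` N)"

datatype chain3 = C0 | C1 | CS2

fun C_pair :: "nat \<Rightarrow> chain3 \<Rightarrow> pt set set set \<times> pt set set set" where
  "C_pair n C0 = (I_ideal n 0, {bar n 1 id})"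
| "C_pair n C1 = (I_ideal n 1, {bar n 2 id})"
| "C_pair n CS2 = (I_ideal n 1, S_bar n 2)"

datatype diamond = Mu | Lambda | Rho | RR

fun xi :: "nat \<Rightarrow> diamond \<Rightarrow> chain3 \<Rightarrow> pt set set rel" where
  "xi n Mu i = case_prod (mu_cong (part_monoid n)) (C_pair n i)"
| "xi n Lambda i = case_prod (lambda_cong (part_monoid n)) (C_pair n i)"
| "xi n Rho i = case_prod (rho_cong (part_monoid n)) (C_pair n i)"
| "xi n RR C0 = R_rees n 0"
| "xi n RR C1 = R_rees n 1"
| "xi n RR CS2 = R_norm n 2 (carrier (sym_group 2))"

fun le_chain3 :: "chain3 \<Rightarrow> chain3 \<Rightarrow> bool" where
  "le_chain3 C0 j \<longleftrightarrow> True"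
| "le_chain3 C1 j \<longleftrightarrow> j \<noteq> C0"
| "le_chain3 CS2 j \<longleftrightarrow> j = CS2"

definition le_diamond :: "diamond \<Rightarrow> diamond \<Rightarrow> bool" where
  "le_diamond x y \<longleftrightarrow> x = Mu \<or> x = y \<or> y = RR"

text \<open>
  Names for the congruences in the classification; pairwise distinctness of the congruences is
  injectivity of the map \<open>cong_of n\<close> on the set \<open>cong_names n\<close>.
\<close>

datatype cong_name = Rees nat | Norm nat "(nat \<Rightarrow> nat) set" | Retr diamond chain3

definition cong_names :: "nat \<Rightarrow> cong_name set" where
  "cong_names n = {Rees q | q. q \<le> n} \<union>
     {Norm q N | q N. 2 \<le> q \<and> q \<le> n \<and> nontriv_normal q N} \<union>
     {Retr x i | x i. x \<in> {Mu, Lambda, Rho}}"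

fun cong_of :: "nat \<Rightarrow> cong_name \<Rightarrow> pt set set rel" where
  "cong_of n (Rees q) = R_rees n q"
| "cong_of n (Norm q N) = R_norm n q N"
| "cong_of n (Retr x i) = xi n x i"

text \<open>The part of the chain belonging to degree \<open>q\<close>, and the whole chain from \<open>R_{S_2}\<close> to \<open>R_n\<close>.\<close>

definition chain_layer :: "nat \<Rightarrow> nat \<Rightarrow> pt set set rel list" where
  "chain_layer n q =
     (if q = 2 then [] else if q = 4 then [R_norm n 4 Klein4, R_norm n 4 (carrier (alt_group 4))]
      else [R_norm n q (carrier (alt_group q))]) @
     [R_norm n q (carrier (sym_group q)), R_rees n q]"

definition upper_chain :: "nat \<Rightarrow> pt set set rel list" where
  "upper_chain n = concat (map (chain_layer n) [2..<Suc n])"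

end

(* A partition alpha is identified with the set of pairs (A, B) of subsets of {1..n} for which
   A together with the primed copy of B is a union of blocks. The product of partitions becomes
   the composition of relations, so that associativity and all concrete products are read off from
   relations, and rank(alpha) = q says that alpha and the idempotent e_q generate the same ideal.

   Let xi be a congruence. If xi relates two elements of rank at most q, one of them of rank q, that
   are not H-related, then multiplying by suitable elements relates e_q to an element of smaller
   rank. For q >= 2 this forces xi to collapse the whole ideal I_q. Hence above the largest
   collapsed rank q, xi consists of H-related pairs; these live in rank q + 1 only, where they are
   given by a normal subgroup of S_{q+1}. If no rank above 1 collapses, then outside I_1 the
   congruence contains at most the pairs given by S_2, and on I_1 it is determined by three bits:
   whether e_1 is related to an element of rank 0, whether two related elements have different upper
   kernels, and whether two related elements have different lower kernels. *)
theory Submission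
  imports Defs
begin


section \<open>Normal subgroups of the symmetric groups\<close>

text \<open>The thresholds 1 and 2 come from two closure properties of the unions of blocks of a
  partition: the empty set and the whole set are such unions, and so is the complement of one. A
  single thread can therefore always be continued by a constant label, so it transmits nothing to or
  from \<open>e 0\<close>; this makes I_1 retractable. Two threads can transmit a connection between
  two points, which no retraction of I_2 survives. Still, exchanging the labels of two threads
  either changes nothing or amounts to complementation, so S_2 remains compatible with lambda, rho
  and mu. A collapse in rank q passes down to smaller ranks because a loss of rank shows up on at
  most two upper points: one outside the domain, or two that are connected. Two points fit into
  every rank m \<ge> 2 but not into rank 1, which needs an argument of its own. Statements about the
  lower row come from those about the upper row by the anti-involution \<open>flip\<close>.\<close>

lemma normal_sym_iff:
  "normal N (sym_group q) \<longleftrightarrow> N \<subseteq> {\<sigma>. \<sigma> permutes {1..q}} \<and> id \<in> N \<and>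
    (\<forall>\<sigma>\<in>N. \<forall>\<tau>\<in>N. \<sigma> \<circ> \<tau> \<in> N) \<and> (\<forall>\<sigma>\<in>N. inv' \<sigma> \<in> N) \<and>
    (\<forall>\<tau>. \<tau> permutes {1..q} \<longrightarrow> (\<forall>\<sigma>\<in>N. \<tau> \<circ> \<sigma> \<circ> inv' \<tau> \<in> N))" (is "?l \<longleftrightarrow> ?r")
proof -
  interpret group "sym_group q" by (rule sym_group_is_group)
  have inv: "inv\<^bsub>sym_group q\<^esub> \<sigma> = inv' \<sigma>" if "\<sigma> permutes {1..q}" for \<sigma>
    using that by (simp add: sym_group_carrier)
  have c: "carrier (sym_group q) = {\<sigma>. \<sigma> permutes {1..q}}" by (auto simp: sym_group_carrier)
  have "subgroup N (sym_group q) \<longleftrightarrow> N \<subseteq> {\<sigma>. \<sigma> permutes {1..q}} \<and> id \<in> N \<and>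
    (\<forall>\<sigma>\<in>N. \<forall>\<tau>\<in>N. \<sigma> \<circ> \<tau> \<in> N) \<and> (\<forall>\<sigma>\<in>N. inv' \<sigma> \<in> N)"
    unfolding subgroup_def c sym_group_mult sym_group_one using inv by (auto simp: subset_iff)
  then show ?thesis unfolding normal_inv_iff c sym_group_mult using inv by auto
qed

lemma transpose_conj:
  assumes "bij \<pi>" shows "\<pi> \<circ> transpose a b \<circ> inv' \<pi> = transpose (\<pi> a) (\<pi> b)"
proof -
  have "transpose (\<pi> a) (\<pi> b) \<circ> \<pi> = \<pi> \<circ> transpose a b"
    using transpose_comp_eq[OF assms, of "\<pi> a" "\<pi> b"] assms by (simp add: bij_is_inj)
  then have "\<pi> \<circ> transpose a b \<circ> inv' \<pi> = transpose (\<pi> a) (\<pi> b) \<circ> \<pi> \<circ> inv' \<pi>" by (simp only:)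
  also have "\<dots> = transpose (\<pi> a) (\<pi> b) \<circ> (\<pi> \<circ> inv' \<pi>)" by (simp only: comp_assoc)
  also have "\<pi> \<circ> inv' \<pi> = id" using assms by (auto simp: fun_eq_iff bij_is_surj surj_f_inv_f)
  finally show ?thesis by (simp only: comp_id)
qed

lemma transpose2_conj:
  assumes "bij \<pi>"
  shows "\<pi> \<circ> (transpose a b \<circ> transpose c d) \<circ> inv' \<pi> = transpose (\<pi> a) (\<pi> b) \<circ> transpose (\<pi> c) (\<pi> d)"
proof -
  have i: "inv' \<pi> (\<pi> x) = x" for x using assms by (simp add: bij_is_inj)
  show ?thesis unfolding transpose_conj[OF assms, symmetric] by (auto simp: fun_eq_iff i)
qed

text \<open>Three-transitivity of the symmetric group on any set. Each transposition puts one more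
  point in place and fixes the images already placed.\<close>

lemma permutes_three_points:
  assumes "a \<in> S" "b \<in> S" "c \<in> S" "a' \<in> S" "b' \<in> S" "c' \<in> S"
    and "distinct [a, b, c]" "distinct [a', b', c']"
  obtains \<pi> where "\<pi> permutes S" "\<pi> a = a'" "\<pi> b = b'" "\<pi> c = c'"
proof -
  define p1 where "p1 = transpose a a'"
  define p2 where "p2 = transpose (p1 b) b'"
  define p3 where "p3 = transpose (p2 (p1 c)) c'"
  have p1: "p1 permutes S" unfolding p1_def using assms by (intro permutes_swap_id)
  have i1: "p1 x \<in> S \<longleftrightarrow> x \<in> S" for x by (rule permutes_in_image[OF p1])
  have p2: "p2 permutes S" unfolding p2_def using assms i1 by (intro permutes_swap_id) auto
  have i2: "p2 x \<in> S \<longleftrightarrow> x \<in> S" for x by (rule permutes_in_image[OF p2])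
  have p3: "p3 permutes S" unfolding p3_def using assms i1 i2 by (intro permutes_swap_id) auto
  have j: "p1 x = p1 y \<longleftrightarrow> x = y" "p2 x = p2 y \<longleftrightarrow> x = y" for x y
    using permutes_inj[OF p1] permutes_inj[OF p2] by (meson injD)+
  have "p1 a = a'" by (simp add: p1_def)
  then have 2: "p2 (p1 a) = a'" unfolding p2_def using assms(7,8) j(1)[of a b] by (auto simp: transpose_def)
  have 3: "p2 (p1 b) = b'" by (simp add: p2_def)
  have "p3 (p2 (p1 a)) = a'" "p3 (p2 (p1 b)) = b'"
    unfolding p3_def using 2 3 assms(7,8) j(1)[of a c] j(1)[of b c] j(2)[of "p1 a" "p1 c"] j(2)[of "p1 b" "p1 c"]
    by (auto simp: transpose_def)
  moreover have "p3 (p2 (p1 c)) = c'" by (simp add: p3_def)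
  moreover have "(p3 \<circ> (p2 \<circ> p1)) permutes S" by (intro permutes_compose p1 p2 p3)
  ultimately show ?thesis using that by simp
qed

context
  fixes N q assumes N: "normal N (sym_group q)"
begin

lemma normal_sym_permutes: "\<sigma> \<in> N \<Longrightarrow> \<sigma> permutes {1..q}"
  and normal_sym_id: "id \<in> N" and normal_sym_comp: "\<sigma> \<in> N \<Longrightarrow> \<tau> \<in> N \<Longrightarrow> \<sigma> \<circ> \<tau> \<in> N"
  and normal_sym_inv: "\<sigma> \<in> N \<Longrightarrow> inv' \<sigma> \<in> N"
  and normal_sym_conj: "\<tau> permutes {1..q} \<Longrightarrow> \<sigma> \<in> N \<Longrightarrow> \<tau> \<circ> \<sigma> \<circ> inv' \<tau> \<in> N"
  using N unfolding normal_sym_iff by blast+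

text \<open>Conjugation carries one 3-cycle to every other, because S_q is three-transitive, and the
  3-cycles generate A_q.\<close>

lemma alt_subset:
  assumes "transpose a b \<circ> transpose b c \<in> N" "distinct [a, b, c]" "{a, b, c} \<subseteq> {1..q}"
  shows "carrier (alt_group q) \<subseteq> N"
proof -
  have all: "transpose a' b' \<circ> transpose b' c' \<in> N" if d: "distinct [a', b', c']" "{a', b', c'} \<subseteq> {1..q}" for a' b' c'
  proof -
    obtain \<pi> where p: "\<pi> permutes {1..q}" "\<pi> a = a'" "\<pi> b = b'" "\<pi> c = c'"
      by (rule permutes_three_points[of a "{1..q}" b c a' b' c']) (use assms(2,3) d in auto)
    show ?thesis using normal_sym_conj[OF p(1) assms(1)] transpose2_conj[OF permutes_bij[OF p(1)]] p by simp
  qed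
  have tc: "three_cycles q \<subseteq> N"
  proof
    fix p assume "p \<in> three_cycles q"
    then obtain cs where cs: "p = cycle_of_list cs" "cycle cs" "length cs = 3" "set cs \<subseteq> {1..q}" by blast
    define x y z where "x = cs ! 0" and "y = cs ! 1" and "z = cs ! 2"
    have "cs = [x, y, z]" unfolding x_def y_def z_def by (rule stupid_lemma[OF cs(3)])
    then show "p \<in> N" using all[of x y z] cs by simp
  qed
  show ?thesis
  proof
    fix p assume "p \<in> carrier (alt_group q)"
    then have "p \<in> generate (alt_group q) (three_cycles q)" using alt_group_carrier_as_three_cycles by simp
    then show "p \<in> N"
    proof induction
      case one then show ?case using normal_sym_id unfolding alt_group_one .
    next
      case (incl h) then show ?case using tc by blast
    next
      case (inv h)
      then have "h \<in> carrier (alt_group q)" using three_cycles_incl by blast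
      then show ?case using alt_group_inv_equality[of h q] normal_sym_inv tc inv by auto
    next
      case (eng h1 h2) then show ?case unfolding alt_group_mult by (intro normal_sym_comp)
    qed
  qed
qed

text \<open>The commutator of \<open>\<sigma>\<close> and a transposition is a product of two transpositions. It is a 3-cycle unless
  \<open>\<sigma>\<close> is a fixed-point-free involution, which accounts for the Klein 4-group.\<close>

lemma commutator_mem:
  assumes "\<sigma> \<in> N" "x \<in> {1..q}" "c \<in> {1..q}"
  shows "transpose (\<sigma> x) (\<sigma> c) \<circ> transpose x c \<in> N"
proof -
  let ?t = "transpose x c"
  have p: "\<sigma> permutes {1..q}" using normal_sym_permutes assms(1) by blast
  have t: "?t permutes {1..q}" using assms by (intro permutes_swap_id)
  have "?t \<circ> inv' \<sigma> \<circ> inv' ?t \<in> N" using normal_sym_conj[OF t] normal_sym_inv assms(1) by blast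
  then have "\<sigma> \<circ> (?t \<circ> inv' \<sigma> \<circ> ?t) \<in> N" using normal_sym_comp assms(1) by simp
  then have "(\<sigma> \<circ> ?t \<circ> inv' \<sigma>) \<circ> ?t \<in> N" by (simp add: comp_assoc)
  then show ?thesis by (simp add: transpose_conj[OF permutes_bij[OF p]])
qed

text \<open>With \<open>c\<close> the preimage of \<open>x\<close>, the two transpositions of the
  commutator share the point \<open>x\<close> and form a 3-cycle.\<close>

lemma alt_subset_noninvolution:
  assumes "\<sigma> \<in> N" "\<sigma> (\<sigma> x) \<noteq> x" shows "carrier (alt_group q) \<subseteq> N"
proof -
  have p: "\<sigma> permutes {1..q}" using normal_sym_permutes assms(1) by blast
  have x: "x \<in> {1..q}" using assms(2) permutes_not_in[OF p] by metis
  define c where "c = inv' \<sigma> x"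
  have sc: "\<sigma> c = x" using permutes_inverses(1)[OF p] by (simp add: c_def)
  have cq: "c \<in> {1..q}" using sc x permutes_in_image[OF p] by metis
  have yq: "\<sigma> x \<in> {1..q}" using x permutes_in_image[OF p] by metis
  have "transpose (\<sigma> x) x \<circ> transpose x c \<in> N" using commutator_mem[OF assms(1) x cq] sc by simp
  then show ?thesis by (rule alt_subset) (use sc assms(2) x cq yq in auto)
qed

text \<open>With a fixed point \<open>c\<close>, the two transpositions of the commutator share
  \<open>c\<close>.\<close>

lemma alt_subset_fixed_point:
  assumes "\<sigma> \<in> N" "\<sigma> x \<noteq> x" "\<sigma> c = c" "c \<in> {1..q}" shows "carrier (alt_group q) \<subseteq> N"
proof -
  have p: "\<sigma> permutes {1..q}" using normal_sym_permutes assms(1) by blast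
  have x: "x \<in> {1..q}" using assms(2) permutes_not_in[OF p] by metis
  have yq: "\<sigma> x \<in> {1..q}" using x permutes_in_image[OF p] by metis
  have xc: "\<sigma> x \<noteq> c" "x \<noteq> c" using assms(2,3) permutes_inj[OF p] by (metis injD)+
  have "transpose (\<sigma> x) c \<circ> transpose c x \<in> N"
    using commutator_mem[OF assms(1) x assms(4)] assms(3) by (simp add: transpose_commute)
  then show ?thesis by (rule alt_subset) (use xc assms x yq in auto)
qed

text \<open>A_q has index two, so a single odd element of \<open>N\<close> brings in all odd
  permutations.\<close>

lemma alt_or_sym:
  assumes "carrier (alt_group q) \<subseteq> N"
  shows "N = carrier (alt_group q) \<or> N = carrier (sym_group q)"
proof (cases "\<exists>\<rho>\<in>N. \<not> evenperm \<rho>")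
  case True
  then obtain \<rho> where r: "\<rho> \<in> N" "\<not> evenperm \<rho>" by blast
  have pr: "\<rho> permutes {1..q}" using normal_sym_permutes r by blast
  have perm: "permutation \<sigma>" if "\<sigma> permutes {1..q}" for \<sigma> using that permutation_permutes by blast
  have "\<pi> \<in> N" if pp: "\<pi> permutes {1..q}" for \<pi>
  proof (cases "evenperm \<pi>")
    case True then show ?thesis using assms pp alt_group_carrier by blast
  next
    case False
    have pi: "(inv' \<rho> \<circ> \<pi>) permutes {1..q}" using pp permutes_inv[OF pr] by (rule permutes_compose)
    have "evenperm (inv' \<rho> \<circ> \<pi>)"
      using evenperm_comp[OF perm[OF permutes_inv[OF pr]] perm[OF pp]] evenperm_inv[OF perm[OF pr]] r(2) False by simp
    then have "inv' \<rho> \<circ> \<pi> \<in> N" using pi assms alt_group_carrier by blast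
    then have "\<rho> \<circ> (inv' \<rho> \<circ> \<pi>) \<in> N" using normal_sym_comp r(1) by blast
    moreover have "\<rho> \<circ> (inv' \<rho> \<circ> \<pi>) = \<pi>" using permutes_inverses(1)[OF pr] by (auto simp: fun_eq_iff)
    ultimately show ?thesis by simp
  qed
  then show ?thesis using normal_sym_permutes sym_group_carrier by blast
next
  case False
  then show ?thesis using assms normal_sym_permutes alt_group_carrier by blast
qed

end

section \<open>The Klein four-group and the alternating group as normal subgroups\<close>

lemma Klein4_perm: "\<sigma> \<in> Klein4 \<Longrightarrow> \<sigma> permutes {1..4}"
  unfolding Klein4_def by (auto intro!: permutes_compose permutes_swap_id permutes_id)

lemma set4: "{1..4::nat} = {1, 2, 3, 4}"
  by auto

text \<open>A description by cycle type instead of a list makes invariance under conjugation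
  evident.\<close>

lemma Klein4_iff:
  "\<sigma> \<in> Klein4 \<longleftrightarrow> \<sigma> permutes {1..4} \<and> (\<sigma> = id \<or> (\<forall>x\<in>{1..4}. \<sigma> x \<noteq> x \<and> \<sigma> (\<sigma> x) = x))" (is "?l \<longleftrightarrow> ?r")
proof
  assume ?l
  moreover have "\<sigma> = id \<or> (\<forall>x\<in>{1..4}. \<sigma> x \<noteq> x \<and> \<sigma> (\<sigma> x) = x)"
    using \<open>?l\<close> unfolding Klein4_def set4 by (auto simp: transpose_def)
  ultimately show ?r using Klein4_perm by blast
next
  assume r: ?r
  show ?l
  proof (cases "\<sigma> = id")
    case True then show ?thesis by (simp add: Klein4_def)
  next
    case False
    then have s: "\<And>x. x \<in> {1..4} \<Longrightarrow> \<sigma> x \<noteq> x" "\<And>x. x \<in> {1..4} \<Longrightarrow> \<sigma> (\<sigma> x) = x" and p: "\<sigma> permutes {1..4}"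
      using r by auto
    have out: "\<sigma> x = x" if "x \<notin> {1..4}" for x using that permutes_not_in[OF p] by blast
    have im: "\<sigma> x \<in> {1, 2, 3, 4}" if "x \<in> {1, 2, 3, 4}" for x using permutes_in_image[OF p, of x] that unfolding set4 by blast
    have ext: "\<sigma> = \<tau>" if "\<sigma> 1 = \<tau> 1" "\<sigma> 2 = \<tau> 2" "\<sigma> 3 = \<tau> 3" "\<sigma> 4 = \<tau> 4" "\<tau> permutes {1..4}" for \<tau>
    proof
      fix x show "\<sigma> x = \<tau> x"
        using that(1-4) out[of x] permutes_not_in[OF that(5), of x] set4 by (cases "x \<in> {1..4}") auto
    qed
    have v: "\<sigma> 1 \<noteq> 1" "\<sigma> 2 \<noteq> 2" "\<sigma> 3 \<noteq> 3" "\<sigma> 4 \<noteq> 4" "\<sigma> (\<sigma> 1) = 1" "\<sigma> (\<sigma> 2) = 2" "\<sigma> (\<sigma> 3) = 3" "\<sigma> (\<sigma> 4) = 4"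
      using s by auto
    consider "\<sigma> 1 = 2" | "\<sigma> 1 = 3" | "\<sigma> 1 = 4" using im[of 1] v(1) by auto
    then show ?thesis
    proof cases
      case 1
      then have "\<sigma> 2 = 1" using v(5) by simp
      moreover from this have "\<sigma> 3 \<noteq> 1" "\<sigma> 3 \<noteq> 2" using v(5-8) 1 by auto
      then have "\<sigma> 3 = 4" using im[of 3] v(1-4) by auto
      moreover from this have "\<sigma> 4 = 3" using v(5-8) by auto
      ultimately have "\<sigma> = transpose 1 2 \<circ> transpose 3 4"
        using 1 by (intro ext) (auto simp: transpose_def intro!: permutes_compose permutes_swap_id)
      then show ?thesis by (simp add: Klein4_def)
    next
      case 2
      then have "\<sigma> 3 = 1" using v(5) by simp
      moreover from this have "\<sigma> 2 \<noteq> 1" "\<sigma> 2 \<noteq> 3" using v(5-8) 2 by auto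
      then have "\<sigma> 2 = 4" using im[of 2] v(1-4) by auto
      moreover from this have "\<sigma> 4 = 2" using v(5-8) by auto
      ultimately have "\<sigma> = transpose 1 3 \<circ> transpose 2 4"
        using 2 by (intro ext) (auto simp: transpose_def intro!: permutes_compose permutes_swap_id)
      then show ?thesis by (simp add: Klein4_def)
    next
      case 3
      then have "\<sigma> 4 = 1" using v(5) by simp
      moreover from this have "\<sigma> 2 \<noteq> 1" "\<sigma> 2 \<noteq> 4" using v(5-8) 3 by auto
      then have "\<sigma> 2 = 3" using im[of 2] v(1-4) by auto
      moreover from this have "\<sigma> 3 = 2" using v(5-8) by auto
      ultimately have "\<sigma> = transpose 1 4 \<circ> transpose 2 3"
        using 3 by (intro ext) (auto simp: transpose_def intro!: permutes_compose permutes_swap_id)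
      then show ?thesis by (simp add: Klein4_def)
    qed
  qed
qed

lemma Klein4_comp: "\<sigma> \<in> Klein4 \<Longrightarrow> \<tau> \<in> Klein4 \<Longrightarrow> \<sigma> \<circ> \<tau> \<in> Klein4"
  unfolding Klein4_def by (elim insertE emptyE; hypsubst) (auto simp: fun_eq_iff transpose_def)

lemma normal_Klein4: "normal Klein4 (sym_group 4)"
  unfolding normal_sym_iff
proof (intro conjI ballI allI impI)
  show "Klein4 \<subseteq> {\<sigma>. \<sigma> permutes {1..4}}" using Klein4_perm by blast
  show "id \<in> Klein4" by (simp add: Klein4_def)
  show "\<sigma> \<circ> \<tau> \<in> Klein4" if "\<sigma> \<in> Klein4" "\<tau> \<in> Klein4" for \<sigma> \<tau> using that by (rule Klein4_comp)
  show "inv' \<sigma> \<in> Klein4" if s: "\<sigma> \<in> Klein4" for \<sigma>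
  proof -
    have "\<sigma> \<circ> \<sigma> = id" using s unfolding Klein4_def by (auto simp: fun_eq_iff transpose_def)
    then have "inv' \<sigma> = \<sigma>" by (rule inv_unique_comp[rotated]) fact
    then show ?thesis using s by simp
  qed
  show "\<tau> \<circ> \<sigma> \<circ> inv' \<tau> \<in> Klein4" if t: "\<tau> permutes {1..4}" and s: "\<sigma> \<in> Klein4" for \<tau> \<sigma>
  proof -
    have inv: "inv' \<tau> (\<tau> x) = x" "\<tau> (inv' \<tau> x) = x" for x using permutes_inverses[OF t] by auto
    have "(\<tau> \<circ> \<sigma> \<circ> inv' \<tau>) permutes {1..4}" using t permutes_inv[OF t] Klein4_perm[OF s] by (intro permutes_compose)
    moreover have "\<tau> \<circ> \<sigma> \<circ> inv' \<tau> = id \<or> (\<forall>x\<in>{1..4}. (\<tau> \<circ> \<sigma> \<circ> inv' \<tau>) x \<noteq> x \<and> (\<tau> \<circ> \<sigma> \<circ> inv' \<tau>) ((\<tau> \<circ> \<sigma> \<circ> inv' \<tau>) x) = x)"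
    proof (cases "\<sigma> = id")
      case True then show ?thesis using inv by (auto simp: fun_eq_iff)
    next
      case False
      then have f: "\<forall>x\<in>{1..4}. \<sigma> x \<noteq> x \<and> \<sigma> (\<sigma> x) = x" using s Klein4_iff by blast
      have "(\<tau> \<circ> \<sigma> \<circ> inv' \<tau>) x \<noteq> x \<and> (\<tau> \<circ> \<sigma> \<circ> inv' \<tau>) ((\<tau> \<circ> \<sigma> \<circ> inv' \<tau>) x) = x" if "x \<in> {1..4}" for x
      proof -
        have y: "inv' \<tau> x \<in> {1..4}" using permutes_in_image[OF permutes_inv[OF t]] that by blast
        have "\<tau> (\<sigma> (inv' \<tau> x)) \<noteq> x" using f y inv by metis
        then show ?thesis using f y inv by simp
      qed
      then show ?thesis by blast
    qed
    ultimately show ?thesis unfolding Klein4_iff by blast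
  qed
qed

lemma normal_alt: "normal (carrier (alt_group q)) (sym_group q)"
  unfolding normal_sym_iff
proof (intro conjI ballI allI impI)
  have perm: "permutation \<sigma>" if "\<sigma> permutes {1..q}" for \<sigma> using that permutation_permutes by blast
  show "carrier (alt_group q) \<subseteq> {\<sigma>. \<sigma> permutes {1..q}}" using alt_group_carrier by blast
  show "id \<in> carrier (alt_group q)" by (simp add: alt_group_carrier permutes_id)
  show "\<sigma> \<circ> \<tau> \<in> carrier (alt_group q)" if "\<sigma> \<in> carrier (alt_group q)" "\<tau> \<in> carrier (alt_group q)" for \<sigma> \<tau>
    using that perm by (auto simp: alt_group_carrier evenperm_comp permutes_compose)
  show "inv' \<sigma> \<in> carrier (alt_group q)" if "\<sigma> \<in> carrier (alt_group q)" for \<sigma>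
    using that perm by (auto simp: alt_group_carrier evenperm_inv permutes_inv)
  show "\<tau> \<circ> \<sigma> \<circ> inv' \<tau> \<in> carrier (alt_group q)" if t: "\<tau> permutes {1..q}" and s: "\<sigma> \<in> carrier (alt_group q)" for \<tau> \<sigma>
  proof -
    have p: "\<sigma> permutes {1..q}" "inv' \<tau> permutes {1..q}" "(\<tau> \<circ> \<sigma>) permutes {1..q}" and e: "evenperm \<sigma>"
      using s t permutes_inv permutes_compose unfolding alt_group_carrier by blast+
    have "evenperm (\<tau> \<circ> \<sigma> \<circ> inv' \<tau>)"
      using evenperm_comp[OF perm[OF p(3)] perm[OF p(2)]] evenperm_comp[OF perm[OF t] perm[OF p(1)]] evenperm_inv[OF perm[OF t]] e by simp
    then show ?thesis using p(2,3) permutes_compose unfolding alt_group_carrier by blast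
  qed
qed

lemma alt_nontrivial:
  assumes "3 \<le> q" shows "transpose 1 2 \<circ> transpose 2 3 \<in> carrier (alt_group q)" "carrier (alt_group q) \<noteq> {id}"
proof -
  have "evenperm (transpose 1 2 \<circ> transpose 2 (3::nat))"
    by (simp add: evenperm_comp evenperm_swap permutation_swap_id)
  then show 1: "transpose 1 2 \<circ> transpose 2 3 \<in> carrier (alt_group q)"
    using assms by (auto simp: alt_group_carrier intro!: permutes_compose permutes_swap_id)
  have "(transpose 1 2 \<circ> transpose 2 3) (3::nat) \<noteq> id 3" by (simp add: transpose_def)
  then have "transpose 1 2 \<circ> transpose 2 (3::nat) \<noteq> id" by metis
  then show "carrier (alt_group q) \<noteq> {id}" using 1 by blast
qed

lemma alt_proper:
  assumes "2 \<le> q" shows "carrier (alt_group q) \<subset> carrier (sym_group q)"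
proof -
  have "transpose 1 2 \<in> carrier (sym_group q)" using assms by (simp add: sym_group_carrier permutes_swap_id)
  moreover have "transpose 1 (2::nat) \<notin> carrier (alt_group q)" by (simp add: alt_group_carrier evenperm_swap)
  moreover have "carrier (alt_group q) \<subseteq> carrier (sym_group q)" by (auto simp: alt_group_carrier sym_group_carrier)
  ultimately show ?thesis by blast
qed

lemma Klein4_proper: "Klein4 \<subset> carrier (alt_group 4)"
proof
  show "Klein4 \<subseteq> carrier (alt_group 4)"
  proof
    fix \<sigma> assume s: "\<sigma> \<in> Klein4"
    then have "evenperm \<sigma>" unfolding Klein4_def by (auto simp: evenperm_comp evenperm_swap permutation_swap_id)
    then show "\<sigma> \<in> carrier (alt_group 4)" using Klein4_perm[OF s] by (simp add: alt_group_carrier)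
  qed
  have "transpose 1 2 \<circ> transpose 2 3 \<notin> Klein4"
  proof
    assume "transpose 1 2 \<circ> transpose 2 3 \<in> Klein4"
    moreover have "(transpose 1 2 \<circ> transpose 2 3) (4::nat) = 4" by (simp add: transpose_def)
    moreover have "(transpose 1 2 \<circ> transpose 2 3) (3::nat) \<noteq> id 3" by (simp add: transpose_def)
    then have "transpose 1 2 \<circ> transpose 2 (3::nat) \<noteq> id" by metis
    moreover have "4 \<in> {1..4::nat}" by simp
    ultimately show False unfolding Klein4_iff by blast
  qed
  then show "Klein4 \<noteq> carrier (alt_group 4)" using alt_nontrivial(1)[of 4] by auto
qed

section \<open>Classification of the normal subgroups of S_q\<close>

lemma nontriv_normal_2: "nontriv_normal 2 N \<longleftrightarrow> N = carrier (sym_group 2)"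
proof -
  have "{1..2::nat} = {1, 2}" by auto
  then have p: "\<sigma> permutes {1..2::nat} \<longleftrightarrow> \<sigma> = id \<or> \<sigma> = transpose 1 2" for \<sigma> by (simp only: permutes_doubleton_iff)
  have c: "carrier (sym_group 2) = {id, transpose 1 2}" using p sym_group_carrier by blast
  have "transpose 1 (2::nat) 1 \<noteq> id 1" by simp
  then have ne: "transpose 1 (2::nat) \<noteq> id" by metis
  have "normal (carrier (sym_group 2)) (sym_group 2)"
    unfolding normal_sym_iff by (auto simp: sym_group_carrier permutes_id permutes_inv intro!: permutes_compose)
  moreover have "N = carrier (sym_group 2)" if "normal N (sym_group 2)" "N \<noteq> {id}"
  proof -
    have "N \<subseteq> {id, transpose 1 2}" "id \<in> N" using that(1) p unfolding normal_sym_iff by auto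
    then show ?thesis unfolding c using that(2) by blast
  qed
  ultimately show ?thesis unfolding nontriv_normal_def using c ne by auto
qed

lemma normal_sym: "normal (carrier (sym_group q)) (sym_group q)"
  unfolding normal_sym_iff by (auto simp: sym_group_carrier permutes_id permutes_inv intro!: permutes_compose)

text \<open>If \<open>N\<close> does not contain A_q, the two criteria above leave only
  fixed-point-free involutions, and the commutator of such an element with a transposition is a
  product of two disjoint transpositions. A fifth point turns it into a 3-cycle; in degree 4 its
  conjugates fill the Klein group.\<close>

lemma normal_cases:
  assumes N: "normal N (sym_group q)" and ne: "N \<noteq> {id}" and q: "3 \<le> q"
  shows "carrier (alt_group q) \<subseteq> N \<or> (q = 4 \<and> N = Klein4)"
proof (rule ccontr)
  assume "\<not> ?thesis"
  then have na: "\<not> carrier (alt_group q) \<subseteq> N" and nk: "\<not> (q = 4 \<and> N = Klein4)" by auto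
  have fpf: "\<sigma> x \<noteq> x" "\<sigma> (\<sigma> x) = x" if "\<sigma> \<in> N" "\<sigma> \<noteq> id" "x \<in> {1..q}" for \<sigma> x
  proof -
    obtain y where "\<sigma> y \<noteq> y" using \<open>\<sigma> \<noteq> id\<close> by (auto simp: fun_eq_iff)
    then show "\<sigma> x \<noteq> x" using alt_subset_fixed_point[OF N \<open>\<sigma> \<in> N\<close>] na that(3) by blast
    show "\<sigma> (\<sigma> x) = x" using alt_subset_noninvolution[OF N \<open>\<sigma> \<in> N\<close>] na by blast
  qed
  obtain \<sigma> where s: "\<sigma> \<in> N" "\<sigma> \<noteq> id" using ne normal_sym_id[OF N] by blast
  have p: "\<sigma> permutes {1..q}" using normal_sym_permutes[OF N s(1)] .
  have im: "\<sigma> x \<in> {1..q}" if "x \<in> {1..q}" for x using permutes_in_image[OF p] that by blast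
  have inj: "\<sigma> x = \<sigma> y \<longleftrightarrow> x = y" for x y using permutes_inj[OF p] by (meson injD)
  note f = fpf[OF s]
  have one: "1 \<in> {1..q}" using q by simp
  \<comment> \<open>\<open>c\<close> avoids the 2-cycle of \<open>\<sigma>\<close> through 1, so
    that 1, \<open>c\<close> and their images are four different points.\<close>
  obtain c where c: "c \<in> {1..q}" "c \<noteq> 1" "c \<noteq> \<sigma> 1"
  proof -
    have "card {1, \<sigma> 1} \<le> 2" by (simp add: card_insert_if)
    then have "\<not> {1..q} \<subseteq> {1, \<sigma> 1}" using card_mono[of "{1, \<sigma> 1}" "{1..q}"] q by auto
    then show ?thesis using that by blast
  qed
  let ?y = "\<sigma> 1" and ?d = "\<sigma> c"
  have yd: "?y \<in> {1..q}" "?d \<in> {1..q}" using im one c by auto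
  have "?d \<noteq> 1" using f(2)[OF c(1)] c(3) by metis
  moreover have "?d \<noteq> ?y" using inj c(2) by simp
  ultimately have dist: "distinct [1, ?y, c, ?d]" using f(1)[OF one] f(1)[OF c(1)] c(2,3) by auto
  have D: "transpose ?y ?d \<circ> transpose 1 c \<in> N" by (rule commutator_mem[OF N s(1) one c(1)])
  have "card (set [1, ?y, c, ?d]) = 4" using distinct_card[OF dist] by simp
  moreover have sub: "set [1, ?y, c, ?d] \<subseteq> {1..q}" using one c yd by auto
  ultimately have q4: "4 \<le> q" using card_mono[OF _ sub] by simp
  show False
  proof (cases "q = 4")
    case False
    then have "5 \<le> q" using q4 by simp
    \<comment> \<open>Conjugation by the transposition of \<open>c\<close> and \<open>g\<close>
      replaces \<open>c\<close> by \<open>g\<close> in the double transposition; in the product of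
      both versions the common factor cancels and a 3-cycle is left.\<close>
    then obtain g where g: "g \<in> {1..q}" "g \<notin> set [1, ?y, c, ?d]"
      using card_mono[of "set [1, ?y, c, ?d]" "{1..q}"] \<open>card _ = 4\<close> by fastforce
    define t where "t = transpose c g"
    have t: "t permutes {1..q}" unfolding t_def using c g by (intro permutes_swap_id)
    have "t \<circ> (transpose ?y ?d \<circ> transpose 1 c) \<circ> inv' t \<in> N" by (rule normal_sym_conj[OF N t D])
    moreover have "t ?y = ?y" "t ?d = ?d" "t 1 = 1" "t c = g" using g dist by (auto simp: t_def transpose_def)
    ultimately have D': "transpose ?y ?d \<circ> transpose 1 g \<in> N" by (simp add: transpose2_conj[OF permutes_bij[OF t]])
    have "(transpose ?y ?d \<circ> transpose 1 c) \<circ> (transpose ?y ?d \<circ> transpose 1 g) = transpose c 1 \<circ> transpose 1 g"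
    proof -
      have "transpose ?y ?d \<circ> transpose 1 c \<circ> inv' (transpose ?y ?d) = transpose 1 c"
        unfolding transpose_conj[OF bij_transpose] using dist by simp
      then have "transpose ?y ?d \<circ> transpose 1 c \<circ> transpose ?y ?d \<circ> transpose 1 g = transpose 1 c \<circ> transpose 1 g"
        by simp
      then show ?thesis by (simp add: comp_assoc transpose_commute)
    qed
    then have "transpose c 1 \<circ> transpose 1 g \<in> N" using normal_sym_comp[OF N D D'] by simp
    then have "carrier (alt_group q) \<subseteq> N" by (rule alt_subset[OF N]) (use c g one in auto)
    then show False using na by blast
  next
    case True
    have "N \<subseteq> Klein4"
    proof
      fix \<tau> assume t: "\<tau> \<in> N"
      then show "\<tau> \<in> Klein4" unfolding Klein4_iff using normal_sym_permutes[OF N t] fpf[OF t] True by blast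
    qed
    moreover have "Klein4 \<subseteq> N"
    proof -
      \<comment> \<open>Three of the four images can be prescribed; the fourth is then
        forced.\<close>
      have K: "transpose a b \<circ> transpose c' d' \<in> N"
        if abcd: "{1..4} = {a, b, c', d'}" "distinct [a, b, c', d']" for a b c' d'
      proof -
        have abcd': "a \<in> {1..q}" "b \<in> {1..q}" "c' \<in> {1..q}" unfolding True using abcd by auto
        obtain \<pi> where \<pi>: "\<pi> permutes {1..q}" "\<pi> ?y = a" "\<pi> ?d = b" "\<pi> 1 = c'"
          by (rule permutes_three_points[of ?y "{1..q}" ?d 1 a b c']) (use abcd' abcd(2) yd one dist in auto)
        have "\<pi> c \<in> {1..q}" using permutes_in_image[OF \<pi>(1)] c(1) by blast
        then have "\<pi> c \<in> {a, b, c', d'}" unfolding True abcd(1) .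
        moreover have "\<pi> c \<noteq> \<pi> ?y" "\<pi> c \<noteq> \<pi> ?d" "\<pi> c \<noteq> \<pi> 1" using permutes_inj[OF \<pi>(1)] dist by (auto dest: injD)
        ultimately have "\<pi> c = d'" unfolding \<pi> by blast
        then show ?thesis
          using normal_sym_conj[OF N \<pi>(1) D] unfolding transpose2_conj[OF permutes_bij[OF \<pi>(1)]] \<pi> by (simp only:)
      qed
      show ?thesis unfolding Klein4_def using K[of 1 2 3 4] K[of 1 3 2 4] K[of 1 4 2 3] normal_sym_id[OF N] set4 by auto
    qed
    ultimately show False using nk True by blast
  qed
qed

lemma nontriv_normal_iff:
  assumes "3 \<le> q"
  shows "nontriv_normal q N \<longleftrightarrow> N = carrier (alt_group q) \<or> N = carrier (sym_group q) \<or> (q = 4 \<and> N = Klein4)"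
proof
  assume "nontriv_normal q N"
  then have N: "normal N (sym_group q)" "N \<noteq> {id}" by (auto simp: nontriv_normal_def)
  then show "N = carrier (alt_group q) \<or> N = carrier (sym_group q) \<or> (q = 4 \<and> N = Klein4)"
    using normal_cases[OF N assms] alt_or_sym[OF N(1)] by blast
next
  assume h: "N = carrier (alt_group q) \<or> N = carrier (sym_group q) \<or> (q = 4 \<and> N = Klein4)"
  have "carrier (sym_group q) \<noteq> {id}" using alt_nontrivial[OF assms] alt_proper[of q] assms by auto
  moreover have "Klein4 \<noteq> {id}"
  proof -
    have "transpose 1 2 \<circ> transpose 3 (4::nat) \<noteq> id" by (auto simp: fun_eq_iff transpose_def)
    then show ?thesis unfolding Klein4_def by blast
  qed
  ultimately show "nontriv_normal q N" unfolding nontriv_normal_def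
    using h normal_alt normal_sym normal_Klein4 alt_nontrivial(2)[OF assms] by blast
qed

section \<open>Partitions as relations between subsets\<close>

text \<open>\<open>Mid\<close> points lie in no block of an element of P_n, so their value is an
  arbitrary default.\<close>

fun lab :: "nat set \<Rightarrow> nat set \<Rightarrow> pt \<Rightarrow> bool" where
  "lab A B (Up i) = (i \<in> A)"
| "lab A B (Lo i) = (i \<in> B)"
| "lab A B (Mid i) = False"

fun swap_pt :: "pt \<Rightarrow> pt" where
  "swap_pt (Up i) = Lo i"
| "swap_pt (Lo i) = Up i"
| "swap_pt (Mid i) = Mid i"

definition conn :: "pt set set \<Rightarrow> pt \<Rightarrow> pt \<Rightarrow> bool" where
  "conn \<alpha> p q \<longleftrightarrow> (\<exists>X\<in>\<alpha>. p \<in> X \<and> q \<in> X)"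

text \<open>\<open>sat \<alpha> A B\<close> says that \<open>A\<close> together with the primed copy of \<open>B\<close> is a union of blocks of \<open>\<alpha>\<close>. The elements of
  \<open>A\<close> and \<open>B\<close> outside \<open>{1..n}\<close> are irrelevant.\<close>

definition sat :: "pt set set \<Rightarrow> nat set \<Rightarrow> nat set \<Rightarrow> bool" where
  "sat \<alpha> A B \<longleftrightarrow> (\<forall>p q. conn \<alpha> p q \<longrightarrow> lab A B p = lab A B q)"

text \<open>For \<open>E\<close> inside the points, this is the finest partition joining the pairs
  of \<open>E\<close>. Concrete elements are built in this way because \<open>sat_gen\<close> reads
  their relation off \<open>E\<close> without computing blocks.\<close>

definition gen :: "nat \<Rightarrow> pt rel \<Rightarrow> pt set set" where
  "gen n E = points n // ((E \<union> E\<inverse>)\<^sup>* \<inter> points n \<times> points n)"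

lemma conn_quotient:
  assumes "equiv X r" shows "conn (X // r) p q \<longleftrightarrow> (p, q) \<in> r"
proof
  assume "conn (X // r) p q"
  then obtain Y where "Y \<in> X // r" "p \<in> Y" "q \<in> Y" unfolding conn_def by blast
  then show "(p, q) \<in> r" using assms quotient_eq_iff quotient_eqI
    by (metis in_quotient_imp_closed in_quotient_imp_in_rel empty_subsetI insert_subset)
next
  assume pq: "(p, q) \<in> r"
  have "p \<in> X" using pq assms by (meson equiv_class_eq_iff)
  then have "r `` {p} \<in> X // r" by (rule quotientI)
  moreover have "p \<in> r `` {p}" using assms \<open>p \<in> X\<close> by (rule equiv_class_self)
  ultimately show "conn (X // r) p q" unfolding conn_def using pq by blast
qed

lemma equiv_rtrancl_restrict:
  assumes "sym r" shows "equiv X (r\<^sup>* \<inter> X \<times> X)"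
proof (rule equivI)
  show "sym (r\<^sup>* \<inter> X \<times> X)" using sym_rtrancl[OF assms] unfolding sym_def by blast
  show "trans (r\<^sup>* \<inter> X \<times> X)" by (rule transI) auto
qed (auto simp: refl_on_def)

locale partition_monoid = fixes n :: nat
begin

abbreviation Q :: "pt set set set" where "Q \<equiv> carrier (part_monoid n)"
abbreviation mul :: "pt set set \<Rightarrow> pt set set \<Rightarrow> pt set set" (infixl \<open>\<odot>\<close> 70)
  where "\<alpha> \<odot> \<beta> \<equiv> part_mult n \<alpha> \<beta>"
abbreviation e :: "nat \<Rightarrow> pt set set" where "e q \<equiv> bar n q id"

lemma mult_part_monoid [simp]: "mult (part_monoid n) = part_mult n"
  by (simp add: part_monoid_def)

lemma Q_iff: "\<alpha> \<in> Q \<longleftrightarrow> partition_on (points n) \<alpha>"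
  by (simp add: part_monoid_def)

lemma in_points [simp]: "Up i \<in> points n \<longleftrightarrow> i \<in> {1..n}" "Lo i \<in> points n \<longleftrightarrow> i \<in> {1..n}"
    "Mid i \<notin> points n"
  by (auto simp: points_def)

lemma conn_points: "\<alpha> \<in> Q \<Longrightarrow> conn \<alpha> p q \<Longrightarrow> p \<in> points n \<and> q \<in> points n"
  by (auto simp: Q_iff conn_def partition_on_def)

lemma conn_refl: "\<alpha> \<in> Q \<Longrightarrow> conn \<alpha> p p \<longleftrightarrow> p \<in> points n"
  by (auto simp: Q_iff conn_def partition_on_def)

lemma conn_sym: "conn \<alpha> p q \<Longrightarrow> conn \<alpha> q p"
  by (auto simp: conn_def)

lemma conn_trans: "\<alpha> \<in> Q \<Longrightarrow> conn \<alpha> p q \<Longrightarrow> conn \<alpha> q r \<Longrightarrow> conn \<alpha> p r"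
  unfolding Q_iff conn_def partition_on_def by (metis IntI disjointD empty_iff)

lemma block_eq_conn: "\<alpha> \<in> Q \<Longrightarrow> X \<in> \<alpha> \<Longrightarrow> p \<in> X \<Longrightarrow> X = {q. conn \<alpha> p q}"
  unfolding Q_iff conn_def partition_on_def by (auto dest: disjointD)

lemma Q_eq_conn: "\<alpha> \<in> Q \<Longrightarrow> \<alpha> = (\<lambda>p. {q. conn \<alpha> p q}) ` points n"
proof -
  assume a: "\<alpha> \<in> Q"
  show ?thesis
  proof (intro equalityI subsetI)
    fix X assume X: "X \<in> \<alpha>"
    then obtain p where "p \<in> X" using a unfolding Q_iff partition_on_def by fastforce
    moreover from this have "p \<in> points n" using X a by (auto simp: Q_iff partition_on_def)
    ultimately show "X \<in> (\<lambda>p. {q. conn \<alpha> p q}) ` points n"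
      using block_eq_conn[OF a X] by blast
  next
    fix X assume "X \<in> (\<lambda>p. {q. conn \<alpha> p q}) ` points n"
    then obtain p where p: "p \<in> points n" "X = {q. conn \<alpha> p q}" by blast
    then obtain Y where "Y \<in> \<alpha>" "p \<in> Y" using a by (auto simp: Q_iff partition_on_def)
    then show "X \<in> \<alpha>" using block_eq_conn[OF a] p by auto
  qed
qed

text \<open>The block of \<open>p\<close> is itself a union of blocks, so the unions of blocks
  determine which points are connected.\<close>

lemma conn_iff_sat:
  assumes "\<alpha> \<in> Q" "p \<in> points n" "q \<in> points n"
  shows "conn \<alpha> p q \<longleftrightarrow> (\<forall>A B. sat \<alpha> A B \<longrightarrow> lab A B p = lab A B q)"
proof
  assume h: "\<forall>A B. sat \<alpha> A B \<longrightarrow> lab A B p = lab A B q"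
  define A B where "A = {i. conn \<alpha> p (Up i)}" and "B = {i. conn \<alpha> p (Lo i)}"
  have l: "lab A B r \<longleftrightarrow> conn \<alpha> p r" for r
    by (cases r) (use assms conn_points[of \<alpha> p r] in \<open>auto simp: A_def B_def\<close>)
  have "sat \<alpha> A B" unfolding sat_def l using conn_trans[OF assms(1)] conn_sym by blast
  then show "conn \<alpha> p q" using h l conn_refl assms by blast
qed (auto simp: sat_def)

text \<open>The extensionality principle through which identities between concrete elements are
  checked below.\<close>

lemma Q_eqI:
  assumes "\<alpha> \<in> Q" "\<beta> \<in> Q" "\<And>A B. sat \<alpha> A B \<longleftrightarrow> sat \<beta> A B"
  shows "\<alpha> = \<beta>"
proof -
  have "conn \<alpha> p q \<longleftrightarrow> conn \<beta> p q" for p q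
    using conn_iff_sat[OF assms(1), of p q] conn_iff_sat[OF assms(2), of p q] assms(3)
      conn_points[OF assms(1)] conn_points[OF assms(2)] by blast
  then show ?thesis using Q_eq_conn[OF assms(1)] Q_eq_conn[OF assms(2)] by simp
qed

lemma quotient_Q: "sym r \<Longrightarrow> points n // (r\<^sup>* \<inter> points n \<times> points n) \<in> Q"
  unfolding Q_iff by (rule partition_on_quotient[OF equiv_rtrancl_restrict])

lemma sym_product_graph: "sym (product_graph \<alpha> \<beta>)"
  unfolding sym_def product_graph_def by blast

lemma mult_closed [simp]: "\<alpha> \<odot> \<beta> \<in> Q"
  unfolding part_mult_def by (rule quotient_Q[OF sym_product_graph])

lemma conn_mult: "conn (\<alpha> \<odot> \<beta>) p q \<longleftrightarrow>
    (p, q) \<in> (product_graph \<alpha> \<beta>)\<^sup>* \<and> p \<in> points n \<and> q \<in> points n"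
  unfolding part_mult_def conn_quotient[OF equiv_rtrancl_restrict[OF sym_product_graph]] by auto

lemma sym_gen: "sym (E \<union> E\<inverse>)"
  by (auto simp: sym_def)

lemma gen_Q [simp]: "gen n E \<in> Q"
  unfolding gen_def by (rule quotient_Q[OF sym_gen])

lemma conn_gen: "conn (gen n E) p q \<longleftrightarrow> (p, q) \<in> (E \<union> E\<inverse>)\<^sup>* \<and> p \<in> points n \<and> q \<in> points n"
  unfolding gen_def conn_quotient[OF equiv_rtrancl_restrict[OF sym_gen]] by auto

lemma rtrancl_invariant:
  assumes "(p, q) \<in> r\<^sup>*" "\<And>x y. (x, y) \<in> r \<Longrightarrow> f x = f y" shows "f p = f q"
  using assms(1) by induction (use assms(2) in auto)

lemma sat_gen:
  assumes "E \<subseteq> points n \<times> points n"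
  shows "sat (gen n E) A B \<longleftrightarrow> (\<forall>(p, q)\<in>E. lab A B p = lab A B q)"
proof
  assume "sat (gen n E) A B"
  moreover have "conn (gen n E) p q" if "(p, q) \<in> E" for p q
    using that assms by (auto simp: conn_gen)
  ultimately show "\<forall>(p, q)\<in>E. lab A B p = lab A B q" unfolding sat_def by blast
next
  assume "\<forall>(p, q)\<in>E. lab A B p = lab A B q"
  then show "sat (gen n E) A B" unfolding sat_def conn_gen
    by (auto elim!: rtrancl_invariant[where f = "lab A B"])
qed

lemma conn_cases:
  assumes "\<alpha> \<in> Q" "conn \<alpha> p q"
  obtains i j where "p = Up i" "q = Up j" | i j where "p = Up i" "q = Lo j"
    | i j where "p = Lo i" "q = Up j" | i j where "p = Lo i" "q = Lo j"
  using conn_points[OF assms] by (cases p; cases q) auto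

text \<open>Within the upper points, and within the lower ones, a one-sided implication suffices
  because connectedness is symmetric.\<close>

lemma sat_iff:
  assumes "\<alpha> \<in> Q"
  shows "sat \<alpha> A B \<longleftrightarrow> (\<forall>i j. conn \<alpha> (Up i) (Up j) \<longrightarrow> i \<in> A \<longrightarrow> j \<in> A) \<and>
    (\<forall>i j. conn \<alpha> (Up i) (Lo j) \<longrightarrow> (i \<in> A \<longleftrightarrow> j \<in> B)) \<and>
    (\<forall>i j. conn \<alpha> (Lo i) (Lo j) \<longrightarrow> i \<in> B \<longrightarrow> j \<in> B)" (is "?l = ?r")
proof
  show ?r if ?l using that unfolding sat_def by (auto dest: conn_sym) (metis lab.simps)+
  show ?l if ?r unfolding sat_def
  proof (intro allI impI)
    fix p q assume c: "conn \<alpha> p q"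
    show "lab A B p = lab A B q"
      using assms c by (rule conn_cases) (use \<open>?r\<close> c conn_sym[OF c] in auto)
  qed
qed

section \<open>Products of partitions as compositions of relations\<close>

lemma product_graph_iff:
  assumes "\<alpha> \<in> Q" "\<beta> \<in> Q"
  shows "(p, q) \<in> product_graph \<alpha> \<beta> \<longleftrightarrow>
    (\<exists>p' q'. conn \<alpha> p' q' \<and> p = lower_to_mid p' \<and> q = lower_to_mid q') \<or>
    (\<exists>p' q'. conn \<beta> p' q' \<and> p = upper_to_mid p' \<and> q = upper_to_mid q')"
  unfolding product_graph_def conn_def by blast

text \<open>A labelling of the outer points that is constant on the components of the product graph
  extends to the middle points; conversely, a labelling that is constant along edges is constant
  along paths.\<close>

lemma sat_mult:
  assumes "\<alpha> \<in> Q" "\<beta> \<in> Q"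
  shows "sat (\<alpha> \<odot> \<beta>) A C \<longleftrightarrow> (\<exists>B. sat \<alpha> A B \<and> sat \<beta> B C)"
proof
  let ?G = "product_graph \<alpha> \<beta>"
  note G = product_graph_iff[OF assms]
  assume s: "sat (\<alpha> \<odot> \<beta>) A C"
  \<comment> \<open>Components without an outer point get the label false; any label constant on
    such a component would do.\<close>
  define B where "B = {i. \<exists>p\<in>points n. (Mid i, p) \<in> ?G\<^sup>* \<and> lab A C p}"
  have *: "lab A C p = lab A C q" if "(p, q) \<in> ?G\<^sup>*" "p \<in> points n" "q \<in> points n" for p q
    using s that unfolding sat_def conn_mult by blast
  have sG: "(q, p) \<in> ?G\<^sup>*" if "(p, q) \<in> ?G\<^sup>*" for p q
    using that sym_rtrancl[OF sym_product_graph] by (meson symD)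
  have mid: "i \<in> B \<longleftrightarrow> lab A C p" if "(Mid i, p) \<in> ?G\<^sup>*" "p \<in> points n" for i p
    unfolding B_def using that * sG by (smt (verit) mem_Collect_eq rtrancl_trans)
  have midmid: "j \<in> B" if "(Mid i, Mid j) \<in> ?G\<^sup>*" "i \<in> B" for i j
    using that sG unfolding B_def by (smt (verit) mem_Collect_eq rtrancl_trans)
  have a1: "(lower_to_mid p, lower_to_mid q) \<in> ?G\<^sup>*" if "conn \<alpha> p q" for p q
    using that G by blast
  have b1: "(upper_to_mid p, upper_to_mid q) \<in> ?G\<^sup>*" if "conn \<beta> p q" for p q
    using that G by blast
  have "sat \<alpha> A B" unfolding sat_iff[OF assms(1)]
  proof (intro conjI allI impI)
    fix i j assume c: "conn \<alpha> (Up i) (Up j)" "i \<in> A"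
    then show "j \<in> A" using *[of "Up i" "Up j"] a1[OF c(1)] conn_points[OF assms(1) c(1)] by simp
  next
    fix i j assume c: "conn \<alpha> (Up i) (Lo j)"
    then show "(i \<in> A) = (j \<in> B)"
      using mid[of j "Up i"] sG a1[OF c] conn_points[OF assms(1) c] by simp
  next
    fix i j assume "conn \<alpha> (Lo i) (Lo j)" "i \<in> B"
    then show "j \<in> B" using midmid[of i j] a1[of "Lo i" "Lo j"] by simp
  qed
  moreover have "sat \<beta> B C" unfolding sat_iff[OF assms(2)]
  proof (intro conjI allI impI)
    fix i j assume c: "conn \<beta> (Lo i) (Lo j)" "i \<in> C"
    then show "j \<in> C" using *[of "Lo i" "Lo j"] b1[OF c(1)] conn_points[OF assms(2) c(1)] by simp
  next
    fix i j assume c: "conn \<beta> (Up i) (Lo j)"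
    then show "(i \<in> B) = (j \<in> C)"
      using mid[of i "Lo j"] b1[OF c] conn_points[OF assms(2) c] by simp
  next
    fix i j assume "conn \<beta> (Up i) (Up j)" "i \<in> B"
    then show "j \<in> B" using midmid[of i j] b1[of "Up i" "Up j"] by simp
  qed
  ultimately show "\<exists>B. sat \<alpha> A B \<and> sat \<beta> B C" by blast
next
  assume "\<exists>B. sat \<alpha> A B \<and> sat \<beta> B C"
  then obtain B where B: "sat \<alpha> A B" "sat \<beta> B C" by blast
  define f where "f p = (case p of Up i \<Rightarrow> i \<in> A | Mid i \<Rightarrow> i \<in> B | Lo i \<Rightarrow> i \<in> C)" for p
  have "f p = f q" if pq: "(p, q) \<in> product_graph \<alpha> \<beta>" for p q
  proof -
    consider p' q' where "conn \<alpha> p' q'" "p = lower_to_mid p'" "q = lower_to_mid q'"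
      | p' q' where "conn \<beta> p' q'" "p = upper_to_mid p'" "q = upper_to_mid q'"
      using pq product_graph_iff[OF assms] by blast
    then show ?thesis
    proof cases
      case 1
      have "f (lower_to_mid x) = lab A B x" if "x \<in> points n" for x
        using that by (cases x) (auto simp: f_def)
      then show ?thesis using 1 B(1) conn_points[OF assms(1) 1(1)] unfolding sat_def by metis
    next
      case 2
      have "f (upper_to_mid x) = lab B C x" if "x \<in> points n" for x
        using that by (cases x) (auto simp: f_def)
      then show ?thesis using 2 B(2) conn_points[OF assms(2) 2(1)] unfolding sat_def by metis
    qed
  qed
  then have f: "f p = f q" if "(p, q) \<in> (product_graph \<alpha> \<beta>)\<^sup>*" for p q
    using that by (rule rtrancl_invariant[rotated])
  have "lab A C p = f p" if "p \<in> points n" for p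
    using that by (cases p) (auto simp: f_def)
  then show "sat (\<alpha> \<odot> \<beta>) A C" unfolding sat_def conn_mult using f by metis
qed

lemma mult_assoc:
  assumes "\<alpha> \<in> Q" "\<beta> \<in> Q" "\<gamma> \<in> Q"
  shows "\<alpha> \<odot> \<beta> \<odot> \<gamma> = \<alpha> \<odot> (\<beta> \<odot> \<gamma>)"
  by (rule Q_eqI) (use assms in \<open>auto simp: sat_mult\<close>)

section \<open>The anti-involution exchanging upper and lower points\<close>

definition flip :: "pt set set \<Rightarrow> pt set set" where
  "flip \<alpha> = gen n (map_prod swap_pt swap_pt ` {(p, q). conn \<alpha> p q})"

lemma flip_Q [simp]: "flip \<alpha> \<in> Q"
  by (simp add: flip_def)

lemma sat_flip: "\<alpha> \<in> Q \<Longrightarrow> sat (flip \<alpha>) A B \<longleftrightarrow> sat \<alpha> B A"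
proof -
  assume a: "\<alpha> \<in> Q"
  have l: "lab A B (swap_pt p) = lab B A p" for p by (cases p) auto
  have "swap_pt p \<in> points n" if "p \<in> points n" for p using that by (cases p) auto
  then have "map_prod swap_pt swap_pt ` {(p, q). conn \<alpha> p q} \<subseteq> points n \<times> points n"
    using conn_points[OF a] by auto
  then show ?thesis unfolding flip_def sat_gen[OF \<open>_ \<subseteq> _\<close>] by (auto simp: sat_def l)
qed

lemma flip_flip [simp]: "\<alpha> \<in> Q \<Longrightarrow> flip (flip \<alpha>) = \<alpha>"
  by (rule Q_eqI) (auto simp: sat_flip)

lemma flip_mult: "\<alpha> \<in> Q \<Longrightarrow> \<beta> \<in> Q \<Longrightarrow> flip (\<alpha> \<odot> \<beta>) = flip \<beta> \<odot> flip \<alpha>"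
  by (rule Q_eqI) (auto simp: sat_flip sat_mult)

section \<open>Rank\<close>

text \<open>Keeps the simplifier from turning \<open>{1..q}\<close> into \<open>{Suc 0..q}\<close>.\<close>

declare One_nat_def [simp del]

lemma sat_conn:
  assumes "sat \<alpha> A B"
  shows "conn \<alpha> (Up i) (Lo j) \<Longrightarrow> i \<in> A \<longleftrightarrow> j \<in> B" "conn \<alpha> (Up i) (Up j) \<Longrightarrow> i \<in> A \<longleftrightarrow> j \<in> A"
    "conn \<alpha> (Lo i) (Lo j) \<Longrightarrow> i \<in> B \<longleftrightarrow> j \<in> B"
  using assms unfolding sat_def by (metis lab.simps)+

text \<open>\<open>a k\<close> and \<open>b k\<close> are an upper and a lower point of the \<open>k\<close>-th transversal.\<close>

definition is_reps :: "pt set set \<Rightarrow> nat \<Rightarrow> (nat \<Rightarrow> nat) \<Rightarrow> (nat \<Rightarrow> nat) \<Rightarrow> bool" where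
  "is_reps \<alpha> q a b \<longleftrightarrow> (\<forall>k\<in>{1..q}. conn \<alpha> (Up (a k)) (Lo (b k))) \<and>
    (\<forall>k\<in>{1..q}. \<forall>l\<in>{1..q}. conn \<alpha> (Up (a k)) (Up (a l)) \<longrightarrow> k = l) \<and>
    (\<forall>i j. conn \<alpha> (Up i) (Lo j) \<longrightarrow> (\<exists>k\<in>{1..q}. conn \<alpha> (Up i) (Up (a k))))"

text \<open>Multiplying by a selector on the left and by a flipped selector on the right restricts
  an element to chosen upper and lower points, renumbered as 1, ..., q.\<close>

definition sel :: "nat \<Rightarrow> (nat \<Rightarrow> nat) \<Rightarrow> pt set set" where
  "sel q a = gen n {(Up k, Lo (a k)) | k. k \<in> {1..q}}"

lemma sel_Q [simp]: "sel q a \<in> Q"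
  by (simp add: sel_def)

lemma sat_sel:
  assumes "q \<le> n" "a ` {1..q} \<subseteq> {1..n}"
  shows "sat (sel q a) A B \<longleftrightarrow> (\<forall>k\<in>{1..q}. k \<in> A \<longleftrightarrow> a k \<in> B)"
proof -
  have *: "{(Up k, Lo (a k)) |k. k \<in> {1..q}} \<subseteq> points n \<times> points n" using assms by fastforce
  show ?thesis unfolding sel_def sat_gen[OF *] by fastforce
qed

section \<open>The partial permutations and the idempotents \<open>e q\<close>\<close>

lemma bar_Q [simp]:
  assumes "q \<le> n" "\<sigma> permutes {1..q}" shows "bar n q \<sigma> \<in> Q"
proof -
  have i: "\<sigma> i = \<sigma> j \<longleftrightarrow> i = j" for i j using permutes_inj[OF assms(2)] by (meson injD)
  have r: "\<sigma> i \<in> {1..q} \<longleftrightarrow> i \<in> {1..q}" for i by (rule permutes_in_image[OF assms(2)])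
  have c: "\<exists>j\<in>{1..q}. i = \<sigma> j" if "i \<in> {1..q}" for i
    using permutes_image[OF assms(2)] that by blast
  show ?thesis unfolding Q_iff
  proof (rule partition_onI)
    show "\<Union> (bar n q \<sigma>) = points n"
    proof (intro equalityI subsetI)
      fix p assume "p \<in> \<Union> (bar n q \<sigma>)"
      then show "p \<in> points n" using r assms(1) by (fastforce simp: bar_def)
    next
      fix p assume p: "p \<in> points n"
      show "p \<in> \<Union> (bar n q \<sigma>)"
      proof (cases p)
        case (Up i)
        have "{Up i} \<in> bar n q \<sigma>" if "\<not> i \<le> q" using p Up that by (auto simp: bar_def)
        moreover have "{Up i, Lo (\<sigma> i)} \<in> bar n q \<sigma>" if "i \<le> q"
          using p Up that by (auto simp: bar_def)
        ultimately show ?thesis using Up by blast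
      next
        case (Lo i)
        show ?thesis
        proof (cases "i \<le> q")
          case True
          then obtain j where "j \<in> {1..q}" "i = \<sigma> j" using c[of i] p Lo by auto
          then have "{Up j, Lo i} \<in> bar n q \<sigma>" unfolding bar_def by blast
          then show ?thesis using Lo by auto
        next
          case False
          then have "{Lo i} \<in> bar n q \<sigma>" using p Lo by (auto simp: bar_def)
          then show ?thesis using Lo by auto
        qed
      qed (use p in auto)
    qed
    show "{} \<notin> bar n q \<sigma>" by (auto simp: bar_def)
    fix X Y assume "X \<in> bar n q \<sigma>" "Y \<in> bar n q \<sigma>" "X \<noteq> Y"
    moreover have "\<not> q < \<sigma> i" if "1 \<le> i" "i \<le> q" for i using r[of i] that by simp
    ultimately show "disjnt X Y" unfolding bar_def disjnt_def by (auto simp: i)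
  qed
qed

lemma conn_bar: "conn (bar n q \<sigma>) (Up i) (Lo j) \<longleftrightarrow> i \<in> {1..q} \<and> j = \<sigma> i"
  unfolding conn_def bar_def by auto

lemma sat_bar:
  assumes "q \<le> n" "\<sigma> permutes {1..q}"
  shows "sat (bar n q \<sigma>) A B \<longleftrightarrow> (\<forall>k\<in>{1..q}. k \<in> A \<longleftrightarrow> \<sigma> k \<in> B)"
proof
  assume "sat (bar n q \<sigma>) A B"
  then show "\<forall>k\<in>{1..q}. k \<in> A \<longleftrightarrow> \<sigma> k \<in> B"
    unfolding sat_iff[OF bar_Q[OF assms]] conn_bar by blast
next
  have i: "\<sigma> i = \<sigma> j \<longleftrightarrow> i = j" for i j using permutes_inj[OF assms(2)] by (meson injD)
  assume *: "\<forall>k\<in>{1..q}. k \<in> A \<longleftrightarrow> \<sigma> k \<in> B"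
  show "sat (bar n q \<sigma>) A B" unfolding sat_def conn_def bar_def using * by auto
qed

lemma e_Q [simp]: "q \<le> n \<Longrightarrow> e q \<in> Q"
  by (simp add: permutes_id)

lemma sat_e: "q \<le> n \<Longrightarrow> sat (e q) A B \<longleftrightarrow> (\<forall>k\<in>{1..q}. k \<in> A \<longleftrightarrow> k \<in> B)"
  by (subst sat_bar) (auto simp: permutes_id)

lemma e_n [simp]:
  assumes "\<alpha> \<in> Q" shows "e n \<odot> \<alpha> = \<alpha>" "\<alpha> \<odot> e n = \<alpha>"
proof -
  \<comment> \<open>Only the traces of \<open>A\<close> and \<open>B\<close> on {1..n} matter, and
    \<open>e n\<close> equates exactly these traces.\<close>
  have s: "sat \<alpha> A' B'" if "sat \<alpha> A B" "\<forall>k\<in>{1..n}. k \<in> A \<longleftrightarrow> k \<in> A'"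
    "\<forall>k\<in>{1..n}. k \<in> B \<longleftrightarrow> k \<in> B'" for A B A' B'
  proof -
    have "lab A B p = lab A' B' p" if "p \<in> points n" for p
      using that \<open>\<forall>k\<in>{1..n}. k \<in> A \<longleftrightarrow> k \<in> A'\<close> \<open>\<forall>k\<in>{1..n}. k \<in> B \<longleftrightarrow> k \<in> B'\<close>
      by (cases p) auto
    then show ?thesis using \<open>sat \<alpha> A B\<close> unfolding sat_def using conn_points[OF assms] by metis
  qed
  show "e n \<odot> \<alpha> = \<alpha>"
  proof (rule Q_eqI)
    show "sat (e n \<odot> \<alpha>) A B \<longleftrightarrow> sat \<alpha> A B" for A B
      using s[of _ B A B] unfolding sat_mult[OF e_Q[OF le_refl] assms] sat_e[OF le_refl] by blast
  qed (use assms in auto)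
  show "\<alpha> \<odot> e n = \<alpha>"
  proof (rule Q_eqI)
    show "sat (\<alpha> \<odot> e n) A B \<longleftrightarrow> sat \<alpha> A B" for A B
      using s[of A _ A B] unfolding sat_mult[OF assms e_Q[OF le_refl]] sat_e[OF le_refl] by blast
  qed (use assms in auto)
qed

lemma e_mult_e: "p \<le> n \<Longrightarrow> q \<le> n \<Longrightarrow> e p \<odot> e q = e (min p q)"
proof (rule Q_eqI)
  fix A C assume pq: "p \<le> n" "q \<le> n"
  show "sat (e p \<odot> e q) A C = sat (e (min p q)) A C" (is "?l = ?r")
  proof
    assume ?l then show ?r using pq by (auto simp: sat_mult sat_e)
  next
    assume r: ?r
    \<comment> \<open>The middle set has to agree with \<open>A\<close> up to \<open>p\<close> and
      with \<open>C\<close> up to \<open>q\<close>; on the overlap the two agree by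
      assumption.\<close>
    have "sat (e p) A (A \<inter> {1..p} \<union> (C - {1..p}))" "sat (e q) (A \<inter> {1..p} \<union> (C - {1..p})) C"
      using r pq by (auto simp: sat_e)
    then show ?l using pq by (auto simp: sat_mult)
  qed
qed auto

section \<open>Factorization through the idempotent of the same rank\<close>

lemma reps_exist:
  assumes a: "\<alpha> \<in> Q"
  obtains a b where "is_reps \<alpha> (part_rank \<alpha>) a b"
proof -
  let ?T = "{B \<in> \<alpha>. (\<exists>i. Up i \<in> B) \<and> (\<exists>j. Lo j \<in> B)}"
  have "finite (points n)" by (simp add: points_def)
  then have "finite \<alpha>" using a unfolding Q_iff by (rule finite_elements)
  then have "finite ?T" by simp
  then obtain h where h: "bij_betw h {1..part_rank \<alpha>} ?T"
    unfolding part_rank_def using ex_bij_betw_nat_finite_1 by blast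
  then have hT: "h k \<in> ?T" if "k \<in> {1..part_rank \<alpha>}" for k
    using that bij_betwE by blast
  define a b where "a k = (SOME i. Up i \<in> h k)" and "b k = (SOME j. Lo j \<in> h k)" for k
  have ab: "Up (a k) \<in> h k" "Lo (b k) \<in> h k" if "k \<in> {1..part_rank \<alpha>}" for k
    using hT[OF that] unfolding a_def b_def by (auto intro: someI)
  have "is_reps \<alpha> (part_rank \<alpha>) a b" unfolding is_reps_def
  proof (intro conjI ballI allI impI)
    show "conn \<alpha> (Up (a k)) (Lo (b k))" if "k \<in> {1..part_rank \<alpha>}" for k
      using ab[OF that] hT[OF that] unfolding conn_def by blast
  next
    fix k l assume kl: "k \<in> {1..part_rank \<alpha>}" "l \<in> {1..part_rank \<alpha>}"
      and "conn \<alpha> (Up (a k)) (Up (a l))"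
    then have "Up (a l) \<in> h k" using block_eq_conn[OF a, of "h k" "Up (a k)"] hT ab by auto
    then have "h k = h l"
      using block_eq_conn[OF a, of "h k" "Up (a l)"] block_eq_conn[OF a, of "h l" "Up (a l)"] hT ab kl
      by auto
    then show "k = l" using h kl by (meson bij_betw_def inj_onD)
  next
    fix i j assume c: "conn \<alpha> (Up i) (Lo j)"
    then obtain X where X: "X \<in> \<alpha>" "Up i \<in> X" "Lo j \<in> X" unfolding conn_def by blast
    then have "X \<in> ?T" by blast
    then have "X \<in> h ` {1..part_rank \<alpha>}" unfolding bij_betw_imp_surj_on[OF h] .
    then obtain k where k: "k \<in> {1..part_rank \<alpha>}" "h k = X" by (metis imageE)
    then show "\<exists>k\<in>{1..part_rank \<alpha>}. conn \<alpha> (Up i) (Up (a k))"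
      using X ab[OF k(1)] unfolding conn_def by blast
  qed
  then show ?thesis by (rule that)
qed

lemma reps_range:
  assumes "\<alpha> \<in> Q" "is_reps \<alpha> q a b"
  shows "a ` {1..q} \<subseteq> {1..n}" "b ` {1..q} \<subseteq> {1..n}" "inj_on a {1..q}" "q \<le> n"
proof -
  have r: "a k \<in> {1..n}" if "k \<in> {1..q}" for k
    using that assms conn_points[OF assms(1)] unfolding is_reps_def by (meson in_points)
  have r': "b k \<in> {1..n}" if "k \<in> {1..q}" for k
    using that assms conn_points[OF assms(1)] unfolding is_reps_def by (meson in_points)
  show "a ` {1..q} \<subseteq> {1..n}" "b ` {1..q} \<subseteq> {1..n}" using r r' by auto
  show i: "inj_on a {1..q}"
  proof (rule inj_onI)
    fix x y assume "x \<in> {1..q}" "y \<in> {1..q}" "a x = a y"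
    then show "x = y" using assms r[of x] conn_refl[OF assms(1), of "Up (a x)"]
      unfolding is_reps_def by (metis in_points(1))
  qed
  show "q \<le> n" using card_inj_on_le[OF i, of "{1..n}"] r by fastforce
qed

lemma reps_conn_Lo:
  assumes "\<alpha> \<in> Q" "is_reps \<alpha> q a b"
  shows "conn \<alpha> (Up i) (Lo j) \<Longrightarrow> \<exists>k\<in>{1..q}. conn \<alpha> (Up i) (Up (a k)) \<and> conn \<alpha> (Lo (b k)) (Lo j)"
  using assms unfolding is_reps_def by (meson conn_sym conn_trans)

text \<open>One thread is kept in each transversal and everything else is cut off, so what remains
  is the idempotent of that rank.\<close>

lemma reps_middle:
  assumes "\<alpha> \<in> Q" "is_reps \<alpha> q a b"
  shows "sel q a \<odot> \<alpha> \<odot> flip (sel q b) = e q"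
proof (rule Q_eqI)
  note r = reps_range[OF assms]
  fix A D
  have ab: "conn \<alpha> (Up (a k)) (Lo (b k))" if "k \<in> {1..q}" for k
    using that assms(2) unfolding is_reps_def by blast
  show "sat (sel q a \<odot> \<alpha> \<odot> flip (sel q b)) A D = sat (e q) A D" (is "?l = ?r")
  proof
    assume ?l
    then obtain B C where "\<forall>k\<in>{1..q}. k \<in> A \<longleftrightarrow> a k \<in> B" "sat \<alpha> B C" "\<forall>k\<in>{1..q}. k \<in> D \<longleftrightarrow> b k \<in> C"
      using assms(1) r by (auto simp: sat_mult sat_flip sat_sel[OF r(4) r(1)] sat_sel[OF r(4) r(2)])
    then show ?r using ab r(4) by (auto simp: sat_e sat_iff[OF assms(1)])
  next
    assume r': ?r
    \<comment> \<open>The union of the transversals whose index lies in \<open>A\<close>.\<close>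
    define B C where "B = {i. \<exists>k\<in>{1..q} \<inter> A. conn \<alpha> (Up (a k)) (Up i)}"
      and "C = {i. \<exists>k\<in>{1..q} \<inter> A. conn \<alpha> (Up (a k)) (Lo i)}"
    have "lab B C p \<longleftrightarrow> (\<exists>k\<in>{1..q} \<inter> A. conn \<alpha> (Up (a k)) p)" for p
      by (cases p) (auto simp: B_def C_def dest: conn_points[OF assms(1)])
    then have "sat \<alpha> B C" unfolding sat_def using conn_trans[OF assms(1)] conn_sym by blast
    moreover have "k \<in> A \<longleftrightarrow> a k \<in> B" if "k \<in> {1..q}" for k
    proof -
      have "conn \<alpha> (Up (a k)) (Up (a k))" using that r(1) conn_refl[OF assms(1)] in_points(1) by blast
      moreover have "\<forall>l\<in>{1..q}. conn \<alpha> (Up (a l)) (Up (a k)) \<longrightarrow> l = k"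
        using that assms(2) unfolding is_reps_def by blast
      ultimately show ?thesis using that unfolding B_def by blast
    qed
    moreover from this have "k \<in> D \<longleftrightarrow> b k \<in> C" if "k \<in> {1..q}" for k
      using that r' r(4) sat_conn(1)[OF \<open>sat \<alpha> B C\<close> ab[OF that]] by (auto simp: sat_e)
    ultimately show ?l using assms(1) r by (auto simp: sat_mult sat_flip sat_sel[OF r(4) r(1)] sat_sel[OF r(4) r(2)])
  qed
qed (use reps_range[OF assms] in auto)

text \<open>The counterpart of \<open>reps_middle\<close>: whatever passes from the top to the
  bottom of \<open>\<alpha>\<close> passes through its transversals, so \<open>\<alpha>\<close>
  factors through \<open>e q\<close>.\<close>

lemma reps_factor:
  assumes "\<alpha> \<in> Q" "is_reps \<alpha> q a b"
  shows "\<alpha> \<odot> flip (sel q b) \<odot> e q \<odot> (sel q a \<odot> \<alpha>) = \<alpha>"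
proof (rule Q_eqI)
  note r = reps_range[OF assms]
  have ab: "conn \<alpha> (Up (a k)) (Lo (b k))" if "k \<in> {1..q}" for k
    using that assms(2) unfolding is_reps_def by blast
  fix A D
  show "sat (\<alpha> \<odot> flip (sel q b) \<odot> e q \<odot> (sel q a \<odot> \<alpha>)) A D = sat \<alpha> A D" (is "?l = ?r")
  proof
    assume ?l
    then obtain B B' C' C where s: "sat \<alpha> A B" "\<forall>k\<in>{1..q}. k \<in> B' \<longleftrightarrow> b k \<in> B"
      "\<forall>k\<in>{1..q}. k \<in> B' \<longleftrightarrow> k \<in> C'" "\<forall>k\<in>{1..q}. k \<in> C' \<longleftrightarrow> a k \<in> C" "sat \<alpha> C D"
      unfolding sat_mult[OF mult_closed mult_closed] sat_mult[OF mult_closed e_Q[OF r(4)]]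
        sat_mult[OF assms(1) flip_Q] sat_mult[OF sel_Q assms(1)] sat_flip[OF sel_Q] sat_e[OF r(4)]
        sat_sel[OF r(4) r(1)] sat_sel[OF r(4) r(2)] by blast
    then have k: "a k \<in> A \<longleftrightarrow> b k \<in> D" if "k \<in> {1..q}" for k
      using that sat_conn(1)[OF s(1) ab[OF that]] sat_conn(1)[OF s(5) ab[OF that]] s(2-4) by simp
    show ?r unfolding sat_iff[OF assms(1)]
    proof (intro conjI allI impI)
      fix i j assume "conn \<alpha> (Up i) (Lo j)"
      then obtain k where "k \<in> {1..q}" "conn \<alpha> (Up i) (Up (a k))" "conn \<alpha> (Lo (b k)) (Lo j)"
        using reps_conn_Lo[OF assms] by blast
      then show "i \<in> A \<longleftrightarrow> j \<in> D" using k sat_conn(2)[OF s(1)] sat_conn(3)[OF s(5)] by blast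
    qed (use sat_conn(2)[OF s(1)] sat_conn(3)[OF s(5)] in \<open>blast+\<close>)
  next
    assume r': ?r
    define B where "B = {k\<in>{1..q}. a k \<in> A}"
    have "\<forall>k\<in>{1..q}. a k \<in> A \<longleftrightarrow> b k \<in> D" using r' ab by (simp add: sat_iff[OF assms(1)])
    then have "sat (flip (sel q b)) D B" "sat (e q) B B" "sat (sel q a) B A"
      using r by (auto simp: sat_flip sat_sel[OF r(4) r(1)] sat_sel[OF r(4) r(2)] sat_e B_def)
    then show ?l using r'
      unfolding sat_mult[OF mult_closed mult_closed] sat_mult[OF mult_closed e_Q[OF r(4)]]
        sat_mult[OF assms(1) flip_Q] sat_mult[OF sel_Q assms(1)]
      by (meson sat_flip[OF sel_Q] sat_flip[OF flip_Q])
  qed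
qed (use assms in auto)

text \<open>Rank measures transmitted information: distinct subsets of {1..m} must leave distinct
  traces on {1..r}, hence 2^m \<le> 2^r.\<close>

lemma e_factor_le:
  assumes "m \<le> n" "r \<le> n" "x \<in> Q" "y \<in> Q" "x \<odot> e r \<odot> y = e m"
  shows "m \<le> r"
proof -
  have ex: "\<exists>B C. sat x A B \<and> sat (e r) B C \<and> sat y C A" for A
  proof -
    have "sat (e m) A A" using assms by (simp add: sat_e)
    then have "sat (x \<odot> e r \<odot> y) A A" by (simp only: assms(5))
    then show ?thesis using assms(1-4) by (auto simp: sat_mult)
  qed
  then obtain f g where fg: "sat x A (f A)" "sat (e r) (f A) (g A)" "sat y (g A) A" for A by metis
  have "inj_on (\<lambda>A. f A \<inter> {1..r}) (Pow {1..m})"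
  proof (rule inj_onI)
    fix A A' assume A: "A \<in> Pow {1..m}" "A' \<in> Pow {1..m}" and eq: "f A \<inter> {1..r} = f A' \<inter> {1..r}"
    have "sat (e r) (f A) (g A')" using fg(2)[of A'] eq assms by (simp add: sat_e) blast
    then have "sat (x \<odot> e r \<odot> y) A A'" using fg(1,3) assms(1-4) by (auto simp: sat_mult)
    then show "A = A'" using A assms by (auto simp: sat_e)
  qed
  then have "card (Pow {1..m}) \<le> card (Pow {1..r})" by (rule card_inj_on_le) auto
  then show ?thesis by (simp add: card_Pow)
qed

lemma rank_le_n: "\<alpha> \<in> Q \<Longrightarrow> part_rank \<alpha> \<le> n"
  using reps_exist reps_range(4) by metis

lemma rank_factor:
  assumes "\<alpha> \<in> Q"
  obtains s t where "s \<in> Q" "t \<in> Q" "s \<odot> e (part_rank \<alpha>) \<odot> t = \<alpha>"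
  using reps_exist[OF assms] reps_factor[OF assms] by (metis mult_closed)

lemma rank_middle:
  assumes "\<alpha> \<in> Q"
  obtains u v where "u \<in> Q" "v \<in> Q" "u \<odot> \<alpha> \<odot> v = e (part_rank \<alpha>)"
  using reps_exist[OF assms] reps_middle[OF assms] by (metis sel_Q flip_Q)

text \<open>A description of rank by divisibility alone; monotonicity of rank under products follows
  from it without another look at blocks.\<close>

lemma rank_le_iff:
  assumes "\<alpha> \<in> Q" "m \<le> n"
  shows "m \<le> part_rank \<alpha> \<longleftrightarrow> (\<exists>u\<in>Q. \<exists>v\<in>Q. u \<odot> \<alpha> \<odot> v = e m)"
proof
  let ?r = "part_rank \<alpha>"
  note r = rank_le_n[OF assms(1)]
  obtain u v where uv: "u \<in> Q" "v \<in> Q" "u \<odot> \<alpha> \<odot> v = e ?r" using rank_middle[OF assms(1)] by blast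
  assume "m \<le> ?r"
  then have "e m = e m \<odot> e ?r" using assms r by (simp add: e_mult_e)
  also have "\<dots> = e m \<odot> u \<odot> \<alpha> \<odot> v" using uv assms by (simp add: mult_assoc flip: uv(3))
  finally show "\<exists>u\<in>Q. \<exists>v\<in>Q. u \<odot> \<alpha> \<odot> v = e m" using uv by (metis mult_closed)
next
  let ?r = "part_rank \<alpha>"
  obtain s t where st: "s \<in> Q" "t \<in> Q" "s \<odot> e ?r \<odot> t = \<alpha>" using rank_factor[OF assms(1)] by blast
  assume "\<exists>u\<in>Q. \<exists>v\<in>Q. u \<odot> \<alpha> \<odot> v = e m"
  then obtain u v where uv: "u \<in> Q" "v \<in> Q" "u \<odot> \<alpha> \<odot> v = e m" by blast
  have "(u \<odot> s) \<odot> e ?r \<odot> (t \<odot> v) = e m"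
  proof -
    have "u \<odot> s \<odot> e ?r \<odot> (t \<odot> v) = u \<odot> (s \<odot> e ?r \<odot> t) \<odot> v"
      using uv(1,2) st(1,2) e_Q[OF rank_le_n[OF assms(1)]] by (simp only: mult_assoc mult_closed)
    then show ?thesis by (simp only: st(3) uv(3))
  qed
  then show "m \<le> ?r" using e_factor_le assms rank_le_n[OF assms(1)] by (metis mult_closed)
qed

section \<open>The group of permutations at \<open>e q\<close>\<close>

lemma bar_mult:
  assumes "q \<le> n" "\<sigma> permutes {1..q}" "\<tau> permutes {1..q}"
  shows "bar n q \<sigma> \<odot> bar n q \<tau> = bar n q (\<tau> \<circ> \<sigma>)"
proof (rule Q_eqI)
  have c: "(\<tau> \<circ> \<sigma>) permutes {1..q}" using assms by (simp add: permutes_compose)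
  have im: "\<sigma> k \<in> {1..q} \<longleftrightarrow> k \<in> {1..q}" for k by (rule permutes_in_image[OF assms(2)])
  fix A C
  show "sat (bar n q \<sigma> \<odot> bar n q \<tau>) A C = sat (bar n q (\<tau> \<circ> \<sigma>)) A C" (is "?l = ?r")
  proof
    assume ?l
    then show ?r using im
      unfolding sat_mult[OF bar_Q[OF assms(1,2)] bar_Q[OF assms(1,3)]] sat_bar[OF assms(1,2)]
        sat_bar[OF assms(1,3)] sat_bar[OF assms(1) c] by fastforce
  next
    assume r: ?r
    then have "sat (bar n q \<sigma>) A (\<tau> -` C)" "sat (bar n q \<tau>) (\<tau> -` C) C"
      by (auto simp: sat_bar[OF assms(1,2)] sat_bar[OF assms(1,3)] sat_bar[OF assms(1) c])
    then show ?l unfolding sat_mult[OF bar_Q[OF assms(1,2)] bar_Q[OF assms(1,3)]] by blast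
  qed
qed (use assms in \<open>simp_all add: permutes_compose\<close>)

lemma bar_inverse:
  assumes "q \<le> n" "\<sigma> permutes {1..q}"
  shows "bar n q \<sigma> \<odot> bar n q (inv' \<sigma>) = e q" "bar n q (inv' \<sigma>) \<odot> bar n q \<sigma> = e q"
  using assms bar_mult[OF assms(1)] permutes_inv[OF assms(2)] permutes_inv_o[OF assms(2)] by simp_all

lemma e_bar [simp]:
  assumes "q \<le> n" "\<sigma> permutes {1..q}"
  shows "e q \<odot> bar n q \<sigma> = bar n q \<sigma>" "bar n q \<sigma> \<odot> e q = bar n q \<sigma>"
  using assms by (simp_all add: bar_mult permutes_id)

lemma e_e [simp]: "q \<le> n \<Longrightarrow> e q \<odot> e q = e q"
  by (simp add: e_mult_e)

lemma bar_inj: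
  assumes "\<sigma> permutes {1..q}" "\<tau> permutes {1..q}" "bar n q \<sigma> = bar n q \<tau>"
  shows "\<sigma> = \<tau>"
proof
  fix i
  show "\<sigma> i = \<tau> i"
  proof (cases "i \<in> {1..q}")
    case True
    then show ?thesis using conn_bar[of q \<sigma> i "\<sigma> i"] conn_bar[of q \<tau> i "\<sigma> i"] assms(3) by simp
  next
    case False
    then show ?thesis using assms by (simp add: permutes_not_in)
  qed
qed

lemma mid_assoc:
  assumes "u \<in> Q" "s \<in> Q" "\<alpha> \<in> Q" "t \<in> Q" "v \<in> Q"
  shows "u \<odot> (s \<odot> \<alpha> \<odot> t) \<odot> v = (u \<odot> s) \<odot> \<alpha> \<odot> (t \<odot> v)"
  using assms by (simp only: mult_assoc mult_closed)

section \<open>Rank of products and cancellation relative to \<open>e q\<close>\<close>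

lemma rank_mult3:
  assumes "s \<in> Q" "\<alpha> \<in> Q" "t \<in> Q"
  shows "part_rank (s \<odot> \<alpha> \<odot> t) \<le> part_rank \<alpha>"
proof -
  obtain u v where "u \<in> Q" "v \<in> Q" "u \<odot> (s \<odot> \<alpha> \<odot> t) \<odot> v = e (part_rank (s \<odot> \<alpha> \<odot> t))"
    using rank_middle[OF mult_closed] by blast
  then show ?thesis
    using rank_le_iff[OF assms(2) rank_le_n[OF mult_closed]] mid_assoc assms by (metis mult_closed)
qed

lemma rank_mult:
  assumes "\<alpha> \<in> Q" "\<beta> \<in> Q"
  shows "part_rank (\<alpha> \<odot> \<beta>) \<le> part_rank \<alpha>" "part_rank (\<alpha> \<odot> \<beta>) \<le> part_rank \<beta>"
  using rank_mult3[of "e n" \<alpha> \<beta>] rank_mult3[of \<alpha> \<beta> "e n"] assms by simp_all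

lemma rank_e [simp]:
  assumes "q \<le> n" shows "part_rank (e q) = q"
proof (rule antisym)
  obtain u v where "u \<in> Q" "v \<in> Q" "u \<odot> e q \<odot> v = e (part_rank (e q))"
    using rank_middle[OF e_Q[OF assms]] by blast
  then show "part_rank (e q) \<le> q" using e_factor_le assms rank_le_n[OF e_Q[OF assms]] by blast
  have "e n \<odot> e q \<odot> e n = e q" using assms by simp
  then show "q \<le> part_rank (e q)"
    using rank_le_iff[OF e_Q[OF assms] assms] e_Q[OF le_refl] by blast
qed

lemma rank_bar [simp]:
  assumes "q \<le> n" "\<sigma> permutes {1..q}" shows "part_rank (bar n q \<sigma>) = q"
proof (rule antisym)
  show "part_rank (bar n q \<sigma>) \<le> q"
    using rank_mult(1)[of "e q" "bar n q \<sigma>"] assms by simp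
  show "q \<le> part_rank (bar n q \<sigma>)"
    using rank_mult(1)[of "bar n q \<sigma>" "bar n q (inv' \<sigma>)"] assms bar_inverse[OF assms]
      permutes_inv[OF assms(2)] by simp
qed

lemma rank_le_factor:
  assumes "\<alpha> \<in> Q" "\<beta> \<in> Q" "part_rank \<alpha> \<le> part_rank \<beta>"
  obtains s t where "s \<in> Q" "t \<in> Q" "\<alpha> = s \<odot> \<beta> \<odot> t"
proof -
  note r = rank_le_n[OF assms(1)]
  obtain u v where uv: "u \<in> Q" "v \<in> Q" "u \<odot> \<beta> \<odot> v = e (part_rank \<alpha>)"
    using rank_le_iff[OF assms(2) r] assms(3) by blast
  obtain s t where st: "s \<in> Q" "t \<in> Q" "s \<odot> e (part_rank \<alpha>) \<odot> t = \<alpha>"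
    using rank_factor[OF assms(1)] by blast
  have "s \<odot> (u \<odot> \<beta> \<odot> v) \<odot> t = \<alpha>" using uv st by simp
  then have "\<alpha> = (s \<odot> u) \<odot> \<beta> \<odot> (v \<odot> t)" using mid_assoc uv(1,2) st(1,2) assms(2) by metis
  then show ?thesis using that by (metis mult_closed)
qed

lemma rank_flip [simp]:
  assumes "\<alpha> \<in> Q" shows "part_rank (flip \<alpha>) = part_rank \<alpha>"
proof -
  have le: "part_rank (flip \<alpha>) \<le> part_rank \<alpha>" if a: "\<alpha> \<in> Q" for \<alpha>
  proof -
    let ?r = "part_rank (flip \<alpha>)"
    have fe: "flip (e ?r) = e ?r"
      by (rule Q_eqI) (use rank_le_n[OF flip_Q] in \<open>auto simp: sat_flip sat_e\<close>)
    obtain u v where uv: "u \<in> Q" "v \<in> Q" "u \<odot> flip \<alpha> \<odot> v = e ?r" using rank_middle[OF flip_Q] by blast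
    have "flip (u \<odot> flip \<alpha> \<odot> v) = e ?r" using uv(3) fe by simp
    then have "flip v \<odot> \<alpha> \<odot> flip u = e ?r" using uv(1,2) a by (simp add: flip_mult mult_assoc)
    then show ?thesis using rank_le_iff[OF a rank_le_n[OF flip_Q]] flip_Q by blast
  qed
  show ?thesis using le[OF assms] le[OF flip_Q, of \<alpha>] assms by simp
qed

lemma flip_e [simp]: "q \<le> n \<Longrightarrow> flip (e q) = e q"
  by (rule Q_eqI) (auto simp: sat_flip sat_e)

text \<open>The units of the local monoid at \<open>e q\<close> are the permutations: points beyond
  \<open>q\<close> are isolated, and \<open>q\<close> transversals then use up all of {1..q} in both
  rows, so that every block in there is a pair.\<close>

lemma local_rank_q:
  assumes q: "q \<le> n" and g: "g \<in> Q" "e q \<odot> g \<odot> e q = g" "part_rank g = q"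
  obtains \<sigma> where "\<sigma> permutes {1..q}" "g = bar n q \<sigma>"
proof -
  obtain a b where ab: "is_reps g q a b" using reps_exist[OF g(1)] g(3) by metis
  note r = reps_range[OF g(1) ab]
  have c: "conn g (Up (a k)) (Lo (b k))" if "k \<in> {1..q}" for k
    using ab that unfolding is_reps_def by blast
  \<comment> \<open>Since \<open>e q\<close> stands on both sides, \<open>g\<close> sees only the
    traces on {1..q}.\<close>
  have dep: "sat g A' B'" if s: "sat g A B" "\<forall>k\<in>{1..q}. k \<in> A \<longleftrightarrow> k \<in> A'" "\<forall>k\<in>{1..q}. k \<in> B \<longleftrightarrow> k \<in> B'"
    for A B A' B'
  proof -
    have "sat (e q \<odot> g \<odot> e q) A' B'"
      using s unfolding sat_mult[OF mult_closed e_Q[OF q]] sat_mult[OF e_Q[OF q] g(1)] sat_e[OF q]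
      by blast
    then show ?thesis by (simp only: g(2))
  qed
  have triv: "sat g {} {}" by (simp add: sat_iff[OF g(1)])
  have out: "i \<in> {1..q}" if "conn g (Up i) (Lo j)" for i j
  proof (rule ccontr)
    assume "i \<notin> {1..q}"
    then have "sat g {i} {}" using dep[OF triv] by auto
    then show False using sat_conn(1)[OF _ that] by blast
  qed
  have out': "j \<in> {1..q}" if "conn g (Up i) (Lo j)" for i j
  proof (rule ccontr)
    assume "j \<notin> {1..q}"
    then have "sat g {} {j}" using dep[OF triv] by auto
    then show False using sat_conn(1)[OF _ that] by blast
  qed
  have b_inj: "inj_on b {1..q}"
  proof (rule inj_onI)
    fix k l assume kl: "k \<in> {1..q}" "l \<in> {1..q}" "b k = b l"
    then have "conn g (Up (a k)) (Up (a l))"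
      using c[of k] c[of l] conn_trans[OF g(1)] conn_sym by metis
    then show "k = l" using ab kl unfolding is_reps_def by blast
  qed
  have a: "bij_betw a {1..q} {1..q}"
    unfolding bij_betw_def using r(3) endo_inj_surj[OF _ _ r(3)] out[OF c] by blast
  have b: "bij_betw b {1..q} {1..q}"
    unfolding bij_betw_def using b_inj endo_inj_surj[OF _ _ b_inj] out'[OF c] by blast
  define \<sigma> where "\<sigma> i = (if i \<in> {1..q} then b (inv_into {1..q} a i) else i)" for i
  have "bij_betw \<sigma> {1..q} {1..q}"
    using bij_betw_trans[OF bij_betw_inv_into[OF a] b] by (subst bij_betw_cong) (auto simp: \<sigma>_def)
  then have p: "\<sigma> permutes {1..q}" by (rule bij_imp_permutes) (simp only: \<sigma>_def if_False)
  have sa: "\<sigma> (a k) = b k" if "k \<in> {1..q}" for k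
    using that a by (simp add: \<sigma>_def bij_betw_def inv_into_f_f) (metis atLeastAtMost_iff image_eqI)
  have ak: "\<exists>k\<in>{1..q}. i = a k" if "i \<in> {1..q}" for i
    using that bij_betw_imp_surj_on[OF a] by blast
  have bk: "\<exists>k\<in>{1..q}. i = b k" if "i \<in> {1..q}" for i
    using that bij_betw_imp_surj_on[OF b] by blast
  have uu: "i = j" if ij: "conn g (Up i) (Up j)" for i j
  proof (rule ccontr)
    assume ne: "i \<noteq> j"
    have "i \<in> {1..q}"
    proof (rule ccontr)
      assume "i \<notin> {1..q}"
      then have "sat g {i} {}" using dep[OF triv] by auto
      then show False using sat_conn(2)[OF _ ij] ne by blast
    qed
    moreover have "j \<in> {1..q}"
    proof (rule ccontr)
      assume "j \<notin> {1..q}"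
      then have "sat g {j} {}" using dep[OF triv] by auto
      then show False using sat_conn(2)[OF _ ij] ne by blast
    qed
    ultimately show False using ak ij ne ab unfolding is_reps_def by metis
  qed
  have ll: "i = j" if ij: "conn g (Lo i) (Lo j)" for i j
  proof (rule ccontr)
    assume ne: "i \<noteq> j"
    have "i \<in> {1..q}"
    proof (rule ccontr)
      assume "i \<notin> {1..q}"
      then have "sat g {} {i}" using dep[OF triv] by auto
      then show False using sat_conn(3)[OF _ ij] ne by blast
    qed
    moreover have "j \<in> {1..q}"
    proof (rule ccontr)
      assume "j \<notin> {1..q}"
      then have "sat g {} {j}" using dep[OF triv] by auto
      then show False using sat_conn(3)[OF _ ij] ne by blast
    qed
    ultimately obtain k l where kl: "k \<in> {1..q}" "l \<in> {1..q}" "i = b k" "j = b l" using bk by metis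
    then have "conn g (Up (a k)) (Up (a l))"
      using ij c[of k] c[of l] conn_trans[OF g(1)] conn_sym by metis
    then show False using uu ab kl ne r(3) by (metis inj_onD)
  qed
  have "g = bar n q \<sigma>"
  proof (rule Q_eqI)
    fix A B
    show "sat g A B = sat (bar n q \<sigma>) A B" unfolding sat_bar[OF q p]
    proof
      assume s: "sat g A B"
      show "\<forall>k\<in>{1..q}. (k \<in> A) = (\<sigma> k \<in> B)"
      proof
        fix i assume "i \<in> {1..q}"
        then obtain k where "k \<in> {1..q}" "i = a k" using ak by blast
        then show "(i \<in> A) = (\<sigma> i \<in> B)" using sat_conn(1)[OF s c] sa by simp
      qed
    next
      assume s: "\<forall>k\<in>{1..q}. (k \<in> A) = (\<sigma> k \<in> B)"
      show "sat g A B" unfolding sat_iff[OF g(1)]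
      proof (intro conjI allI impI)
        fix i j assume ij: "conn g (Up i) (Lo j)"
        then obtain k where k: "k \<in> {1..q}" "i = a k" using ak[OF out] by blast
        then have "j = b k" using ll conn_trans[OF g(1) conn_sym[OF c[OF k(1)]]] ij by metis
        then show "(i \<in> A) = (j \<in> B)" using s out[OF ij] sa[OF k(1)] k by metis
      qed (use uu ll in blast)+
    qed
  qed (use g p q in auto)
  then show ?thesis using p that by blast
qed

text \<open>If the rank does not drop, \<open>e q \<odot> (u \<odot> s) \<odot> e q\<close> has rank
  \<open>q\<close> for a suitable \<open>u\<close>. It is then a unit of the local monoid at
  \<open>e q\<close> and can be inverted there.\<close>

lemma left_cancel_e:
  assumes "q \<le> n" "s \<in> Q" "part_rank (s \<odot> e q) = q"
  obtains u where "u \<in> Q" "u \<odot> (s \<odot> e q) = e q"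
proof -
  obtain u v where uv: "u \<in> Q" "v \<in> Q" "u \<odot> (s \<odot> e q) \<odot> v = e q"
    using rank_middle[of "s \<odot> e q"] assms by auto
  let ?g = "e q \<odot> (u \<odot> s) \<odot> e q"
  have "?g \<odot> v = e q \<odot> (u \<odot> (s \<odot> e q) \<odot> v)" using assms(1,2) uv(1,2) by (simp add: mult_assoc)
  then have "?g \<odot> v = e q" using uv assms by simp
  then have "q \<le> part_rank ?g" using rank_mult(1)[of ?g v] uv assms(1) by simp
  moreover have "part_rank ?g \<le> q" using rank_mult(2)[of "e q \<odot> (u \<odot> s)" "e q"] assms(1) by simp
  moreover have "e q \<odot> ?g \<odot> e q = ?g" using assms(1,2) uv(1)
    by (simp add: mult_assoc) (simp flip: mult_assoc)
  ultimately obtain \<sigma> where \<sigma>: "\<sigma> permutes {1..q}" "?g = bar n q \<sigma>"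
    using local_rank_q[OF assms(1) mult_closed] by (metis antisym)
  have "bar n q (inv' \<sigma>) \<odot> (e q \<odot> u) \<odot> (s \<odot> e q) = bar n q (inv' \<sigma>) \<odot> ?g"
    using assms(1,2) uv(1) permutes_inv[OF \<sigma>(1)] by (simp add: mult_assoc)
  also have "\<dots> = e q" using \<sigma> bar_inverse assms(1) by simp
  finally show ?thesis using that by (metis mult_closed)
qed

lemma right_cancel_e:
  assumes "q \<le> n" "t \<in> Q" "part_rank (e q \<odot> t) = q"
  obtains v where "v \<in> Q" "e q \<odot> t \<odot> v = e q"
proof -
  have "part_rank (flip t \<odot> e q) = q" using rank_flip[of "e q \<odot> t"] assms by (simp add: flip_mult)
  then obtain u where u: "u \<in> Q" "u \<odot> (flip t \<odot> e q) = e q" using left_cancel_e[OF assms(1) flip_Q] by blast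
  have "flip (u \<odot> (flip t \<odot> e q)) = e q" using u assms by simp
  then have "e q \<odot> t \<odot> flip u = e q" using u(1) assms(1,2) by (simp add: flip_mult)
  then show ?thesis using that by (metis flip_Q)
qed

section \<open>Ideals and IN-pairs\<close>

abbreviation P :: "pt set set monoid" where "P \<equiv> part_monoid n"
abbreviation Sbar :: "nat \<Rightarrow> pt set set set" where "Sbar q \<equiv> bar n q ` {\<sigma>. \<sigma> permutes {1..q}}"
abbreviation I :: "nat \<Rightarrow> pt set set set" where "I q \<equiv> I_ideal n q"

lemma I_iff: "\<alpha> \<in> I q \<longleftrightarrow> \<alpha> \<in> Q \<and> part_rank \<alpha> \<le> q"
  by (simp add: I_ideal_def)

lemma I_ideal_mult:
  "\<alpha> \<in> I q \<Longrightarrow> s \<in> Q \<Longrightarrow> s \<odot> \<alpha> \<in> I q" "\<alpha> \<in> I q \<Longrightarrow> s \<in> Q \<Longrightarrow> \<alpha> \<odot> s \<in> I q"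
  unfolding I_iff using rank_mult(2)[of s \<alpha>] rank_mult(1)[of \<alpha> s] by auto

text \<open>An element of largest rank generates the whole ideal.\<close>

lemma sg_ideal_iff: "sg_ideal P J \<longleftrightarrow> (\<exists>q\<le>n. J = I q)"
proof
  assume J: "sg_ideal P J"
  define q where "q = Max (part_rank ` J)"
  have sub: "J \<subseteq> Q" and ne: "J \<noteq> {}"
    and cl: "\<And>x s. x \<in> J \<Longrightarrow> s \<in> Q \<Longrightarrow> s \<odot> x \<in> J \<and> x \<odot> s \<in> J"
    using J by (auto simp: sg_ideal_def)
  have fin: "finite (part_rank ` J)" using sub rank_le_n by (auto intro!: finite_subset[of _ "{..n}"])
  have "q \<in> part_rank ` J" unfolding q_def using fin ne by (intro Max_in) auto
  then obtain \<alpha> where \<alpha>: "\<alpha> \<in> J" "part_rank \<alpha> = q" by blast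
  have "J = I q"
  proof (intro equalityI subsetI)
    fix x assume "x \<in> J"
    then show "x \<in> I q" using sub fin by (auto simp: I_iff q_def)
  next
    fix x assume "x \<in> I q"
    then obtain s t where "s \<in> Q" "t \<in> Q" "x = s \<odot> \<alpha> \<odot> t"
      using rank_le_factor[of x \<alpha>] \<alpha> sub by (auto simp: I_iff)
    then show "x \<in> J" using cl \<alpha> by simp
  qed
  then show "\<exists>q\<le>n. J = I q" using \<alpha> sub rank_le_n by auto
next
  assume "\<exists>q\<le>n. J = I q"
  then obtain q where q: "q \<le> n" "J = I q" by blast
  then have "e q \<in> J" by (simp add: I_iff)
  then have "J \<noteq> {}" by blast
  moreover have "J \<subseteq> Q" using q by (auto simp: I_iff)
  ultimately show "sg_ideal P J" unfolding sg_ideal_def q(2) using I_ideal_mult by simp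
qed

lemma I_subset_iff: "p \<le> n \<Longrightarrow> I p \<subseteq> I q \<longleftrightarrow> p \<le> q"
proof
  assume "p \<le> n" "I p \<subseteq> I q"
  moreover from this have "e p \<in> I p" by (simp add: I_iff)
  ultimately have "e p \<in> I q" by blast
  then show "p \<le> q" using \<open>p \<le> n\<close> by (simp add: I_iff)
qed (auto simp: I_iff)

lemma min_ideal_eq: "min_ideal P = I 0"
  unfolding min_ideal_def
proof (rule the_equality)
  show "sg_ideal P (I 0) \<and> (\<forall>J. sg_ideal P J \<and> J \<subseteq> I 0 \<longrightarrow> J = I 0)"
    unfolding sg_ideal_iff using I_subset_iff by (metis le_0_eq zero_le)
  fix M assume M: "sg_ideal P M \<and> (\<forall>J. sg_ideal P J \<and> J \<subseteq> M \<longrightarrow> J = M)"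
  then obtain q where "q \<le> n" "M = I q" unfolding sg_ideal_iff by blast
  then have "I 0 \<subseteq> M" using I_subset_iff by simp
  then show "M = I 0" using M unfolding sg_ideal_iff by blast
qed

lemma princ_ideal_iff:
  assumes "\<beta> \<in> Q" shows "\<alpha> \<in> princ_ideal P \<beta> \<longleftrightarrow> \<alpha> \<in> Q \<and> part_rank \<alpha> \<le> part_rank \<beta>"
proof
  assume "\<alpha> \<in> princ_ideal P \<beta>"
  then show "\<alpha> \<in> Q \<and> part_rank \<alpha> \<le> part_rank \<beta>"
    unfolding princ_ideal_def using assms rank_mult3 by auto
next
  assume "\<alpha> \<in> Q \<and> part_rank \<alpha> \<le> part_rank \<beta>"
  then obtain s t where "s \<in> Q" "t \<in> Q" "\<alpha> = s \<odot> \<beta> \<odot> t" using rank_le_factor assms by metis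
  then show "\<alpha> \<in> princ_ideal P \<beta>" unfolding princ_ideal_def by auto
qed

lemma green_J_iff: "(\<alpha>, \<beta>) \<in> green_J P \<longleftrightarrow> \<alpha> \<in> Q \<and> \<beta> \<in> Q \<and> part_rank \<alpha> = part_rank \<beta>"
proof -
  have "princ_ideal P \<alpha> = princ_ideal P \<beta> \<longleftrightarrow> part_rank \<alpha> = part_rank \<beta>" if "\<alpha> \<in> Q" "\<beta> \<in> Q"
  proof
    assume "princ_ideal P \<alpha> = princ_ideal P \<beta>"
    then show "part_rank \<alpha> = part_rank \<beta>"
      using princ_ideal_iff[OF that(1)] princ_ideal_iff[OF that(2)] that by (metis antisym order_refl)
  qed (use princ_ideal_iff[OF that(1)] princ_ideal_iff[OF that(2)] in auto)
  then show ?thesis unfolding green_J_def by auto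
qed

definition J_class :: "nat \<Rightarrow> pt set set set" where
  "J_class q = {\<alpha> \<in> Q. part_rank \<alpha> = q}"

lemma J_classes_eq: "J_classes P = J_class ` {..n}"
proof -
  have im: "green_J P `` {\<alpha>} = J_class (part_rank \<alpha>)" if "\<alpha> \<in> Q" for \<alpha>
    using that by (auto simp: J_class_def green_J_iff)
  have "J_class q \<in> J_classes P" if "q \<le> n" for q
    using im[of "e q"] that unfolding J_classes_def by (metis e_Q quotientI rank_e)
  moreover have "X \<in> J_class ` {..n}" if "X \<in> J_classes P" for X
    using that im rank_le_n unfolding J_classes_def by (auto elim!: quotientE)
  ultimately show ?thesis by auto
qed

lemma e_in_J_class: "q \<le> n \<Longrightarrow> e q \<in> J_class p \<longleftrightarrow> p = q"
  by (auto simp: J_class_def)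

lemma J_le_iff: "p \<le> n \<Longrightarrow> q \<le> n \<Longrightarrow> J_le P (J_class p) (J_class q) \<longleftrightarrow> p \<le> q"
proof
  assume "J_le P (J_class p) (J_class q)" then show "p \<le> q"
    unfolding J_le_def using princ_ideal_iff by (auto simp: J_class_def)
next
  assume "p \<le> n" "q \<le> n" "p \<le> q"
  then show "J_le P (J_class p) (J_class q)" unfolding J_le_def
    using princ_ideal_iff[of "e q" "e p"] e_in_J_class by (metis e_Q rank_e)
qed

lemma J_class_subset_iff: "p \<le> n \<Longrightarrow> J_class p \<subseteq> Q - I q \<longleftrightarrow> q < p"
proof
  assume "p \<le> n" "J_class p \<subseteq> Q - I q"
  then show "q < p" using e_in_J_class[of p p] by (auto simp: I_iff)
qed (auto simp: J_class_def I_iff)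

lemma minimal_outside_iff:
  assumes "q \<le> n" shows "minimal_outside P (I q) J \<longleftrightarrow> q < n \<and> J = J_class (Suc q)"
proof
  assume m: "minimal_outside P (I q) J"
  then obtain p where p: "p \<le> n" "J = J_class p" unfolding minimal_outside_def J_classes_eq by blast
  then have qp: "q < p" using m J_class_subset_iff unfolding minimal_outside_def by blast
  then have "J_class (Suc q) \<in> J_classes P" "J_class (Suc q) \<subseteq> Q - I q" "J_le P (J_class (Suc q)) J"
    using p J_class_subset_iff[of "Suc q" q] J_le_iff[of "Suc q" p] by (auto simp: J_classes_eq)
  then have "J_class (Suc q) = J" using m unfolding minimal_outside_def by blast
  then show "q < n \<and> J = J_class (Suc q)" using qp p by simp
next
  assume a: "q < n \<and> J = J_class (Suc q)"
  show "minimal_outside P (I q) J" unfolding minimal_outside_def J_classes_eq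
  proof (intro conjI ballI impI)
    fix J' assume "J' \<in> J_class ` {..n}" and J': "J' \<subseteq> carrier P - I q \<and> J_le P J' J"
    then obtain p where p: "p \<le> n" "J' = J_class p" by blast
    then have "q < p" "p \<le> Suc q" using J' J_class_subset_iff[of p q] J_le_iff[of p "Suc q"] a by auto
    then show "J' = J" using p a by (metis Suc_leI antisym)
  qed (use a J_class_subset_iff[of "Suc q" q] in auto)
qed

text \<open>The identity that makes P_n a regular *-semigroup. It gives regularity of the J-classes,
  and it lets the projections \<open>\<alpha> \<odot> flip \<alpha>\<close> and
  \<open>flip \<alpha> \<odot> \<alpha>\<close> stand for the R-class and the L-class of
  \<open>\<alpha>\<close> below.\<close>

lemma flip_regular: "\<alpha> \<in> Q \<Longrightarrow> \<alpha> \<odot> flip \<alpha> \<odot> \<alpha> = \<alpha>"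
proof (rule Q_eqI)
  fix A D assume a: "\<alpha> \<in> Q"
  show "sat (\<alpha> \<odot> flip \<alpha> \<odot> \<alpha>) A D = sat \<alpha> A D" (is "?l = ?r")
  proof
    assume ?l
    then obtain B C where s: "sat \<alpha> A B" "sat \<alpha> C B" "sat \<alpha> C D" using a by (auto simp: sat_mult sat_flip)
    show ?r unfolding sat_iff[OF a]
      using sat_conn[OF s(1)] sat_conn[OF s(2)] sat_conn[OF s(3)] by blast
  next
    assume ?r then show ?l using a by (auto simp: sat_mult sat_flip)
  qed
qed auto

lemma regular_J_class: "regular_set P (J_class q)"
  unfolding regular_set_def J_class_def using flip_regular by fastforce

section \<open>Maximal subgroups and IN-pairs\<close>

lemma S_bar_eq: "S_bar n q = Sbar q"
  by (simp add: S_bar_def sym_group_def)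

lemma subgroup_at_simps [simp]:
  "carrier (subgroup_at S G u) = G" "mult (subgroup_at S G u) = mult S" "one (subgroup_at S G u) = u"
  by (simp_all add: subgroup_at_def)

lemma Sbar_group:
  assumes "q \<le> n" shows "group (subgroup_at P (Sbar q) (e q))"
proof (rule groupI, unfold subgroup_at_simps mult_part_monoid)
  show "x \<odot> y \<in> Sbar q" if xy: "x \<in> Sbar q" "y \<in> Sbar q" for x y
  proof -
    obtain \<sigma> \<tau> where "x = bar n q \<sigma>" "y = bar n q \<tau>" "\<sigma> permutes {1..q}" "\<tau> permutes {1..q}"
      using xy by blast
    then show ?thesis using bar_mult[OF assms] permutes_compose by blast
  qed
  show "e q \<in> Sbar q" by (simp add: permutes_id)
  show "x \<odot> y \<odot> z = x \<odot> (y \<odot> z)" if "x \<in> Sbar q" "y \<in> Sbar q" "z \<in> Sbar q" for x y z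
    using that assms by (intro mult_assoc) auto
  show "e q \<odot> x = x" if "x \<in> Sbar q" for x using that assms by auto
  show "\<exists>y\<in>Sbar q. y \<odot> x = e q" if "x \<in> Sbar q" for x
    using that bar_inverse(2)[OF assms] permutes_inv by blast
qed

text \<open>A subgroup with identity \<open>e q\<close> consists of units of the local monoid at
  \<open>e q\<close>, hence of permutations.\<close>

lemma subgroup_at_e:
  assumes "q \<le> n" "is_subgroup_at P G (e q)" shows "G \<subseteq> Sbar q"
proof
  interpret group "subgroup_at P G (e q)" using assms by (simp add: is_subgroup_at_def)
  fix g assume g: "g \<in> G"
  have GQ: "G \<subseteq> Q" using assms by (simp add: is_subgroup_at_def)
  have eg: "e q \<odot> g = g" "g \<odot> e q = g" using l_one[of g] r_one[of g] g by simp_all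
  obtain h where h: "h \<in> G" "g \<odot> h = e q" using r_inv_ex[of g] g by auto
  have "part_rank g = q"
    using rank_mult(1)[of g h] rank_mult(1)[of "e q" g] subsetD[OF GQ g] subsetD[OF GQ h(1)]
      h(2) assms(1) eg by simp
  moreover have "g \<in> Q" "e q \<odot> g \<odot> e q = g" using g GQ eg by auto
  ultimately obtain \<sigma> where "\<sigma> permutes {1..q}" "g = bar n q \<sigma>"
    using local_rank_q[OF assms(1)] by metis
  then show "g \<in> Sbar q" by blast
qed

lemma is_subgroup_Sbar: "q \<le> n \<Longrightarrow> is_subgroup_at P (Sbar q) (e q)"
  unfolding is_subgroup_at_def using Sbar_group by auto

lemma idem_in_group:
  assumes "group (subgroup_at P G u)" "f \<in> G" "f \<odot> f = f" shows "f = u"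
proof -
  interpret group "subgroup_at P G u" by fact
  show ?thesis using assms r_cancel_one[of f f] by simp
qed

lemma maximal_Sbar:
  assumes "q \<le> n" shows "maximal_subgroup_at P (Sbar q) (e q)"
  unfolding maximal_subgroup_at_def
proof (intro conjI allI impI)
  fix G u assume G: "is_subgroup_at P G u \<and> Sbar q \<subseteq> G"
  have "e q \<in> G" using G by (auto simp: permutes_id)
  then have "e q = u" using G idem_in_group[of G u "e q"] e_e[OF assms] unfolding is_subgroup_at_def by blast
  then show "G = Sbar q" using G subgroup_at_e[OF assms] by blast
qed (rule is_subgroup_Sbar[OF assms])

lemma maximal_subgroup_unique:
  assumes "q \<le> n" "maximal_subgroup_at P G (e q)" shows "G = Sbar q"
  using assms subgroup_at_e is_subgroup_Sbar unfolding maximal_subgroup_at_def by blast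

lemma inv_subgroup_Sbar:
  assumes "q \<le> n" "\<sigma> permutes {1..q}"
  shows "inv\<^bsub>subgroup_at P (Sbar q) (e q)\<^esub> (bar n q \<sigma>) = bar n q (inv' \<sigma>)"
proof -
  interpret group "subgroup_at P (Sbar q) (e q)" by (rule Sbar_group[OF assms(1)])
  show ?thesis
    by (rule inv_equality) (use assms bar_inverse(2)[OF assms] permutes_inv in auto)
qed

text \<open>\<open>bar\<close> reverses products, so conjugation by \<open>\<tau>\<close> turns into
  conjugation by its inverse; quantified over all \<open>\<tau>\<close> this makes no
  difference.\<close>

lemma normal_bar_iff:
  assumes q: "q \<le> n" and N: "N \<subseteq> {\<sigma>. \<sigma> permutes {1..q}}"
  shows "normal (bar n q ` N) (subgroup_at P (Sbar q) (e q)) \<longleftrightarrow> normal N (sym_group q)"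
proof -
  interpret group "subgroup_at P (Sbar q) (e q)" by (rule Sbar_group[OF q])
  have mem: "bar n q \<sigma> \<in> bar n q ` N \<longleftrightarrow> \<sigma> \<in> N" if "\<sigma> permutes {1..q}" for \<sigma>
    using that N bar_inj[of \<sigma> q] by auto
  have p: "\<sigma> permutes {1..q}" if "\<sigma> \<in> N" for \<sigma> using that N by blast
  note pi = permutes_inv permutes_compose permutes_id
  have inv: "inv\<^bsub>subgroup_at P (Sbar q) (e q)\<^esub> (bar n q \<sigma>) = bar n q (inv' \<sigma>)"
    if "\<sigma> permutes {1..q}" for \<sigma> using that by (rule inv_subgroup_Sbar[OF q])
  have sub: "subgroup (bar n q ` N) (subgroup_at P (Sbar q) (e q)) \<longleftrightarrow> id \<in> N \<and>
    (\<forall>\<sigma>\<in>N. \<forall>\<tau>\<in>N. \<tau> \<circ> \<sigma> \<in> N) \<and> (\<forall>\<sigma>\<in>N. inv' \<sigma> \<in> N)"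
  proof -
    have 1: "(\<forall>x y. x \<in> bar n q ` N \<longrightarrow> y \<in> bar n q ` N \<longrightarrow> x \<odot> y \<in> bar n q ` N) \<longleftrightarrow>
        (\<forall>\<sigma>\<in>N. \<forall>\<tau>\<in>N. bar n q \<sigma> \<odot> bar n q \<tau> \<in> bar n q ` N)" by blast
    have 2: "(\<forall>x. x \<in> bar n q ` N \<longrightarrow> inv\<^bsub>subgroup_at P (Sbar q) (e q)\<^esub> x \<in> bar n q ` N) \<longleftrightarrow>
        (\<forall>\<sigma>\<in>N. inv\<^bsub>subgroup_at P (Sbar q) (e q)\<^esub> (bar n q \<sigma>) \<in> bar n q ` N)" by blast
    have 3: "bar n q ` N \<subseteq> Sbar q" using N by blast
    show ?thesis unfolding subgroup_def subgroup_at_simps mult_part_monoid 1 2 mem[OF permutes_id]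
      using 3 p by (auto simp: bar_mult[OF q] mem pi inv)
  qed
  have c1: "bar n q \<tau> \<odot> bar n q \<sigma> \<odot> bar n q (inv' \<tau>) \<in> bar n q ` N \<longleftrightarrow> inv' \<tau> \<circ> (\<sigma> \<circ> \<tau>) \<in> N"
    if "\<tau> permutes {1..q}" "\<sigma> \<in> N" for \<tau> \<sigma>
    using that p by (simp add: bar_mult[OF q] mem pi)
  have conj: "(\<forall>x\<in>Sbar q. \<forall>h\<in>bar n q ` N. x \<odot> h \<odot> inv\<^bsub>subgroup_at P (Sbar q) (e q)\<^esub> x \<in> bar n q ` N) \<longleftrightarrow>
    (\<forall>\<tau>. \<tau> permutes {1..q} \<longrightarrow> (\<forall>\<sigma>\<in>N. inv' \<tau> \<circ> (\<sigma> \<circ> \<tau>) \<in> N))" (is "?a \<longleftrightarrow> ?b")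
  proof -
    have "?a \<longleftrightarrow> (\<forall>\<tau>. \<tau> permutes {1..q} \<longrightarrow> (\<forall>\<sigma>\<in>N. bar n q \<tau> \<odot> bar n q \<sigma> \<odot>
        inv\<^bsub>subgroup_at P (Sbar q) (e q)\<^esub> (bar n q \<tau>) \<in> bar n q ` N))" by blast
    then show ?thesis using c1 inv by simp
  qed
  also have "\<dots> \<longleftrightarrow> (\<forall>\<tau>. \<tau> permutes {1..q} \<longrightarrow> (\<forall>\<sigma>\<in>N. \<tau> \<circ> \<sigma> \<circ> inv' \<tau> \<in> N))"
  proof (intro iffI allI impI ballI)
    fix \<tau> \<sigma> assume "\<forall>\<tau>. \<tau> permutes {1..q} \<longrightarrow> (\<forall>\<sigma>\<in>N. inv' \<tau> \<circ> (\<sigma> \<circ> \<tau>) \<in> N)" "\<tau> permutes {1..q}" "\<sigma> \<in> N"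
    then have "inv' (inv' \<tau>) \<circ> (\<sigma> \<circ> inv' \<tau>) \<in> N" using permutes_inv by blast
    then show "\<tau> \<circ> \<sigma> \<circ> inv' \<tau> \<in> N" using permutes_inv_inv[OF \<open>\<tau> permutes _\<close>] by (simp add: comp_assoc)
  next
    fix \<tau> \<sigma> assume "\<forall>\<tau>. \<tau> permutes {1..q} \<longrightarrow> (\<forall>\<sigma>\<in>N. \<tau> \<circ> \<sigma> \<circ> inv' \<tau> \<in> N)" "\<tau> permutes {1..q}" "\<sigma> \<in> N"
    then have "inv' \<tau> \<circ> \<sigma> \<circ> inv' (inv' \<tau>) \<in> N" using permutes_inv by blast
    then show "inv' \<tau> \<circ> (\<sigma> \<circ> \<tau>) \<in> N" using permutes_inv_inv[OF \<open>\<tau> permutes _\<close>] by (simp add: comp_assoc)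
  qed
  finally show ?thesis
    unfolding normal_inv_iff normal_sym_iff sub subgroup_at_simps mult_part_monoid using N by auto
qed

text \<open>\<open>M\<close> contains the idempotent \<open>e q\<close>, which must be the identity
  of the ambient maximal subgroup. This identifies that subgroup as \<open>Sbar q\<close>, and its
  J-class shows that \<open>q\<close> is one more than the rank bounding the ideal.\<close>

lemma IN_pair_char:
  assumes "q \<le> n"
  shows "IN_pair P J M \<and> le_S_bar n q M \<longleftrightarrow>
    1 \<le> q \<and> J = I (q - 1) \<and> (\<exists>N. normal N (sym_group q) \<and> M = bar n q ` N)"
proof
  assume "IN_pair P J M \<and> le_S_bar n q M"
  then obtain C G u p where h: "p \<le> n" "J = I p" "minimal_outside P (I p) C" "G \<subseteq> C"
      "maximal_subgroup_at P G u" "normal M (subgroup_at P G u)"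
    and le: "subgroup M (subgroup_at P (Sbar q) (e q))"
    unfolding IN_pair_def sg_ideal_iff le_S_bar_def S_bar_eq by blast
  have pC: "p < n" "C = J_class (Suc p)" using h minimal_outside_iff by auto
  have MS: "M \<subseteq> Sbar q" "e q \<in> M" using le by (auto simp: subgroup_def)
  have "M \<subseteq> G" using h(6) normal_imp_subgroup subgroup.subset by fastforce
  then have "e q \<in> G" using MS by blast
  then have qp: "q = Suc p" using h(4) pC assms by (auto simp: J_class_def)
  have "group (subgroup_at P G u)" using h(5) by (simp add: maximal_subgroup_at_def is_subgroup_at_def)
  then have "e q = u" using \<open>e q \<in> G\<close> idem_in_group[of G u "e q"] e_e[OF assms] by blast
  then have "G = Sbar q" using maximal_subgroup_unique[OF assms] h(5) by blast
  define N where "N = {\<sigma>. \<sigma> permutes {1..q} \<and> bar n q \<sigma> \<in> M}"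
  have "M = bar n q ` N" using MS by (auto simp: N_def)
  moreover from this have "normal N (sym_group q)"
    using normal_bar_iff[OF assms, of N] h(6) \<open>G = Sbar q\<close> \<open>e q = u\<close> by (auto simp: N_def)
  ultimately show "1 \<le> q \<and> J = I (q - 1) \<and> (\<exists>N. normal N (sym_group q) \<and> M = bar n q ` N)"
    using qp h(2) by auto
next
  assume "1 \<le> q \<and> J = I (q - 1) \<and> (\<exists>N. normal N (sym_group q) \<and> M = bar n q ` N)"
  then obtain N where q: "1 \<le> q" "J = I (q - 1)" and N: "normal N (sym_group q)" "M = bar n q ` N"
    by blast
  have M: "normal M (subgroup_at P (Sbar q) (e q))"
    using N normal_bar_iff[OF assms, of N] by (auto simp: normal_sym_iff)
  have "minimal_outside P (I (q - 1)) (J_class q)" using minimal_outside_iff[of "q - 1"] q assms by auto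
  moreover have "Sbar q \<subseteq> J_class q" using assms by (auto simp: J_class_def)
  moreover have "sg_ideal P (I (q - 1))" unfolding sg_ideal_iff using assms by (intro exI[of _ "q - 1"]) auto
  ultimately show "IN_pair P J M \<and> le_S_bar n q M"
    unfolding IN_pair_def le_S_bar_def S_bar_eq
    using M q maximal_Sbar[OF assms] regular_J_class normal_imp_subgroup by blast
qed

lemma proper_card:
  assumes "q \<le> n" "normal N (sym_group q)"
  shows "card (bar n q ` N) \<ge> 2 \<longleftrightarrow> N \<noteq> {id}"
proof -
  have N: "N \<subseteq> {\<sigma>. \<sigma> permutes {1..q}}" "id \<in> N" using assms(2) by (auto simp: normal_sym_iff)
  have "finite N" using N(1) finite_permutations[of "{1..q}"] finite_subset by auto
  have "card (bar n q ` N) = card N"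
    using N(1) bar_inj by (intro card_image inj_onI) blast
  moreover have "card N = 1 \<longleftrightarrow> N = {id}" using N(2) by (auto elim!: card_1_singletonE)
  moreover have "card N > 0" using \<open>finite N\<close> N(2) by (auto simp: card_gt_0_iff)
  ultimately show ?thesis by linarith
qed

lemma permutes_small: "q \<le> (1::nat) \<Longrightarrow> \<sigma> permutes {1..q} \<Longrightarrow> \<sigma> = id"
  by (cases "q = 0") (auto simp: le_Suc_eq One_nat_def)

lemma proper_IN_pairs:
  "{(J, M). proper_IN_pair P J M \<and> (\<exists>q\<le>n. le_S_bar n q M)} =
   {(I (q - 1), bar n q ` N) | q N. 2 \<le> q \<and> q \<le> n \<and> nontriv_normal q N}" (is "?l = ?r")
proof (intro equalityI subrelI)
  fix J M assume "(J, M) \<in> ?l"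
  then obtain q where q: "q \<le> n" "IN_pair P J M" "card M \<ge> 2" "le_S_bar n q M"
    by (auto simp: proper_IN_pair_def)
  then obtain N where N: "normal N (sym_group q)" "M = bar n q ` N" "J = I (q - 1)"
    using IN_pair_char[OF q(1), of J M] q(2,4) by metis
  have ne: "N \<noteq> {id}" using proper_card N q by blast
  have "2 \<le> q"
  proof (rule ccontr)
    assume "\<not> 2 \<le> q"
    then have "N \<subseteq> {id}" using N(1) permutes_small[of q] unfolding normal_sym_iff by auto
    then show False using ne N(1) unfolding normal_sym_iff by auto
  qed
  then show "(J, M) \<in> ?r" using N ne q(1) unfolding nontriv_normal_def by auto
next
  fix J M assume "(J, M) \<in> ?r"
  then obtain q N where "2 \<le> q" "q \<le> n" "nontriv_normal q N" "J = I (q - 1)" "M = bar n q ` N" by auto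
  moreover from this have "IN_pair P J M \<and> le_S_bar n q M"
    using IN_pair_char[of q J M] unfolding nontriv_normal_def by auto
  ultimately show "(J, M) \<in> ?l" using proper_card unfolding proper_IN_pair_def nontriv_normal_def by auto
qed

section \<open>Retractions onto the minimal ideal\<close>

lemma sat_const: "\<alpha> \<in> Q \<Longrightarrow> sat \<alpha> {} {}" "\<alpha> \<in> Q \<Longrightarrow> sat \<alpha> UNIV UNIV"
  by (simp_all add: sat_iff)

lemma sat_compl: "sat \<alpha> A B \<Longrightarrow> \<alpha> \<in> Q \<Longrightarrow> sat \<alpha> (- A) (- B)"
  using sat_conn[of \<alpha> A B] by (auto simp: sat_iff[of \<alpha> "- A"])

lemma sat_e0 [simp]: "sat (e 0) A B"
  by (simp add: sat_e)

lemma e0_mid [simp]: "\<alpha> \<in> Q \<Longrightarrow> e 0 \<odot> \<alpha> \<odot> e 0 = e 0"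
  by (rule Q_eqI) (use sat_const in \<open>auto simp: sat_mult\<close>)

text \<open>Absorption rules in right-nested form, so that they rewrite terms already normalized by
  \<open>mult_assoc\<close>.\<close>

lemma e0_collapse:
  assumes "\<alpha> \<in> Q"
  shows "e 0 \<odot> (\<alpha> \<odot> e 0) = e 0" "\<gamma> \<in> Q \<Longrightarrow> e 0 \<odot> (\<alpha> \<odot> (e 0 \<odot> \<gamma>)) = e 0 \<odot> \<gamma>"
    "\<beta> \<in> Q \<Longrightarrow> e 0 \<odot> (\<alpha> \<odot> (\<beta> \<odot> e 0)) = e 0"
    "\<beta> \<in> Q \<Longrightarrow> \<gamma> \<in> Q \<Longrightarrow> e 0 \<odot> (\<alpha> \<odot> (\<beta> \<odot> (e 0 \<odot> \<gamma>))) = e 0 \<odot> \<gamma>"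
proof -
  have *: "e 0 \<odot> (\<alpha> \<odot> e 0) = e 0" if "\<alpha> \<in> Q" for \<alpha> using e0_mid[OF that] that by (simp add: mult_assoc)
  have **: "e 0 \<odot> (\<alpha> \<odot> (e 0 \<odot> \<gamma>)) = e 0 \<odot> \<gamma>" if "\<alpha> \<in> Q" "\<gamma> \<in> Q" for \<alpha> \<gamma>
  proof -
    have "e 0 \<odot> (\<alpha> \<odot> (e 0 \<odot> \<gamma>)) = e 0 \<odot> (\<alpha> \<odot> e 0) \<odot> \<gamma>" using that by (simp add: mult_assoc)
    then show ?thesis using * that by simp
  qed
  show "e 0 \<odot> (\<alpha> \<odot> e 0) = e 0" "\<gamma> \<in> Q \<Longrightarrow> e 0 \<odot> (\<alpha> \<odot> (e 0 \<odot> \<gamma>)) = e 0 \<odot> \<gamma>" using assms * ** by auto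
  show "\<beta> \<in> Q \<Longrightarrow> e 0 \<odot> (\<alpha> \<odot> (\<beta> \<odot> e 0)) = e 0"
    using *[of "\<alpha> \<odot> \<beta>"] assms by (simp add: mult_assoc)
  show "\<beta> \<in> Q \<Longrightarrow> \<gamma> \<in> Q \<Longrightarrow> e 0 \<odot> (\<alpha> \<odot> (\<beta> \<odot> (e 0 \<odot> \<gamma>))) = e 0 \<odot> \<gamma>"
    using **[of "\<alpha> \<odot> \<beta>" \<gamma>] assms by (simp add: mult_assoc)
qed

text \<open>Whatever label the single thread of \<open>e 1\<close> carries, a constant label on all
  of \<open>\<alpha>\<close> continues it, so against \<open>e 0\<close> it imposes no
  condition.\<close>

lemma e1_e0:
  assumes "1 \<le> n" "\<alpha> \<in> Q" shows "e 1 \<odot> \<alpha> \<odot> e 0 = e 0" "e 0 \<odot> \<alpha> \<odot> e 1 = e 0"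
proof -
  have "\<exists>B C. (1 \<in> A \<longleftrightarrow> 1 \<in> B) \<and> sat \<alpha> B C" for A
    using sat_const[OF assms(2)] by (cases "1 \<in> A") auto
  then have "\<exists>C B. (1 \<in> A \<longleftrightarrow> 1 \<in> B) \<and> sat \<alpha> B C" for A by blast
  then show "e 1 \<odot> \<alpha> \<odot> e 0 = e 0" using assms by (intro Q_eqI) (auto simp: sat_mult sat_e)
  have "\<exists>C B. (1 \<in> B \<longleftrightarrow> 1 \<in> A) \<and> sat \<alpha> C B" for A :: "nat set"
    using sat_const[OF assms(2)] by (cases "1 \<in> A") auto
  then have "\<exists>B. (\<exists>C. sat \<alpha> C B) \<and> (1 \<in> B \<longleftrightarrow> 1 \<in> A)" for A :: "nat set" by blast
  then show "e 0 \<odot> \<alpha> \<odot> e 1 = e 0" using assms by (intro Q_eqI) (auto simp: sat_mult sat_e)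
qed

lemma rank_le_via_e:
  assumes "\<alpha> \<in> Q" "part_rank \<alpha> \<le> q" "q \<le> n"
  obtains s t where "s \<in> Q" "t \<in> Q" "\<alpha> = s \<odot> e q \<odot> t"
  using rank_le_factor[OF assms(1) e_Q[OF assms(3)]] assms by auto

text \<open>The previous lemma, carried from \<open>e 1\<close> to everything that factors through
  it. This absorption makes the map from \<open>\<alpha>\<close> to
  \<open>\<alpha> \<odot> e 0 \<odot> \<alpha>\<close> multiplicative on I_1.\<close>

lemma absorb_e0:
  assumes "1 \<le> n" "\<alpha> \<in> I 1" "\<beta> \<in> Q"
  shows "\<alpha> \<odot> \<beta> \<odot> e 0 = \<alpha> \<odot> e 0" "e 0 \<odot> \<beta> \<odot> \<alpha> = e 0 \<odot> \<alpha>"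
proof -
  obtain s t where st: "s \<in> Q" "t \<in> Q" "\<alpha> = s \<odot> e 1 \<odot> t"
    using rank_le_via_e[of \<alpha> 1] assms by (auto simp: I_iff)
  have *: "s \<odot> (e 1 \<odot> x \<odot> e 0) = s \<odot> e 0" "(e 0 \<odot> x \<odot> e 1) \<odot> t = e 0 \<odot> t" if "x \<in> Q" for x
    using e1_e0[OF assms(1) that] by simp_all
  show "\<alpha> \<odot> \<beta> \<odot> e 0 = \<alpha> \<odot> e 0"
    using *(1)[of "t \<odot> \<beta>"] *(1)[OF st(2)] st(1,2) assms(1,3) by (simp add: st(3) mult_assoc)
  show "e 0 \<odot> \<beta> \<odot> \<alpha> = e 0 \<odot> \<alpha>"
    using *(2)[of "\<beta> \<odot> s"] *(2)[OF st(1)] st(1,2) assms(1,3) by (simp add: st(3) mult_assoc)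
qed

text \<open>\<open>\<alpha> \<odot> e 0 \<odot> \<alpha>\<close> cuts each transversal of
  \<open>\<alpha>\<close> into its upper and its lower half; in rank 0 there is nothing to
  cut.\<close>

lemma rank0_hat:
  assumes "\<alpha> \<in> I 0" shows "\<alpha> \<odot> e 0 \<odot> \<alpha> = \<alpha>"
proof -
  obtain s t where st: "s \<in> Q" "t \<in> Q" "\<alpha> = s \<odot> e 0 \<odot> t"
    using rank_le_via_e[of \<alpha> 0] assms by (auto simp: I_iff)
  show ?thesis using st(1,2) by (simp add: st(3) mult_assoc e0_collapse)
qed

lemma I0_subset: "I 0 \<subseteq> I 1"
  by (auto simp: I_iff)

lemma e0_I0: "\<alpha> \<in> Q \<Longrightarrow> \<alpha> \<odot> e 0 \<in> I 0" "\<alpha> \<in> Q \<Longrightarrow> e 0 \<odot> \<alpha> \<in> I 0"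
  using I_ideal_mult[of "e 0" 0 \<alpha>] by (auto simp: I_iff)

lemma hat_I0: "\<alpha> \<in> Q \<Longrightarrow> \<alpha> \<odot> e 0 \<odot> \<alpha> \<in> I 0"
  using I_ideal_mult(2)[OF e0_I0(1)] by blast

lemma retraction_hat:
  assumes "1 \<le> n" "q \<le> 1"
  shows "is_retraction P (I q) (restrict (\<lambda>\<alpha>. \<alpha> \<odot> e 0 \<odot> \<alpha>) (I q))"
proof -
  have sub: "I q \<subseteq> I 1" using assms by (auto simp: I_iff)
  have hom: "\<alpha> \<odot> \<beta> \<odot> e 0 \<odot> (\<alpha> \<odot> \<beta>) = (\<alpha> \<odot> e 0 \<odot> \<alpha>) \<odot> (\<beta> \<odot> e 0 \<odot> \<beta>)"
    if ab: "\<alpha> \<in> I q" "\<beta> \<in> I q" for \<alpha> \<beta>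
  proof -
    have Q: "\<alpha> \<in> Q" "\<beta> \<in> Q" using ab by (auto simp: I_iff)
    have "\<alpha> \<odot> \<beta> \<odot> e 0 \<odot> (\<alpha> \<odot> \<beta>) = \<alpha> \<odot> e 0 \<odot> (\<alpha> \<odot> \<beta>)"
      using absorb_e0(1)[OF assms(1) _ Q(2)] ab sub by auto
    also have "\<dots> = \<alpha> \<odot> (e 0 \<odot> \<alpha> \<odot> \<beta>)" using Q by (simp add: mult_assoc)
    also have "\<dots> = \<alpha> \<odot> (e 0 \<odot> \<beta>)" using absorb_e0(2)[OF assms(1) _ Q(1)] ab sub by auto
    also have "\<dots> = (\<alpha> \<odot> e 0 \<odot> \<alpha>) \<odot> (\<beta> \<odot> e 0 \<odot> \<beta>)"
      using Q by (simp add: mult_assoc e0_collapse)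
    finally show ?thesis .
  qed
  show ?thesis unfolding is_retraction_def min_ideal_eq
  proof (intro conjI ballI)
    show "restrict (\<lambda>\<alpha>. \<alpha> \<odot> e 0 \<odot> \<alpha>) (I q) \<in> hom (P\<lparr>carrier := I q\<rparr>) (P\<lparr>carrier := I 0\<rparr>)"
      using hat_I0 I_ideal_mult hom by (auto simp: hom_def I_iff)
    show "restrict (\<lambda>\<alpha>. \<alpha> \<odot> e 0 \<odot> \<alpha>) (I q) x = x" if "x \<in> I 0" for x
      using that rank0_hat[OF that] by (auto simp: I_iff)
  qed auto
qed

text \<open>Multiplication by \<open>e 0\<close> moves \<open>x\<close> into the minimal ideal,
  where \<open>f\<close> is the identity. So \<open>f x\<close> and \<open>x\<close> have the same
  products with \<open>e 0\<close>, and these determine an element of the minimal ideal.\<close>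

lemma retraction_unique:
  assumes "is_retraction P (I q) f" "x \<in> I q"
  shows "f x = x \<odot> e 0 \<odot> x"
proof -
  have mul: "f (x \<odot> y) = f x \<odot> f y" if "x \<in> I q" "y \<in> I q" for x y
    using assms(1) that unfolding is_retraction_def by (auto dest: hom_mult)
  have fI: "f x \<in> I 0" using assms unfolding is_retraction_def min_ideal_eq hom_def by auto
  have fix0: "f y = y" if "y \<in> I 0" for y using assms(1) that unfolding is_retraction_def min_ideal_eq by blast
  have e0: "e 0 \<in> I q" "e 0 \<in> I 0" by (auto simp: I_iff)
  have xQ: "x \<in> Q" using assms(2) by (simp add: I_iff)
  have fQ: "f x \<in> Q" using fI by (simp add: I_iff)
  have "f x \<odot> e 0 = x \<odot> e 0" using mul[OF assms(2) e0(1)] fix0[OF e0_I0(1)[OF xQ]] fix0[OF e0(2)] by simp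
  moreover have "e 0 \<odot> f x = e 0 \<odot> x" using mul[OF e0(1) assms(2)] fix0[OF e0_I0(2)[OF xQ]] fix0[OF e0(2)] by simp
  moreover have "f x = f x \<odot> e 0 \<odot> f x" using rank0_hat[OF fI] by simp
  ultimately show ?thesis using xQ fQ by (metis mult_assoc e_Q zero_le)
qed

lemma retraction_of_eq:
  assumes "1 \<le> n" "q \<le> 1" "x \<in> I q"
  shows "retraction_of P (I q) x = x \<odot> e 0 \<odot> x"
proof -
  have "retraction_of P (I q) = restrict (\<lambda>\<alpha>. \<alpha> \<odot> e 0 \<odot> \<alpha>) (I q)"
    unfolding retraction_of_def
  proof (rule the_equality)
    show "is_retraction P (I q) (restrict (\<lambda>\<alpha>. \<alpha> \<odot> e 0 \<odot> \<alpha>) (I q))"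
      by (rule retraction_hat[OF assms(1,2)])
    fix f assume f: "is_retraction P (I q) f"
    then have "f \<in> extensional (I q)" by (simp add: is_retraction_def)
    then show "f = restrict (\<lambda>\<alpha>. \<alpha> \<odot> e 0 \<odot> \<alpha>) (I q)"
      by (rule extensionalityI[of _ "I q"]) (use retraction_unique[OF f] in auto)
  qed
  then show ?thesis using assms(3) by simp
qed

text \<open>The formula for retractions sends \<open>e 2\<close> to \<open>e 0\<close>; but
  \<open>e 2\<close> preserves a connection between the lower points 1 and 2 of an element of rank
  0, and \<open>e 0\<close> destroys it.\<close>

lemma not_retractable:
  assumes "2 \<le> q" "q \<le> n" shows "\<not> is_retraction P (I q) f"
proof
  assume f: "is_retraction P (I q) f"
  define z where "z = gen n {(Lo 1, Lo 2)}"
  have z: "sat z A B \<longleftrightarrow> (1 \<in> B \<longleftrightarrow> 2 \<in> B)" for A B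
    unfolding z_def by (subst sat_gen) (use assms in auto)
  have zQ: "z \<in> Q" by (simp add: z_def)
  have "z \<odot> e 0 \<odot> z = z" by (rule Q_eqI) (use zQ in \<open>auto simp: sat_mult z\<close>)
  then have z0: "z \<in> I 0" using hat_I0[OF zQ] by simp
  have e2: "e 2 \<in> I q" "e 2 \<in> Q" and zq: "z \<in> I q" using assms zQ z0 by (auto simp: I_iff)
  have ze: "z \<odot> e 2 \<in> I 0" using I_ideal_mult(2)[OF z0 e2(2)] .
  have fix0: "f y = y" if "y \<in> I 0" for y using f that unfolding is_retraction_def min_ideal_eq by blast
  have "f (z \<odot> e 2) = f z \<odot> f (e 2)" using f e2 zq unfolding is_retraction_def by (auto dest: hom_mult)
  moreover have "f (e 2) = e 0" using retraction_unique[OF f e2(1)] assms by (simp add: e_mult_e)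
  ultimately have "z \<odot> e 2 = z \<odot> e 0" using fix0[OF ze] fix0[OF z0] by simp
  moreover have "sat (z \<odot> e 0) {} {1}" using zQ z by (auto simp: sat_mult)
  moreover have "\<not> sat (z \<odot> e 2) {} {1}" using zQ z assms by (auto simp: sat_mult sat_e)
  ultimately show False by simp
qed

lemma retractable_iff:
  assumes "1 \<le> n" "q \<le> n" shows "retractable_ideal P (I q) \<longleftrightarrow> q \<le> 1"
proof -
  have "sg_ideal P (I q)" using assms sg_ideal_iff by blast
  then show ?thesis unfolding retractable_ideal_def
    using not_retractable[of q] retraction_hat[OF assms(1), of q] assms by fastforce
qed

text \<open>\<open>e 0 \<odot> \<alpha>\<close> records the lower kernel of \<open>\<alpha>\<close>,
  and \<open>\<alpha> \<odot> e 0\<close> the upper kernel. \<open>RR\<close> imposes nothing, which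
  lets the Rees congruences follow the same pattern.\<close>

fun agree :: "diamond \<Rightarrow> pt set set \<Rightarrow> pt set set \<Rightarrow> bool" where
  "agree Mu \<alpha> \<beta> \<longleftrightarrow> \<alpha> \<odot> e 0 = \<beta> \<odot> e 0 \<and> e 0 \<odot> \<alpha> = e 0 \<odot> \<beta>"
| "agree Lambda \<alpha> \<beta> \<longleftrightarrow> e 0 \<odot> \<alpha> = e 0 \<odot> \<beta>"
| "agree Rho \<alpha> \<beta> \<longleftrightarrow> \<alpha> \<odot> e 0 = \<beta> \<odot> e 0"
| "agree RR \<alpha> \<beta> \<longleftrightarrow> True"

section \<open>Green's relations on the minimal ideal\<close>

lemma green_L_I0:
  assumes "x \<in> I 0" "y \<in> I 0" shows "(x, y) \<in> green_L P \<longleftrightarrow> e 0 \<odot> x = e 0 \<odot> y"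
proof -
  have Q: "x \<in> Q" "y \<in> Q" using assms by (auto simp: I_iff)
  note hx = rank0_hat[OF assms(1)] and hy = rank0_hat[OF assms(2)]
  have s: "e 0 \<odot> s \<odot> y = e 0 \<odot> y" if "s \<in> Q" for s
  proof -
    have "e 0 \<odot> s \<odot> (y \<odot> e 0 \<odot> y) = e 0 \<odot> y" using that Q by (simp add: mult_assoc e0_collapse)
    then show ?thesis by (simp only: hy)
  qed
  have sub: "{s \<odot> x | s. s \<in> Q} \<subseteq> {s \<odot> y | s. s \<in> Q}" if eq: "e 0 \<odot> x = e 0 \<odot> y"
    and Q: "x \<in> Q" "y \<in> Q" and hx: "x \<odot> e 0 \<odot> x = x" for x y
  proof -
    have *: "s \<odot> x = (s \<odot> x \<odot> e 0) \<odot> y" if "s \<in> Q" for s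
    proof -
      have "s \<odot> (x \<odot> e 0 \<odot> x) = s \<odot> x \<odot> (e 0 \<odot> x)" using that Q by (simp add: mult_assoc)
      also have "\<dots> = (s \<odot> x \<odot> e 0) \<odot> y" unfolding eq using that Q by (simp add: mult_assoc)
      finally show ?thesis by (simp only: hx)
    qed
    show ?thesis
    proof
      fix z assume "z \<in> {s \<odot> x | s. s \<in> Q}"
      then obtain s where "s \<in> Q" "z = s \<odot> x" by auto
      then show "z \<in> {s \<odot> y | s. s \<in> Q}" using *[OF \<open>s \<in> Q\<close>] mult_closed by auto
    qed
  qed
  show ?thesis
  proof
    assume "(x, y) \<in> green_L P"
    then have "{s \<odot> x | s. s \<in> Q} = {s \<odot> y | s. s \<in> Q}" by (simp add: green_L_def)
    moreover have "x \<in> {s \<odot> x | s. s \<in> Q}" using e_n(1)[OF Q(1)] e_Q[OF le_refl] by force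
    ultimately have "x \<in> {s \<odot> y | s. s \<in> Q}" by (simp only:)
    then obtain s where "s \<in> Q" "x = s \<odot> y" by (elim CollectE exE conjE)
    then show "e 0 \<odot> x = e 0 \<odot> y" using s[OF \<open>s \<in> Q\<close>] mult_assoc[OF _ \<open>s \<in> Q\<close> Q(2), of "e 0"]
      by (simp only: e_Q zero_le)
  next
    assume eq: "e 0 \<odot> x = e 0 \<odot> y"
    then show "(x, y) \<in> green_L P" unfolding green_L_def mult_part_monoid
      using sub[OF eq Q hx] sub[OF eq[symmetric] Q(2,1) hy] Q by blast
  qed
qed

lemma green_R_I0:
  assumes "x \<in> I 0" "y \<in> I 0" shows "(x, y) \<in> green_R P \<longleftrightarrow> x \<odot> e 0 = y \<odot> e 0"
proof -
  have Q: "x \<in> Q" "y \<in> Q" using assms by (auto simp: I_iff)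
  note hx = rank0_hat[OF assms(1)] and hy = rank0_hat[OF assms(2)]
  have s: "y \<odot> s \<odot> e 0 = y \<odot> e 0" if "s \<in> Q" for s
  proof -
    have "(y \<odot> e 0 \<odot> y) \<odot> s \<odot> e 0 = y \<odot> e 0" using that Q by (simp add: mult_assoc e0_collapse)
    then show ?thesis by (simp only: hy)
  qed
  have sub: "{x \<odot> s | s. s \<in> Q} \<subseteq> {y \<odot> s | s. s \<in> Q}" if eq: "x \<odot> e 0 = y \<odot> e 0"
    and Q: "x \<in> Q" "y \<in> Q" and hx: "x \<odot> e 0 \<odot> x = x" for x y
  proof -
    have *: "x \<odot> s = y \<odot> (e 0 \<odot> (x \<odot> s))" if "s \<in> Q" for s
    proof -
      have "(x \<odot> e 0 \<odot> x) \<odot> s = x \<odot> e 0 \<odot> (x \<odot> s)" using that Q by (simp add: mult_assoc)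
      also have "\<dots> = y \<odot> (e 0 \<odot> (x \<odot> s))" unfolding eq using that Q by (simp add: mult_assoc)
      finally show ?thesis by (simp only: hx)
    qed
    show ?thesis
    proof
      fix z assume "z \<in> {x \<odot> s | s. s \<in> Q}"
      then obtain s where "s \<in> Q" "z = x \<odot> s" by auto
      then show "z \<in> {y \<odot> s | s. s \<in> Q}" using *[OF \<open>s \<in> Q\<close>] mult_closed by auto
    qed
  qed
  show ?thesis
  proof
    assume "(x, y) \<in> green_R P"
    then have "{x \<odot> s | s. s \<in> Q} = {y \<odot> s | s. s \<in> Q}" by (simp add: green_R_def)
    moreover have "x \<in> {x \<odot> s | s. s \<in> Q}" using e_n(2)[OF Q(1)] e_Q[OF le_refl] by force
    ultimately have "x \<in> {y \<odot> s | s. s \<in> Q}" by (simp only:)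
    then obtain s where "s \<in> Q" "x = y \<odot> s" by (elim CollectE exE conjE)
    then show "x \<odot> e 0 = y \<odot> e 0" using s[OF \<open>s \<in> Q\<close>] by (simp only:)
  next
    assume eq: "x \<odot> e 0 = y \<odot> e 0"
    then show "(x, y) \<in> green_R P" unfolding green_R_def mult_part_monoid
      using sub[OF eq Q hx] sub[OF eq[symmetric] Q(2,1) hy] Q by blast
  qed
qed

text \<open>The retraction changes neither of the two products with \<open>e 0\<close>, so Green's
  relations between the images can be tested on \<open>x\<close> and \<open>y\<close>
  themselves.\<close>

lemma retr_green:
  assumes "1 \<le> n" "q \<le> 1" "x \<in> I q" "y \<in> I q"
  shows "(retraction_of P (I q) x, retraction_of P (I q) y) \<in> green_L P \<longleftrightarrow> agree Lambda x y"
    "(retraction_of P (I q) x, retraction_of P (I q) y) \<in> green_R P \<longleftrightarrow> agree Rho x y"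
    "(retraction_of P (I q) x, retraction_of P (I q) y) \<in> green_H P \<longleftrightarrow> agree Mu x y"
proof -
  have Q: "x \<in> Q" "y \<in> Q" using assms by (auto simp: I_iff)
  have h: "e 0 \<odot> (z \<odot> e 0 \<odot> z) = e 0 \<odot> z" "z \<odot> e 0 \<odot> z \<odot> e 0 = z \<odot> e 0" if "z \<in> Q" for z
  proof -
    have "e 0 \<odot> (z \<odot> e 0 \<odot> z) = (e 0 \<odot> z \<odot> e 0) \<odot> z" using that by (simp only: mult_assoc mult_closed e_Q zero_le)
    then show "e 0 \<odot> (z \<odot> e 0 \<odot> z) = e 0 \<odot> z" using that by simp
    have "z \<odot> e 0 \<odot> z \<odot> e 0 = z \<odot> (e 0 \<odot> z \<odot> e 0)" using that by (simp only: mult_assoc mult_closed e_Q zero_le)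
    then show "z \<odot> e 0 \<odot> z \<odot> e 0 = z \<odot> e 0" using that by simp
  qed
  show L: "(retraction_of P (I q) x, retraction_of P (I q) y) \<in> green_L P \<longleftrightarrow> agree Lambda x y"
    using assms by (simp add: retraction_of_eq green_L_I0 hat_I0 Q h(1))
  show R: "(retraction_of P (I q) x, retraction_of P (I q) y) \<in> green_R P \<longleftrightarrow> agree Rho x y"
    using assms by (simp add: retraction_of_eq green_R_I0 hat_I0 Q h(2))
  show "(retraction_of P (I q) x, retraction_of P (I q) y) \<in> green_H P \<longleftrightarrow> agree Mu x y"
    using L R by (auto simp: green_H_def)
qed

section \<open>The congruences\<close>

text \<open>The elements \<open>u\<close> and \<open>v\<close> are one-sided inverses of \<open>s\<close> and \<open>t\<close> relative to \<open>e q\<close>; they recover \<open>\<sigma>\<close> from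
  \<open>s \<odot> bar n q \<sigma> \<odot> t\<close>.\<close>

definition frame :: "nat \<Rightarrow> pt set set \<Rightarrow> pt set set \<Rightarrow> pt set set \<Rightarrow> pt set set \<Rightarrow> bool" where
  "frame q s t u v \<longleftrightarrow> q \<le> n \<and> s \<in> Q \<and> t \<in> Q \<and> u \<in> Q \<and> v \<in> Q \<and>
     s \<odot> e q = s \<and> e q \<odot> t = t \<and> e q \<odot> u = u \<and> v \<odot> e q = v \<and> u \<odot> s = e q \<and> t \<odot> v = e q"

text \<open>Since the whole product has rank \<open>q\<close>, neither \<open>s \<odot> e q\<close>
  nor \<open>e q \<odot> t\<close> has lost rank, and both can be cancelled.\<close>

lemma frame_exists:
  assumes "q \<le> n" "s \<in> Q" "t \<in> Q" "\<sigma> permutes {1..q}" "part_rank (s \<odot> bar n q \<sigma> \<odot> t) = q"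
  obtains u v where "frame q (s \<odot> e q) (e q \<odot> t) u v"
proof -
  have eq: "s \<odot> bar n q \<sigma> \<odot> t = s \<odot> e q \<odot> (bar n q \<sigma> \<odot> t)" "s \<odot> bar n q \<sigma> \<odot> t = s \<odot> bar n q \<sigma> \<odot> (e q \<odot> t)"
  proof -
    note Q = assms(2,3) e_Q[OF assms(1)] bar_Q[OF assms(1,4)] mult_closed
    have "s \<odot> bar n q \<sigma> \<odot> t = s \<odot> (e q \<odot> bar n q \<sigma>) \<odot> t" "s \<odot> bar n q \<sigma> \<odot> t = s \<odot> (bar n q \<sigma> \<odot> e q) \<odot> t"
      by (simp_all only: e_bar[OF assms(1,4)])
    then show "s \<odot> bar n q \<sigma> \<odot> t = s \<odot> e q \<odot> (bar n q \<sigma> \<odot> t)" "s \<odot> bar n q \<sigma> \<odot> t = s \<odot> bar n q \<sigma> \<odot> (e q \<odot> t)"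
      using Q by (simp_all only: mult_assoc)
  qed
  have "part_rank (s \<odot> e q) = q"
    using rank_mult(1)[of "s \<odot> e q" "bar n q \<sigma> \<odot> t"] rank_mult(2)[of s "e q"] assms eq(1) by simp
  then obtain u where u: "u \<in> Q" "u \<odot> (s \<odot> e q) = e q" using left_cancel_e assms by blast
  have "part_rank (e q \<odot> t) = q"
    using rank_mult(2)[of "s \<odot> bar n q \<sigma>" "e q \<odot> t"] rank_mult(1)[of "e q" t] assms eq(2) by simp
  then obtain v where v: "v \<in> Q" "e q \<odot> t \<odot> v = e q" using right_cancel_e assms by blast
  have 1: "e q \<odot> (e q \<odot> x) = e q \<odot> x" if "x \<in> Q" for x
  proof -
    have "e q \<odot> (e q \<odot> x) = e q \<odot> e q \<odot> x" using that assms(1) by (simp only: mult_assoc e_Q)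
    then show ?thesis using assms(1) by simp
  qed
  have "(e q \<odot> u) \<odot> (s \<odot> e q) = e q" using u assms(1-3) by (simp add: mult_assoc)
  moreover have "(e q \<odot> t) \<odot> (v \<odot> e q) = e q \<odot> t \<odot> v \<odot> e q" using v(1) assms(1-3) by (simp add: mult_assoc)
  then have "(e q \<odot> t) \<odot> (v \<odot> e q) = e q" using v(2) assms(1) by simp
  ultimately have "frame q (s \<odot> e q) (e q \<odot> t) (e q \<odot> u) (v \<odot> e q)"
    unfolding frame_def using assms(1-3) u(1) v(1) 1 by (simp add: mult_assoc)
  then show ?thesis by (rule that)
qed

lemma frame_mid:
  assumes "frame q s t u v" "\<sigma> permutes {1..q}"
  shows "u \<odot> (s \<odot> bar n q \<sigma> \<odot> t) \<odot> v = bar n q \<sigma>"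
proof -
  have f: "q \<le> n" "s \<in> Q" "t \<in> Q" "u \<in> Q" "v \<in> Q" "u \<odot> s = e q" "t \<odot> v = e q"
    using assms by (auto simp: frame_def)
  have "u \<odot> (s \<odot> bar n q \<sigma> \<odot> t) \<odot> v = (u \<odot> s) \<odot> bar n q \<sigma> \<odot> (t \<odot> v)"
    using mid_assoc f assms by simp
  then show ?thesis using f assms by simp
qed

lemma frame_rank:
  assumes "frame q s t u v" "\<sigma> permutes {1..q}"
  shows "part_rank (s \<odot> bar n q \<sigma> \<odot> t) = q"
proof -
  have f: "q \<le> n" "s \<in> Q" "t \<in> Q" "u \<in> Q" "v \<in> Q" using assms by (auto simp: frame_def)
  show ?thesis using rank_mult3[of u "s \<odot> bar n q \<sigma> \<odot> t" v] rank_mult3[of s "bar n q \<sigma>" t]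
    frame_mid[OF assms] f assms by simp
qed

text \<open>Two factorizations of one element through the group at \<open>e q\<close> differ by
  permutations \<open>\<gamma>\<close> and \<open>\<eta>\<close> that do not depend on the
  permutation in the middle. This is what makes \<open>nu\<close> transitive.\<close>

lemma frame_shift:
  assumes "frame q s t u v" "s' \<in> Q" "t' \<in> Q" "\<sigma> permutes {1..q}" "\<tau> permutes {1..q}"
    and eq: "s \<odot> bar n q \<sigma> \<odot> t = s' \<odot> bar n q \<tau> \<odot> t'"
  obtains \<gamma> \<eta> where "\<gamma> permutes {1..q}" "\<eta> permutes {1..q}" "\<sigma> = \<eta> \<circ> \<tau> \<circ> \<gamma>"
    "\<And>\<pi>. \<pi> permutes {1..q} \<Longrightarrow> s' \<odot> bar n q \<pi> \<odot> t' = s \<odot> bar n q (\<eta> \<circ> \<pi> \<circ> \<gamma>) \<odot> t"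
proof -
  have f: "q \<le> n" "s \<in> Q" "t \<in> Q" "u \<in> Q" "v \<in> Q" "s \<odot> e q = s" "e q \<odot> t = t" "e q \<odot> u = u"
    "v \<odot> e q = v" "u \<odot> s = e q" "t \<odot> v = e q" using assms by (auto simp: frame_def)
  note q = f(1)
  let ?b = "bar n q"
  note Q = f(2-5) assms(2,3) bar_Q[OF q assms(4)] bar_Q[OF q assms(5)] e_Q[OF q] mult_closed
  \<comment> \<open>\<open>u\<close> and \<open>v\<close> cancel the first frame; what remains is
    the contribution of the second frame on either side.\<close>
  let ?g = "u \<odot> s' \<odot> e q" and ?h = "e q \<odot> t' \<odot> v"
  have bt: "e q \<odot> ?b \<tau> = ?b \<tau>" "?b \<tau> \<odot> e q = ?b \<tau>" "?b \<sigma> \<odot> e q = ?b \<sigma>" "e q \<odot> ?b \<sigma> = ?b \<sigma>"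
    using e_bar q assms by auto
  have y: "?b \<sigma> = ?g \<odot> ?b \<tau> \<odot> ?h"
  proof -
    have "?b \<sigma> = u \<odot> (s' \<odot> ?b \<tau> \<odot> t') \<odot> v" using frame_mid[OF assms(1,4)] eq by simp
    also have "\<dots> = u \<odot> s' \<odot> (e q \<odot> ?b \<tau> \<odot> e q) \<odot> t' \<odot> v" using Q by (simp add: mult_assoc bt)
    also have "\<dots> = ?g \<odot> ?b \<tau> \<odot> ?h" using Q by (simp only: mult_assoc)
    finally show ?thesis .
  qed
  have "part_rank (?b \<sigma>) = q" using q assms by simp
  then have ge: "q \<le> part_rank ?g" "q \<le> part_rank ?h"
    using y rank_mult(1)[of "?g \<odot> ?b \<tau>" ?h] rank_mult(1)[of ?g "?b \<tau>"] rank_mult(2)[of "?g \<odot> ?b \<tau>" ?h] Q by auto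
  have le: "part_rank ?g \<le> q" "part_rank ?h \<le> q"
    using rank_mult(2)[of "u \<odot> s'" "e q"] rank_mult(1)[of "e q" "t' \<odot> v"] Q q by (auto simp: mult_assoc)
  have ee: "e q \<odot> (e q \<odot> x) = e q \<odot> x" "x \<odot> e q \<odot> e q = x \<odot> e q" if "x \<in> Q" for x
    using mult_assoc[of "e q" "e q" x] mult_assoc[of x "e q" "e q"] that q by auto
  have eu: "e q \<odot> (u \<odot> x) = u \<odot> x" "x \<odot> v \<odot> e q = x \<odot> v" if "x \<in> Q" for x
    using mult_assoc[of "e q" u x] mult_assoc[of x v "e q"] that Q f by auto
  have "e q \<odot> ?g \<odot> e q = ?g" "e q \<odot> ?h \<odot> e q = ?h"
    using Q eu[of "s' \<odot> e q"] ee(2)[of "u \<odot> s'"] ee(1)[of "t' \<odot> v"] eu(2)[of "e q \<odot> t'"]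
    by (simp_all add: mult_assoc)
  then obtain \<gamma> \<eta> where g: "\<gamma> permutes {1..q}" "?g = ?b \<gamma>" and h: "\<eta> permutes {1..q}" "?h = ?b \<eta>"
    using local_rank_q[OF q mult_closed] ge le by (metis antisym)
  note QQ = Q bar_Q[OF q g(1)] bar_Q[OF q h(1)]
  have "?b \<sigma> = ?b (\<eta> \<circ> \<tau> \<circ> \<gamma>)"
    using y unfolding g(2) h(2) by (simp add: bar_mult q g h assms permutes_compose comp_assoc)
  then have sg: "\<sigma> = \<eta> \<circ> \<tau> \<circ> \<gamma>"
    using bar_inj assms g h permutes_compose by metis
  have s1: "s' \<odot> e q = s \<odot> ?b \<gamma>"
  proof -
    let ?i = "?b (inv' (\<eta> \<circ> \<tau>))"
    have p: "(\<eta> \<circ> \<tau>) permutes {1..q}" using h(1) assms(5) by (simp add: permutes_compose)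
    have iQ: "?i \<in> Q" using q permutes_inv[OF p] by simp
    have "s \<odot> ?b \<sigma> = s \<odot> ?b \<sigma> \<odot> t \<odot> v" using QQ bt f by (simp add: mult_assoc)
    also have "\<dots> = s' \<odot> ?b \<tau> \<odot> t' \<odot> v" by (simp only: eq)
    also have "\<dots> = s' \<odot> (e q \<odot> ?b \<tau>) \<odot> e q \<odot> t' \<odot> v" using QQ by (simp add: mult_assoc bt)
    also have "\<dots> = s' \<odot> e q \<odot> (?b \<tau> \<odot> ?h)" using QQ by (simp add: mult_assoc)
    also have "\<dots> = s' \<odot> e q \<odot> ?b (\<eta> \<circ> \<tau>)" unfolding h(2) using q h(1) assms(5) by (simp add: bar_mult)
    finally have "s \<odot> ?b \<sigma> \<odot> ?i = s' \<odot> e q \<odot> ?b (\<eta> \<circ> \<tau>) \<odot> ?i" by simp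
    then have "s \<odot> (?b \<sigma> \<odot> ?i) = s' \<odot> e q \<odot> (?b (\<eta> \<circ> \<tau>) \<odot> ?i)" using QQ iQ bar_Q[OF q p] by (simp add: mult_assoc)
    moreover have "?b \<sigma> \<odot> ?i = ?b \<gamma>"
    proof -
      have "?b \<sigma> = ?b \<gamma> \<odot> ?b (\<eta> \<circ> \<tau>)" using bar_mult[OF q g(1) p] by (simp add: sg)
      then show ?thesis using bar_inverse[OF q p] QQ iQ bar_Q[OF q p] e_bar(2)[OF q g(1)] by (simp add: mult_assoc)
    qed
    ultimately show ?thesis using bar_inverse[OF q p] QQ ee by simp
  qed
  have t1: "e q \<odot> t' = ?b \<eta> \<odot> t"
  proof -
    let ?i = "?b (inv' (\<tau> \<circ> \<gamma>))"
    have p: "(\<tau> \<circ> \<gamma>) permutes {1..q}" using g(1) assms(5) by (simp add: permutes_compose)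
    have iQ: "?i \<in> Q" using q permutes_inv[OF p] by simp
    have "?b \<sigma> \<odot> t = u \<odot> (s \<odot> ?b \<sigma> \<odot> t)"
    proof -
      have "u \<odot> (s \<odot> ?b \<sigma> \<odot> t) = (u \<odot> s) \<odot> ?b \<sigma> \<odot> t" using QQ by (simp only: mult_assoc)
      then show ?thesis using bt f by simp
    qed
    also have "\<dots> = u \<odot> (s' \<odot> ?b \<tau> \<odot> t')" by (simp only: eq)
    also have "\<dots> = u \<odot> (s' \<odot> (e q \<odot> ?b \<tau>) \<odot> e q \<odot> t')" using QQ by (simp add: mult_assoc bt)
    also have "\<dots> = ?g \<odot> ?b \<tau> \<odot> (e q \<odot> t')" using QQ by (simp add: mult_assoc)
    also have "\<dots> = ?b (\<tau> \<circ> \<gamma>) \<odot> (e q \<odot> t')" unfolding g(2) using q g(1) assms(5) by (simp add: bar_mult)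
    finally have "?i \<odot> (?b \<sigma> \<odot> t) = ?i \<odot> (?b (\<tau> \<circ> \<gamma>) \<odot> (e q \<odot> t'))" by simp
    then have "?i \<odot> ?b \<sigma> \<odot> t = ?i \<odot> ?b (\<tau> \<circ> \<gamma>) \<odot> (e q \<odot> t')" using QQ iQ bar_Q[OF q p] by (simp add: mult_assoc)
    moreover have "?i \<odot> ?b \<sigma> = ?b \<eta>"
    proof -
      have "?b \<sigma> = ?b (\<tau> \<circ> \<gamma>) \<odot> ?b \<eta>" using bar_mult[OF q p h(1)] by (simp add: sg comp_assoc)
      then have "?i \<odot> ?b \<sigma> = ?i \<odot> ?b (\<tau> \<circ> \<gamma>) \<odot> ?b \<eta>" using QQ iQ bar_Q[OF q p] by (simp add: mult_assoc)
      then show ?thesis using bar_inverse[OF q p] e_bar(1)[OF q h(1)] by simp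
    qed
    ultimately show ?thesis using bar_inverse[OF q p] QQ ee by simp
  qed
  have "s' \<odot> ?b \<pi> \<odot> t' = s \<odot> ?b (\<eta> \<circ> \<pi> \<circ> \<gamma>) \<odot> t" if \<pi>: "\<pi> permutes {1..q}" for \<pi>
  proof -
    note bp = bar_Q[OF q \<pi>]
    have "s' \<odot> ?b \<pi> \<odot> t' = s' \<odot> (e q \<odot> ?b \<pi> \<odot> e q) \<odot> t'" using e_bar[OF q \<pi>] by simp
    also have "\<dots> = (s' \<odot> e q) \<odot> ?b \<pi> \<odot> (e q \<odot> t')" using QQ bp by (simp only: mult_assoc)
    also have "\<dots> = s \<odot> (?b \<gamma> \<odot> ?b \<pi> \<odot> ?b \<eta>) \<odot> t" unfolding s1 t1 using QQ bp by (simp only: mult_assoc)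
    also have "?b \<gamma> \<odot> ?b \<pi> \<odot> ?b \<eta> = ?b (\<eta> \<circ> \<pi> \<circ> \<gamma>)"
      by (simp add: bar_mult q g h \<pi> permutes_compose comp_assoc)
    finally show ?thesis .
  qed
  with g h sg show ?thesis using that by blast
qed

section \<open>The relation \<open>nu\<close> of a normal subgroup\<close>

lemma nu_iff:
  assumes "q \<le> n" "N \<subseteq> {\<sigma>. \<sigma> permutes {1..q}}" "N \<noteq> {}"
  shows "(\<alpha>, \<beta>) \<in> nu P (bar n q ` N) \<longleftrightarrow> part_rank \<alpha> = q \<and> part_rank \<beta> = q \<and>
    (\<exists>s\<in>Q. \<exists>t\<in>Q. \<exists>\<sigma>\<in>N. \<exists>\<tau>\<in>N. \<alpha> = s \<odot> bar n q \<sigma> \<odot> t \<and> \<beta> = s \<odot> bar n q \<tau> \<odot> t)"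
proof -
  have "green_J P `` (bar n q ` N) = J_class q"
  proof -
    obtain \<pi> where "\<pi> \<in> N" using assms(3) by blast
    have r: "part_rank (bar n q \<sigma>) = q" "bar n q \<sigma> \<in> Q" if "\<sigma> \<in> N" for \<sigma> using assms(1,2) that by auto
    have "x \<in> green_J P `` (bar n q ` N)" if "x \<in> J_class q" for x
      using that r[OF \<open>\<pi> \<in> N\<close>] \<open>\<pi> \<in> N\<close> by (intro ImageI[of "bar n q \<pi>"]) (auto simp: J_class_def green_J_iff)
    moreover have "x \<in> J_class q" if "x \<in> green_J P `` (bar n q ` N)" for x
      using that r by (auto simp: J_class_def green_J_iff)
    ultimately show ?thesis by blast
  qed
  then have nu: "nu P (bar n q ` N) = {(s \<odot> x \<odot> t, s \<odot> y \<odot> t) | s t x y. x \<in> bar n q ` N \<and>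
      y \<in> bar n q ` N \<and> s \<in> Q \<and> t \<in> Q} \<inter> (J_class q \<times> J_class q)" unfolding nu_def mult_part_monoid by simp
  show ?thesis
  proof
    assume "(\<alpha>, \<beta>) \<in> nu P (bar n q ` N)"
    then obtain s t x y where h: "\<alpha> = s \<odot> x \<odot> t" "\<beta> = s \<odot> y \<odot> t" "x \<in> bar n q ` N" "y \<in> bar n q ` N"
      "s \<in> Q" "t \<in> Q" "\<alpha> \<in> J_class q" "\<beta> \<in> J_class q" unfolding nu by blast
    obtain \<sigma> \<tau> where "\<sigma> \<in> N" "\<tau> \<in> N" "x = bar n q \<sigma>" "y = bar n q \<tau>" using h(3,4) by blast
    then show "part_rank \<alpha> = q \<and> part_rank \<beta> = q \<and>
      (\<exists>s\<in>Q. \<exists>t\<in>Q. \<exists>\<sigma>\<in>N. \<exists>\<tau>\<in>N. \<alpha> = s \<odot> bar n q \<sigma> \<odot> t \<and> \<beta> = s \<odot> bar n q \<tau> \<odot> t)"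
      using h by (intro conjI bexI[of _ s] bexI[of _ t] bexI[of _ \<sigma>] bexI[of _ \<tau>]) (auto simp only: J_class_def mem_Collect_eq)
  next
    assume r: "part_rank \<alpha> = q \<and> part_rank \<beta> = q \<and>
      (\<exists>s\<in>Q. \<exists>t\<in>Q. \<exists>\<sigma>\<in>N. \<exists>\<tau>\<in>N. \<alpha> = s \<odot> bar n q \<sigma> \<odot> t \<and> \<beta> = s \<odot> bar n q \<tau> \<odot> t)"
    then obtain s t \<sigma> \<tau> where h: "s \<in> Q" "t \<in> Q" "\<sigma> \<in> N" "\<tau> \<in> N"
      "\<alpha> = s \<odot> bar n q \<sigma> \<odot> t" "\<beta> = s \<odot> bar n q \<tau> \<odot> t" by blast
    have "\<alpha> \<in> Q" "\<beta> \<in> Q" unfolding h(5,6) by (rule mult_closed)+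
    then have "\<alpha> \<in> J_class q" "\<beta> \<in> J_class q" unfolding J_class_def using r by simp_all
    then show "(\<alpha>, \<beta>) \<in> nu P (bar n q ` N)" unfolding nu using h by blast
  qed
qed

lemma nu_frame:
  assumes "q \<le> n" "N \<subseteq> {\<sigma>. \<sigma> permutes {1..q}}" "N \<noteq> {}" "(\<alpha>, \<beta>) \<in> nu P (bar n q ` N)"
  obtains s t u v \<sigma> \<tau> where "frame q s t u v" "\<sigma> \<in> N" "\<tau> \<in> N" "\<alpha> = s \<odot> bar n q \<sigma> \<odot> t"
    "\<beta> = s \<odot> bar n q \<tau> \<odot> t"
proof -
  obtain s t \<sigma> \<tau> where h: "s \<in> Q" "t \<in> Q" "\<sigma> \<in> N" "\<tau> \<in> N" "\<alpha> = s \<odot> bar n q \<sigma> \<odot> t"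
    "\<beta> = s \<odot> bar n q \<tau> \<odot> t" "part_rank \<alpha> = q"
    using assms(4) unfolding nu_iff[OF assms(1-3)] by blast
  have p: "\<sigma> permutes {1..q}" "\<tau> permutes {1..q}" using h assms by auto
  obtain u v where fr: "frame q (s \<odot> e q) (e q \<odot> t) u v"
    using frame_exists[OF assms(1) h(1,2) p(1)] h(5,7) by metis
  have "s \<odot> bar n q \<pi> \<odot> t = (s \<odot> e q) \<odot> bar n q \<pi> \<odot> (e q \<odot> t)" if "\<pi> permutes {1..q}" for \<pi>
  proof -
    have "s \<odot> bar n q \<pi> \<odot> t = s \<odot> (e q \<odot> bar n q \<pi> \<odot> e q) \<odot> t" using e_bar[OF assms(1) that] by simp
    then show ?thesis using h(1,2) bar_Q[OF assms(1) that] e_Q[OF assms(1)] by (simp only: mult_assoc mult_closed)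
  qed
  then show ?thesis using that[OF fr h(3,4)] h(5,6) p by auto
qed

lemma normal_sym_nonempty:
  assumes "normal N (sym_group q)" shows "N \<subseteq> {\<sigma>. \<sigma> permutes {1..q}}" "N \<noteq> {}" "id \<in> N"
  using assms by (auto simp: normal_sym_iff)

lemma nu_sym: "(\<alpha>, \<beta>) \<in> nu P N \<Longrightarrow> (\<beta>, \<alpha>) \<in> nu P N"
  unfolding nu_def by blast

lemma nu_ranks:
  assumes "q \<le> n" "normal N (sym_group q)" "(\<alpha>, \<beta>) \<in> nu P (bar n q ` N)"
  shows "\<alpha> \<in> Q" "\<beta> \<in> Q" "part_rank \<alpha> = q" "part_rank \<beta> = q"
proof -
  obtain s t \<sigma> \<tau> where "\<alpha> = s \<odot> bar n q \<sigma> \<odot> t" "\<beta> = s \<odot> bar n q \<tau> \<odot> t"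
    and r: "part_rank \<alpha> = q" "part_rank \<beta> = q"
    using assms(3) unfolding nu_iff[OF assms(1) normal_sym_nonempty(1,2)[OF assms(2)]] by blast
  then show "\<alpha> \<in> Q" "\<beta> \<in> Q" by (simp_all only: mult_closed)
  show "part_rank \<alpha> = q" "part_rank \<beta> = q" by (rule r)+
qed

text \<open>The second pair is rewritten in the frame of the first; the resulting shift of the
  permutations is a conjugation, which normality of \<open>N\<close> absorbs.\<close>

lemma nu_trans:
  assumes "q \<le> n" "normal N (sym_group q)" "(\<alpha>, \<beta>) \<in> nu P (bar n q ` N)" "(\<beta>, \<gamma>) \<in> nu P (bar n q ` N)"
  shows "(\<alpha>, \<gamma>) \<in> nu P (bar n q ` N)"
proof -
  note N = normal_sym_nonempty[OF assms(2)]
  note iff = nu_iff[OF assms(1) N(1,2)]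
  obtain s t u v \<sigma> \<tau> where a: "frame q s t u v" "\<sigma> \<in> N" "\<tau> \<in> N" "\<alpha> = s \<odot> bar n q \<sigma> \<odot> t"
    "\<beta> = s \<odot> bar n q \<tau> \<odot> t" using nu_frame[OF assms(1) N(1,2) assms(3)] by metis
  obtain s' t' \<sigma>' \<tau>' where b: "s' \<in> Q" "t' \<in> Q" "\<sigma>' \<in> N" "\<tau>' \<in> N" "\<beta> = s' \<odot> bar n q \<sigma>' \<odot> t'"
    "\<gamma> = s' \<odot> bar n q \<tau>' \<odot> t'" using assms(4) unfolding iff by blast
  have p: "\<tau> permutes {1..q}" "\<sigma>' permutes {1..q}" "\<tau>' permutes {1..q}" using a b N by auto
  obtain g h where gh: "g permutes {1..q}" "h permutes {1..q}" "\<tau> = h \<circ> \<sigma>' \<circ> g"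
    "\<gamma> = s \<odot> bar n q (h \<circ> \<tau>' \<circ> g) \<odot> t"
    using frame_shift[OF a(1) b(1,2) p(1,2)] a(5) b(5,6) p(3) by metis
  have "h \<circ> \<tau>' \<circ> g = (h \<circ> (\<tau>' \<circ> inv' \<sigma>') \<circ> inv' h) \<circ> \<tau>"
  proof
    fix x
    have "inv' h (h y) = y" for y using permutes_inverses(2)[OF gh(2)] by simp
    moreover have "inv' \<sigma>' (\<sigma>' y) = y" for y using permutes_inverses(2)[OF p(2)] by simp
    ultimately show "(h \<circ> \<tau>' \<circ> g) x = ((h \<circ> (\<tau>' \<circ> inv' \<sigma>') \<circ> inv' h) \<circ> \<tau>) x" by (simp add: gh(3))
  qed
  moreover have "(h \<circ> (\<tau>' \<circ> inv' \<sigma>') \<circ> inv' h) \<circ> \<tau> \<in> N"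
    using assms(2) a(3) b(3,4) gh(2) unfolding normal_sym_iff by blast
  ultimately have "h \<circ> \<tau>' \<circ> g \<in> N" by simp
  moreover have "s \<in> Q" "t \<in> Q" using a(1) by (auto simp: frame_def)
  ultimately show ?thesis unfolding iff using a gh(4) nu_ranks[OF assms(1,2)] assms(3,4) by blast
qed

text \<open>Rank is kept or lost on both sides at once, since it depends on the outer factors and
  not on the permutation between them.\<close>

lemma nu_mult:
  assumes "q \<le> n" "normal N (sym_group q)" "(\<alpha>, \<beta>) \<in> nu P (bar n q ` N)" "w \<in> Q"
  shows "(w \<odot> \<alpha>, w \<odot> \<beta>) \<in> nu P (bar n q ` N) \<or> (part_rank (w \<odot> \<alpha>) < q \<and> part_rank (w \<odot> \<beta>) < q)"
    "(\<alpha> \<odot> w, \<beta> \<odot> w) \<in> nu P (bar n q ` N) \<or> (part_rank (\<alpha> \<odot> w) < q \<and> part_rank (\<beta> \<odot> w) < q)"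
proof -
  note N = normal_sym_nonempty[OF assms(2)]
  note iff = nu_iff[OF assms(1) N(1,2)]
  obtain s t \<sigma> \<tau> where a: "s \<in> Q" "t \<in> Q" "\<sigma> \<in> N" "\<tau> \<in> N" "\<alpha> = s \<odot> bar n q \<sigma> \<odot> t"
    "\<beta> = s \<odot> bar n q \<tau> \<odot> t" using assms(3) unfolding iff by blast
  have p: "\<sigma> permutes {1..q}" "\<tau> permutes {1..q}" using a N by auto
  have same: "part_rank (s \<odot> bar n q \<tau> \<odot> t) = q"
    if r: "part_rank (s \<odot> bar n q \<sigma> \<odot> t) = q" and pp: "\<sigma> permutes {1..q}" "\<tau> permutes {1..q}" "s \<in> Q" "t \<in> Q" for s t \<sigma> \<tau>
  proof -
    obtain u v where fr: "frame q (s \<odot> e q) (e q \<odot> t) u v" using frame_exists[OF assms(1) pp(3,4,1) r] .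
    have "part_rank ((s \<odot> e q) \<odot> bar n q \<tau> \<odot> (e q \<odot> t)) = q" by (rule frame_rank[OF fr pp(2)])
    moreover have "s \<odot> (e q \<odot> bar n q \<tau> \<odot> e q) \<odot> t = (s \<odot> e q) \<odot> bar n q \<tau> \<odot> (e q \<odot> t)"
      using pp bar_Q[OF assms(1) pp(2)] e_Q[OF assms(1)] by (simp only: mult_assoc mult_closed)
    ultimately show ?thesis using e_bar[OF assms(1) pp(2)] by simp
  qed
  note bQ = bar_Q[OF assms(1) p(1)] bar_Q[OF assms(1) p(2)]
  have le: "part_rank (s \<odot> bar n q \<pi> \<odot> t) \<le> q" if "\<pi> permutes {1..q}" "s \<in> Q" "t \<in> Q" for \<pi> s t
    using rank_mult3[OF that(2) bar_Q[OF assms(1) that(1)] that(3)] assms(1) that by simp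
  have w: "w \<odot> \<alpha> = (w \<odot> s) \<odot> bar n q \<sigma> \<odot> t" "w \<odot> \<beta> = (w \<odot> s) \<odot> bar n q \<tau> \<odot> t"
    "\<alpha> \<odot> w = s \<odot> bar n q \<sigma> \<odot> (t \<odot> w)" "\<beta> \<odot> w = s \<odot> bar n q \<tau> \<odot> (t \<odot> w)"
    using a assms(4) bQ by (simp_all add: mult_assoc)
  show "(w \<odot> \<alpha>, w \<odot> \<beta>) \<in> nu P (bar n q ` N) \<or> (part_rank (w \<odot> \<alpha>) < q \<and> part_rank (w \<odot> \<beta>) < q)"
  proof (cases "part_rank (w \<odot> \<alpha>) = q \<or> part_rank (w \<odot> \<beta>) = q")
    case True
    then have "part_rank (w \<odot> \<alpha>) = q \<and> part_rank (w \<odot> \<beta>) = q"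
      unfolding w(1,2) using same[OF _ p mult_closed a(2)] same[OF _ p(2,1) mult_closed a(2)] by blast
    then show ?thesis unfolding iff using w(1,2) a(2-4) mult_closed by blast
  next
    case False
    then show ?thesis using le[OF p(1) mult_closed a(2), of w s] le[OF p(2) mult_closed a(2), of w s] w by simp
  qed
  show "(\<alpha> \<odot> w, \<beta> \<odot> w) \<in> nu P (bar n q ` N) \<or> (part_rank (\<alpha> \<odot> w) < q \<and> part_rank (\<beta> \<odot> w) < q)"
  proof (cases "part_rank (\<alpha> \<odot> w) = q \<or> part_rank (\<beta> \<odot> w) = q")
    case True
    then have "part_rank (\<alpha> \<odot> w) = q \<and> part_rank (\<beta> \<odot> w) = q"
      unfolding w(3,4) using same[OF _ p a(1) mult_closed] same[OF _ p(2,1) a(1) mult_closed] by blast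
    then show ?thesis unfolding iff using w(3,4) a(1,3,4) mult_closed by blast
  next
    case False
    then show ?thesis using le[OF p(1) a(1) mult_closed, of t w] le[OF p(2) a(1) mult_closed, of t w] w by simp
  qed
qed

section \<open>The named relations are congruences\<close>

lemma congruences_iff:
  "r \<in> congruences P \<longleftrightarrow> equiv Q r \<and>
    (\<forall>a b s. (a, b) \<in> r \<longrightarrow> s \<in> Q \<longrightarrow> (s \<odot> a, s \<odot> b) \<in> r \<and> (a \<odot> s, b \<odot> s) \<in> r)"
  unfolding congruences_def by auto

text \<open>A template for \<open>xi\<close> and \<open>R_norm\<close>, with \<open>D\<close> the
  relation imposed on I_k. For trivial \<open>N\<close> the part \<open>nu\<close> is diagonal and
  any \<open>k\<close> below \<open>q\<close> is allowed; otherwise products may fall from rank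
  \<open>q\<close> into I_k, so \<open>k\<close> has to be q - 1 and \<open>D\<close> has to hold
  for these products.\<close>

lemma congruence_nu:
  assumes q: "1 \<le> q" "q \<le> n" and N: "normal N (sym_group q)" and k: "k < q"
    and D: "\<And>a. D a a" "\<And>a b. D a b \<Longrightarrow> D b a" "\<And>a b c. D a b \<Longrightarrow> D b c \<Longrightarrow> D a c"
    and Dm: "\<And>a b s. a \<in> I k \<Longrightarrow> b \<in> I k \<Longrightarrow> s \<in> Q \<Longrightarrow> D a b \<Longrightarrow> D (s \<odot> a) (s \<odot> b) \<and> D (a \<odot> s) (b \<odot> s)"
    and nu: "N = {id} \<or> (k = q - 1 \<and> (\<forall>a b s. (a, b) \<in> nu P (bar n q ` N) \<longrightarrow> s \<in> Q \<longrightarrow> D (s \<odot> a) (s \<odot> b) \<and> D (a \<odot> s) (b \<odot> s)))"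
  shows "Id_on Q \<union> nu P (bar n q ` N) \<union> {(a, b). a \<in> I k \<and> b \<in> I k \<and> D a b} \<in> congruences P" (is "?r \<in> _")
proof -
  note rk = nu_ranks[OF q(2) N]
  have nuid: "a = b" if "N = {id}" "(a, b) \<in> nu P (bar n q ` N)" for a b
    using that nu_iff[OF q(2) normal_sym_nonempty(1,2)[OF N]] by auto
  show ?thesis unfolding congruences_iff
  proof (intro conjI allI impI)
    show "equiv Q ?r"
    proof (rule equivI)
      show "?r \<subseteq> Q \<times> Q" using rk by (auto simp: I_iff)
      show "refl_on Q ?r" by (auto simp: refl_on_def)
      show "sym ?r" unfolding sym_def using nu_sym D(2) by blast
      show "trans ?r"
      proof (rule transI)
        fix a b c assume ab: "(a, b) \<in> ?r" and bc: "(b, c) \<in> ?r"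
        have ex: False if "(b, x) \<in> nu P (bar n q ` N) \<or> (x, b) \<in> nu P (bar n q ` N)" "b \<in> I k" for x
          using that rk k by (auto simp: I_iff)
        show "(a, c) \<in> ?r" using ab bc ex nu_trans[OF q(2) N] D(3) by blast
      qed
    qed
  next
    fix a b s assume ab: "(a, b) \<in> ?r" and s: "s \<in> Q"
    then consider "a = b" "a \<in> Q" | "a \<noteq> b" "(a, b) \<in> nu P (bar n q ` N)" | "a \<in> I k" "b \<in> I k" "D a b"
      using rk(1) by blast
    then have "(s \<odot> a, s \<odot> b) \<in> ?r \<and> (a \<odot> s, b \<odot> s) \<in> ?r"
    proof cases
      case 1 then show ?thesis by auto
    next
      case 2
      then have k': "k = q - 1" and d: "D (s \<odot> a) (s \<odot> b)" "D (a \<odot> s) (b \<odot> s)" using nu nuid s by blast+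
      have "x \<in> I k" if "part_rank x < q" "x \<in> Q" for x using that k' by (auto simp: I_iff)
      then show ?thesis using nu_mult[OF q(2) N 2(2) s] d by auto
    next
      case 3
      then show ?thesis using Dm[OF 3(1,2) s 3(3)] I_ideal_mult s by blast
    qed
    then show "(s \<odot> a, s \<odot> b) \<in> ?r" "(a \<odot> s, b \<odot> s) \<in> ?r" by blast+
  qed
qed

lemma permutes_2: "\<sigma> permutes {1..2::nat} \<longleftrightarrow> \<sigma> = id \<or> \<sigma> = transpose 1 2"
proof -
  have "{1..2::nat} = {1, 2}" by auto
  then show ?thesis by (simp only: permutes_doubleton_iff)
qed

text \<open>On the points 1 and 2 a permutation either leaves a label unchanged or complements it,
  and the complement of a union of blocks is one too. With \<open>e 0\<close> at the other end of
  \<open>x\<close> the two cases cannot be told apart.\<close>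

lemma e0_swap:
  assumes "2 \<le> n" "x \<in> Q" "\<sigma> permutes {1..2}"
  shows "e 0 \<odot> x \<odot> bar n 2 \<sigma> = e 0 \<odot> x \<odot> e 2" "bar n 2 \<sigma> \<odot> x \<odot> e 0 = e 2 \<odot> x \<odot> e 0"
proof -
  have d: "{1..2::nat} = {1, 2}" by auto
  have ex: "\<exists>D. (\<forall>k\<in>{1..2}. k \<in> D \<longleftrightarrow> \<tau> k \<in> B) \<and> R D"
    if "\<forall>k\<in>{1..2}. k \<in> D \<longleftrightarrow> \<tau>' k \<in> B" "R D" "\<And>D. R D \<Longrightarrow> R (- D)" "\<tau> permutes {1..2}" "\<tau>' permutes {1..2}"
    for B D :: "nat set" and R \<tau> \<tau>'
    using that(1,2) that(3)[of D] that(4,5)[unfolded permutes_2] unfolding d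
    by (intro exI[of _ "if (\<tau> 1 \<in> B) = (\<tau>' 1 \<in> B) then D else - D"]) auto
  note sb = sat_bar[OF assms(1,3)] sat_e[OF assms(1)]
  note bQ = bar_Q[OF assms(1,3)]
  have idp: "id permutes {1..2::nat}" by (rule permutes_id)
  have "sat (e 0 \<odot> x \<odot> bar n 2 \<sigma>) A B \<longleftrightarrow> sat (e 0 \<odot> x \<odot> e 2) A B" for A B
  proof -
    define R where "R D \<longleftrightarrow> (\<exists>C. sat x C D)" for D
    have R: "R (- D)" if "R D" for D using that sat_compl[OF _ assms(2)] unfolding R_def by blast
    have l: "sat (e 0 \<odot> x \<odot> bar n 2 \<sigma>) A B \<longleftrightarrow> (\<exists>D. (\<forall>k\<in>{1..2}. k \<in> D \<longleftrightarrow> \<sigma> k \<in> B) \<and> R D)"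
      using assms bQ by (auto simp: sat_mult sb R_def)
    have r: "sat (e 0 \<odot> x \<odot> e 2) A B \<longleftrightarrow> (\<exists>D. (\<forall>k\<in>{1..2}. k \<in> D \<longleftrightarrow> id k \<in> B) \<and> R D)"
      using assms by (auto simp: sat_mult sb R_def)
    show ?thesis unfolding l r using ex[of _ id B R \<sigma>] ex[of _ \<sigma> B R id] R assms(3) idp by blast
  qed
  then show "e 0 \<odot> x \<odot> bar n 2 \<sigma> = e 0 \<odot> x \<odot> e 2" by (intro Q_eqI) auto
  have ex': "\<exists>D. (\<forall>k\<in>{1..2}. k \<in> B \<longleftrightarrow> \<tau> k \<in> D) \<and> R D"
    if "\<forall>k\<in>{1..2}. k \<in> B \<longleftrightarrow> \<tau>' k \<in> D" "R D" "\<And>D. R D \<Longrightarrow> R (- D)" "\<tau> permutes {1..2}" "\<tau>' permutes {1..2}"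
    for B D :: "nat set" and R \<tau> \<tau>'
    using that(1,2) that(3)[of D] that(4,5)[unfolded permutes_2] unfolding d
    by (intro exI[of _ "if (\<tau> 1 \<in> D) = (\<tau>' 1 \<in> D) then D else - D"]) auto
  have "sat (bar n 2 \<sigma> \<odot> x \<odot> e 0) A B \<longleftrightarrow> sat (e 2 \<odot> x \<odot> e 0) A B" for A B
  proof -
    define R where "R D \<longleftrightarrow> (\<exists>C. sat x D C)" for D
    have R: "R (- D)" if "R D" for D using that sat_compl[OF _ assms(2)] unfolding R_def by blast
    have l: "sat (bar n 2 \<sigma> \<odot> x \<odot> e 0) A B \<longleftrightarrow> (\<exists>D. (\<forall>k\<in>{1..2}. k \<in> A \<longleftrightarrow> \<sigma> k \<in> D) \<and> R D)"
      using assms bQ by (auto simp: sat_mult sb R_def)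
    have r: "sat (e 2 \<odot> x \<odot> e 0) A B \<longleftrightarrow> (\<exists>D. (\<forall>k\<in>{1..2}. k \<in> A \<longleftrightarrow> id k \<in> D) \<and> R D)"
      using assms by (auto simp: sat_mult sb R_def)
    show ?thesis unfolding l r using ex'[of A id _ R \<sigma>] ex'[of A \<sigma> _ R id] R assms(3) idp by blast
  qed
  then show "bar n 2 \<sigma> \<odot> x \<odot> e 0 = e 2 \<odot> x \<odot> e 0" by (intro Q_eqI) auto
qed

lemma agree_mono: "agree Mu a b \<Longrightarrow> agree x a b"
  by (cases x) auto

lemma swap_agree:
  assumes "2 \<le> n" "s \<in> Q" "t \<in> Q" "\<sigma> permutes {1..2}" "\<tau> permutes {1..2}"
  shows "agree x (s \<odot> bar n 2 \<sigma> \<odot> t) (s \<odot> bar n 2 \<tau> \<odot> t)"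
proof -
  note Q = assms(2,3) bar_Q[OF assms(1,4)] bar_Q[OF assms(1,5)] e_Q[OF assms(1)] e_Q[of 0] mult_closed
  have "s \<odot> bar n 2 \<pi> \<odot> t \<odot> e 0 = s \<odot> (e 2 \<odot> t \<odot> e 0)" if "\<pi> permutes {1..2}" for \<pi>
  proof -
    have "s \<odot> bar n 2 \<pi> \<odot> t \<odot> e 0 = s \<odot> (bar n 2 \<pi> \<odot> t \<odot> e 0)"
      using Q bar_Q[OF assms(1) that] by (simp add: mult_assoc)
    then show ?thesis by (simp only: e0_swap(2)[OF assms(1,3) that])
  qed
  moreover have "e 0 \<odot> (s \<odot> bar n 2 \<pi> \<odot> t) = e 0 \<odot> s \<odot> e 2 \<odot> t" if "\<pi> permutes {1..2}" for \<pi>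
  proof -
    have "e 0 \<odot> (s \<odot> bar n 2 \<pi> \<odot> t) = (e 0 \<odot> s \<odot> bar n 2 \<pi>) \<odot> t"
      using Q bar_Q[OF assms(1) that] by (simp add: mult_assoc)
    then show ?thesis by (simp only: e0_swap(1)[OF assms(1,2) that])
  qed
  ultimately show ?thesis using assms(4,5) by - (rule agree_mono, simp)
qed

lemma nu_agree:
  assumes "2 \<le> n" "normal N (sym_group 2)" "(\<alpha>, \<beta>) \<in> nu P (bar n 2 ` N)" "w \<in> Q"
  shows "agree x (w \<odot> \<alpha>) (w \<odot> \<beta>)" "agree x (\<alpha> \<odot> w) (\<beta> \<odot> w)" "agree x \<alpha> \<beta>"
proof -
  note N = normal_sym_nonempty[OF assms(2)]
  obtain s t \<sigma> \<tau> where a: "s \<in> Q" "t \<in> Q" "\<sigma> \<in> N" "\<tau> \<in> N" "\<alpha> = s \<odot> bar n 2 \<sigma> \<odot> t"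
    "\<beta> = s \<odot> bar n 2 \<tau> \<odot> t" using assms(3) unfolding nu_iff[OF assms(1) N(1,2)] by blast
  have p: "\<sigma> permutes {1..2}" "\<tau> permutes {1..2}" using a N by auto
  note bQ = bar_Q[OF assms(1) p(1)] bar_Q[OF assms(1) p(2)]
  have w: "w \<odot> \<alpha> = (w \<odot> s) \<odot> bar n 2 \<sigma> \<odot> t" "w \<odot> \<beta> = (w \<odot> s) \<odot> bar n 2 \<tau> \<odot> t"
    "\<alpha> \<odot> w = s \<odot> bar n 2 \<sigma> \<odot> (t \<odot> w)" "\<beta> \<odot> w = s \<odot> bar n 2 \<tau> \<odot> (t \<odot> w)"
    using a assms(4) bQ by (simp_all add: mult_assoc)
  show "agree x (w \<odot> \<alpha>) (w \<odot> \<beta>)" unfolding w by (rule swap_agree[OF assms(1) mult_closed a(2) p])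
  show "agree x (\<alpha> \<odot> w) (\<beta> \<odot> w)" unfolding w by (rule swap_agree[OF assms(1) a(1) mult_closed p])
  show "agree x \<alpha> \<beta>" unfolding a(5,6) by (rule swap_agree[OF assms(1) a(1,2) p])
qed

lemma agree_refl: "agree x a a" and agree_sym: "agree x a b \<Longrightarrow> agree x b a"
  and agree_trans: "agree x a b \<Longrightarrow> agree x b c \<Longrightarrow> agree x a c"
  by (cases x; simp)+

text \<open>A factor between \<open>e 0\<close> and an element of I_1 is absorbed; a factor on the
  far side is handled by associativity.\<close>

lemma agree_mult:
  assumes "1 \<le> n" "a \<in> I 1" "b \<in> I 1" "s \<in> Q" "agree x a b"
  shows "agree x (s \<odot> a) (s \<odot> b)" "agree x (a \<odot> s) (b \<odot> s)"
proof -
  have Q: "a \<in> Q" "b \<in> Q" "e 0 \<in> Q" using assms by (auto simp: I_iff)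
  have 1: "e 0 \<odot> (s \<odot> c) = e 0 \<odot> c" "c \<odot> s \<odot> e 0 = c \<odot> e 0" if "c \<in> I 1" for c
    using absorb_e0[OF assms(1) that assms(4)] that assms(4) mult_assoc[of "e 0" s c] by (auto simp: I_iff)
  have 2: "e 0 \<odot> a = e 0 \<odot> b \<Longrightarrow> e 0 \<odot> (a \<odot> s) = e 0 \<odot> (b \<odot> s)"
    using mult_assoc[OF Q(3,1) assms(4)] mult_assoc[OF Q(3,2) assms(4)] by simp
  have 3: "a \<odot> e 0 = b \<odot> e 0 \<Longrightarrow> s \<odot> a \<odot> e 0 = s \<odot> b \<odot> e 0"
    using mult_assoc[OF assms(4) Q(1,3)] mult_assoc[OF assms(4) Q(2,3)] by simp
  show "agree x (s \<odot> a) (s \<odot> b)"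
    using assms(5) 1(1)[OF assms(2)] 1(1)[OF assms(3)] 3 by (cases x) simp_all
  show "agree x (a \<odot> s) (b \<odot> s)"
    using assms(5) 1(2)[OF assms(2)] 1(2)[OF assms(3)] 2 by (cases x) simp_all
qed

text \<open>The rank bounding the ideal in \<open>C_pair n i\<close>; \<open>C1\<close> and
  \<open>CS2\<close> have the same ideal and differ in the group.\<close>

fun lev :: "chain3 \<Rightarrow> nat" where
  "lev C0 = 0" | "lev C1 = 1" | "lev CS2 = 1"

lemma normal_id: "normal {id} (sym_group q)"
proof -
  have "inv' (id :: nat \<Rightarrow> nat) = id" by simp
  moreover have "\<tau> \<circ> id \<circ> inv' \<tau> = id" if "\<tau> permutes {1..q}" for \<tau> using permutes_inv_o[OF that] by simp
  ultimately show ?thesis unfolding normal_sym_iff by (auto simp: permutes_id)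
qed

lemma normal_full: "normal {\<sigma>. \<sigma> permutes {1..q}} (sym_group q)"
  unfolding normal_sym_iff by (auto simp: permutes_id permutes_inv intro!: permutes_compose)

lemma nu_trivial: "q \<le> n \<Longrightarrow> nu P {e q} \<subseteq> Id_on Q"
proof (intro subrelI)
  fix a b assume q: "q \<le> n" and ab: "(a, b) \<in> nu P {e q}"
  have e: "{e q} = bar n q ` {id}" by simp
  have "a \<in> Q" using nu_ranks(1)[OF q normal_id] ab e by metis
  moreover have "a = b" using ab unfolding e nu_iff[OF q normal_sym_nonempty(1,2)[OF normal_id]] by auto
  ultimately show "(a, b) \<in> Id_on Q" by auto
qed

lemma carrier_sym: "carrier (sym_group q) = {\<sigma>. \<sigma> permutes {1..q}}"
  by (auto simp: sym_group_carrier)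

lemma Times_Collect: "{(a, b). a \<in> X \<and> b \<in> X} = X \<times> X"
  by auto

lemma retr_cong_eq:
  assumes "1 \<le> n" "k \<le> 1"
  shows "mu_cong P (I k) M = Id_on Q \<union> nu P M \<union> {(a, b). a \<in> I k \<and> b \<in> I k \<and> agree Mu a b}"
    "lambda_cong P (I k) M = Id_on Q \<union> nu P M \<union> {(a, b). a \<in> I k \<and> b \<in> I k \<and> agree Lambda a b}"
    "rho_cong P (I k) M = Id_on Q \<union> nu P M \<union> {(a, b). a \<in> I k \<and> b \<in> I k \<and> agree Rho a b}"
  unfolding mu_cong_def lambda_cong_def rho_cong_def retr_cong_def
  using retr_green[OF assms] by blast+

text \<open>One shape for all twelve congruences: for \<open>C0\<close> and \<open>C1\<close> the
  group is trivial, so that \<open>nu\<close> adds nothing to the diagonal.\<close>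

lemma xi_eq:
  assumes "2 \<le> n"
  shows "xi n x i = Id_on Q \<union> (if i = CS2 then nu P (Sbar 2) else {}) \<union>
    {(a, b). a \<in> I (lev i) \<and> b \<in> I (lev i) \<and> agree x a b}"
proof -
  have 1: "1 \<le> n" using assms by simp
  have t: "Id_on Q \<union> nu P {e 1} = Id_on Q" "Id_on Q \<union> nu P {e 2} = Id_on Q"
    using nu_trivial[of 1] nu_trivial[of 2] assms by auto
  show ?thesis
    by (cases x; cases i)
      (simp_all add: retr_cong_eq[OF 1] t t[unfolded One_nat_def] R_rees_def rees_cong_def R_norm_def R_cong_def S_bar_eq carrier_sym Times_Collect One_nat_def)
qed

lemma xi_congruence:
  assumes "2 \<le> n" shows "xi n x i \<in> congruences P"
proof -
  have n1: "1 \<le> n" using assms by simp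
  have sub: "I (lev i) \<subseteq> I 1" for i using I0_subset by (cases i) auto
  have m: "agree x (s \<odot> a) (s \<odot> b) \<and> agree x (a \<odot> s) (b \<odot> s)"
    if "a \<in> I (lev i)" "b \<in> I (lev i)" "s \<in> Q" "agree x a b" for a b s i
    using agree_mult[OF n1 _ _ that(3,4)] that(1,2) sub by blast
  show ?thesis
  proof (cases "i = CS2")
    case True
    have "Id_on Q \<union> nu P (Sbar 2) \<union> {(a, b). a \<in> I 1 \<and> b \<in> I 1 \<and> agree x a b} \<in> congruences P"
    proof (rule congruence_nu)
      show "{\<sigma>. \<sigma> permutes {1..2::nat}} = {id} \<or> (1 = 2 - (1::nat) \<and> (\<forall>a b s. (a, b) \<in> nu P (Sbar 2) \<longrightarrow>
          s \<in> Q \<longrightarrow> agree x (s \<odot> a) (s \<odot> b) \<and> agree x (a \<odot> s) (b \<odot> s)))"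
        using nu_agree[OF assms normal_full] by simp
      show "agree x (s \<odot> a) (s \<odot> b) \<and> agree x (a \<odot> s) (b \<odot> s)"
        if "a \<in> I 1" "b \<in> I 1" "s \<in> Q" "agree x a b" for a b s
        using m[of a CS2 b s] that by simp
    qed (use assms normal_full in \<open>auto intro: agree_refl agree_sym agree_trans\<close>)
    then show ?thesis using True by (simp add: xi_eq[OF assms])
  next
    case False
    have "Id_on Q \<union> nu P (bar n (Suc (lev i)) ` {id}) \<union> {(a, b). a \<in> I (lev i) \<and> b \<in> I (lev i) \<and> agree x a b} \<in> congruences P"
    proof (rule congruence_nu)
      show "Suc (lev i) \<le> n" using assms by (cases i) auto
      show "agree x (s \<odot> a) (s \<odot> b) \<and> agree x (a \<odot> s) (b \<odot> s)"
        if "a \<in> I (lev i)" "b \<in> I (lev i)" "s \<in> Q" "agree x a b" for a b s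
        using m[OF that] .
    qed (auto intro: agree_refl agree_sym agree_trans normal_id)
    moreover have "Suc (lev i) \<le> n" using assms by (cases i) auto
    then have "Id_on Q \<union> nu P (bar n (Suc (lev i)) ` {id}) = Id_on Q" using nu_trivial[of "Suc (lev i)"] by auto
    ultimately show ?thesis using False by (simp add: xi_eq[OF assms])
  qed
qed

lemma R_norm_eq: "R_norm n q N = Id_on Q \<union> nu P (bar n q ` N) \<union> I (q - 1) \<times> I (q - 1)"
  by (simp add: R_norm_def R_cong_def)

lemma R_rees_eq: "R_rees n q = Id_on Q \<union> I q \<times> I q"
  by (simp add: R_rees_def rees_cong_def)

lemma R_norm_congruence:
  assumes "1 \<le> q" "q \<le> n" "normal N (sym_group q)" shows "R_norm n q N \<in> congruences P"
proof -
  have "Id_on Q \<union> nu P (bar n q ` N) \<union> {(a, b). a \<in> I (q - 1) \<and> b \<in> I (q - 1) \<and> agree RR a b} \<in> congruences P"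
    by (rule congruence_nu) (use assms in auto)
  then show ?thesis by (simp add: R_norm_eq Times_Collect)
qed

lemma R_rees_congruence: "R_rees n q \<in> congruences P"
  unfolding congruences_iff R_rees_eq
proof (intro conjI allI impI)
  show "equiv Q (Id_on Q \<union> I q \<times> I q)"
    by (rule equivI) (auto simp: refl_on_def sym_def trans_def I_iff)
qed (use I_ideal_mult in auto)

lemma I_n: "I n = Q"
  using rank_le_n by (auto simp: I_iff)

lemma R_rees_n: "R_rees n n = Q \<times> Q"
  by (auto simp: R_rees_eq I_n)

section \<open>The retractable IN-pairs\<close>

lemma card_image_const: "M \<noteq> {} \<Longrightarrow> (\<And>h. h \<in> M \<Longrightarrow> f h = c) \<Longrightarrow> card (\<Union>h\<in>M. {f h}) = 1"
proof -
  assume "M \<noteq> {}" "\<And>h. h \<in> M \<Longrightarrow> f h = c"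
  then have "(\<Union>h\<in>M. {f h}) = {c}" by auto
  then show ?thesis by simp
qed

lemma retractable_IN_pairs:
  assumes "2 \<le> n"
  shows "{(J, M). retractable_IN_pair P J M \<and> (\<exists>q\<le>n. le_S_bar n q M)} =
     {C_pair n C0, C_pair n C1, C_pair n CS2}" (is "?l = ?r")
proof (intro equalityI subrelI)
  have n1: "1 \<le> n" using assms by simp
  fix J M assume "(J, M) \<in> ?l"
  then obtain q where q: "q \<le> n" "IN_pair P J M" "retractable_ideal P J" "le_S_bar n q M"
    by (auto simp: retractable_IN_pair_def)
  then obtain N where N: "1 \<le> q" "normal N (sym_group q)" "M = bar n q ` N" "J = I (q - 1)"
    using IN_pair_char[OF q(1), of J M] by metis
  note N' = normal_sym_nonempty[OF N(2)]
  have "q - 1 \<le> 1" using q(3) N(4) retractable_iff[OF n1, of "q - 1"] q(1) by auto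
  then consider "q = 1" | "q = 2" using N(1) by linarith
  then show "(J, M) \<in> ?r"
  proof cases
    case 1
    then have "N = {id}" using N' permutes_small[of 1] by auto
    then show ?thesis using N 1 by simp
  next
    case 2
    then have "N \<subseteq> {id, transpose 1 2}" using N' permutes_2 by auto
    then have "N = {id} \<or> N = {id, transpose 1 2}" using N'(3) by blast
    then have "N = {id} \<or> N = {\<sigma>. \<sigma> permutes {1..2}}" unfolding permutes_2 by auto
    then show ?thesis using N(3,4) unfolding 2 by (elim disjE) (simp_all add: S_bar_eq One_nat_def)
  qed
next
  have n1: "1 \<le> n" using assms by simp
  fix J M assume "(J, M) \<in> ?r"
  then have "\<exists>q N. 1 \<le> q \<and> q \<le> 2 \<and> normal N (sym_group q) \<and> J = I (q - 1) \<and> M = bar n q ` N"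
  proof (elim insertE emptyE)
    assume "(J, M) = C_pair n C0"
    then show ?thesis by (intro exI[of _ 1] exI[of _ "{id}"]) (simp_all add: normal_id One_nat_def)
  next
    assume "(J, M) = C_pair n C1"
    then show ?thesis by (intro exI[of _ 2] exI[of _ "{id}"]) (simp_all add: normal_id One_nat_def)
  next
    assume "(J, M) = C_pair n CS2"
    then show ?thesis by (intro exI[of _ 2] exI[of _ "{\<sigma>. \<sigma> permutes {1..2}}"]) (simp_all add: normal_full normal_full[unfolded One_nat_def] S_bar_eq One_nat_def)
  qed
  then obtain q N where q: "1 \<le> q" "q \<le> 2" "normal N (sym_group q)" "J = I (q - 1)" "M = bar n q ` N" by blast
  note N' = normal_sym_nonempty[OF q(3)]
  have qn: "q \<le> n" using q assms by simp
  \<comment> \<open>In degree 2, writing \<open>x\<close> as \<open>x \<odot> e 0 \<odot> x\<close>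
    reduces the claim to \<open>e0_swap\<close>.\<close>
  have c: "x \<odot> h = x \<odot> e q \<and> h \<odot> x = e q \<odot> x" if x: "x \<in> I 0" and h: "h \<in> M" for x h
  proof (cases "q = 1")
    case True
    then have "h = e q" using h q(5) N'(1) permutes_small[of 1] by auto
    then show ?thesis by simp
  next
    case False
    then have q2: "q = 2" using q by simp
    obtain \<sigma> where s: "\<sigma> permutes {1..2}" "h = bar n 2 \<sigma>" using h q(5) N'(1) q2 by auto
    have Q: "x \<in> Q" "h \<in> Q" "e 2 \<in> Q" using x s assms by (auto simp: I_iff)
    have xx: "x = x \<odot> e 0 \<odot> x" using rank0_hat[OF x] by simp
    have "x \<odot> e 0 \<odot> x \<odot> h = x \<odot> (e 0 \<odot> x \<odot> h)" "x \<odot> e 0 \<odot> x \<odot> e 2 = x \<odot> (e 0 \<odot> x \<odot> e 2)"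
      "h \<odot> (x \<odot> e 0 \<odot> x) = (h \<odot> x \<odot> e 0) \<odot> x" "e 2 \<odot> (x \<odot> e 0 \<odot> x) = (e 2 \<odot> x \<odot> e 0) \<odot> x"
      using Q by (simp_all add: mult_assoc)
    then show ?thesis using e0_swap[OF assms Q(1) s(1)] xx q2 s(2) by metis
  qed
  have "M \<noteq> {}" using q N' by simp
  then have "card (x <#\<^bsub>P\<^esub> M) = 1 \<and> card (M #>\<^bsub>P\<^esub> x) = 1" if "x \<in> I 0" for x
    unfolding l_coset_def r_coset_def mult_part_monoid
    using card_image_const[of M "\<lambda>h. x \<odot> h" "x \<odot> e q"] card_image_const[of M "\<lambda>h. h \<odot> x" "e q \<odot> x"] c[OF that] by auto
  moreover have "IN_pair P J M \<and> le_S_bar n q M" using IN_pair_char[OF qn, of J M] q by blast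
  moreover have "retractable_ideal P J" using retractable_iff[OF n1, of "q - 1"] q assms by auto
  ultimately show "(J, M) \<in> ?l" unfolding retractable_IN_pair_def min_ideal_eq using qn by auto
qed

section \<open>Separating elements of equal rank\<close>

definition in_dom :: "pt set set \<Rightarrow> nat \<Rightarrow> bool" where
  "in_dom \<alpha> i \<longleftrightarrow> (\<exists>j. conn \<alpha> (Up i) (Lo j))"

text \<open>Upper points that belong to no transversal can be relabelled, class by class, without
  affecting the lower row.\<close>

lemma sat_upper_class:
  assumes "\<alpha> \<in> Q" "\<not> in_dom \<alpha> i" "sat \<alpha> A B"
  shows "sat \<alpha> (A \<union> {j. conn \<alpha> (Up i) (Up j)}) B" "sat \<alpha> (A - {j. conn \<alpha> (Up i) (Up j)}) B"
proof -
  let ?K = "{j. conn \<alpha> (Up i) (Up j)}"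
  have nd: "\<not> conn \<alpha> (Up j) (Lo l)" if "conn \<alpha> (Up i) (Up j)" for j l
    using that assms(2) conn_trans[OF assms(1)] unfolding in_dom_def by blast
  have k: "conn \<alpha> (Up j) (Up l) \<Longrightarrow> j \<in> ?K \<longleftrightarrow> l \<in> ?K" for j l
    using conn_trans[OF assms(1)] conn_sym by blast
  note c = sat_conn[OF assms(3)]
  have UL: "i' \<in> A \<union> ?K \<longleftrightarrow> j \<in> B" "i' \<in> A - ?K \<longleftrightarrow> j \<in> B" if "conn \<alpha> (Up i') (Lo j)" for i' j
    using c(1)[OF that] nd[of i' j] that by auto
  have UU: "j \<in> A \<union> ?K \<longleftrightarrow> l \<in> A \<union> ?K" "j \<in> A - ?K \<longleftrightarrow> l \<in> A - ?K" if "conn \<alpha> (Up j) (Up l)" for j l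
    using c(2)[OF that] k[OF that] by auto
  show "sat \<alpha> (A \<union> ?K) B" unfolding sat_iff[OF assms(1)] using UL(1) UU(1) c(3) by (intro conjI allI impI) metis+
  show "sat \<alpha> (A - ?K) B" unfolding sat_iff[OF assms(1)] using UL(2) UU(2) c(3) by (intro conjI allI impI) metis+
qed

lemma upper_class:
  assumes "\<alpha> \<in> Q" "\<not> in_dom \<alpha> i" shows "sat \<alpha> {j. conn \<alpha> (Up i) (Up j)} {}"
  using sat_upper_class(1)[OF assms sat_const(1)[OF assms(1)]] by simp

lemma in_dom_conn: "\<alpha> \<in> Q \<Longrightarrow> conn \<alpha> (Up i) (Up j) \<Longrightarrow> in_dom \<alpha> i \<longleftrightarrow> in_dom \<alpha> j"
  unfolding in_dom_def using conn_trans conn_sym by blast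

text \<open>\<open>\<alpha> \<odot> flip \<alpha>\<close> encodes exactly the upper kernel and the
  domain of \<open>\<alpha>\<close>: both rows respect the kernel, and labels are compared on the
  domain only.\<close>

lemma sat_mult_flip:
  assumes "\<alpha> \<in> Q"
  shows "sat (\<alpha> \<odot> flip \<alpha>) A A' \<longleftrightarrow> (\<forall>i j. conn \<alpha> (Up i) (Up j) \<longrightarrow> i \<in> A \<longrightarrow> j \<in> A) \<and>
    (\<forall>i j. conn \<alpha> (Up i) (Up j) \<longrightarrow> i \<in> A' \<longrightarrow> j \<in> A') \<and> (\<forall>i. in_dom \<alpha> i \<longrightarrow> (i \<in> A \<longleftrightarrow> i \<in> A'))" (is "?l \<longleftrightarrow> ?r")
proof
  assume ?l
  then obtain B where B: "sat \<alpha> A B" "sat \<alpha> A' B" using assms by (auto simp: sat_mult sat_flip)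
  show ?r unfolding in_dom_def using sat_conn[OF B(1)] sat_conn[OF B(2)] by blast
next
  assume r: ?r
  define B where "B = {j. \<exists>i\<in>A. conn \<alpha> (Up i) (Lo j)}"
  have UL: "i \<in> A \<longleftrightarrow> j \<in> B" if c: "conn \<alpha> (Up i) (Lo j)" for i j
  proof
    assume "j \<in> B"
    then obtain i' where "i' \<in> A" "conn \<alpha> (Up i') (Lo j)" unfolding B_def by blast
    then have "conn \<alpha> (Up i') (Up i)" using c conn_trans[OF assms] conn_sym by blast
    then show "i \<in> A" using r \<open>i' \<in> A\<close> by blast
  qed (use c B_def in blast)
  have LL: "j \<in> B" if "conn \<alpha> (Lo i) (Lo j)" "i \<in> B" for i j
    using that conn_trans[OF assms] unfolding B_def by blast
  have "sat \<alpha> A B" unfolding sat_iff[OF assms] using UL LL r by blast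
  moreover have "sat \<alpha> A' B" unfolding sat_iff[OF assms] using UL LL r in_dom_def by blast
  ultimately show ?l using assms by (auto simp: sat_mult sat_flip)
qed

lemma mult_flip_differ:
  assumes "\<alpha> \<in> Q" "\<beta> \<in> Q" "\<alpha> \<odot> flip \<alpha> \<noteq> \<beta> \<odot> flip \<beta>"
  shows "(\<exists>i. in_dom \<alpha> i \<noteq> in_dom \<beta> i) \<or> (\<exists>i j. conn \<alpha> (Up i) (Up j) \<noteq> conn \<beta> (Up i) (Up j))"
proof (rule ccontr)
  assume "\<not> ?thesis"
  then have "\<alpha> \<odot> flip \<alpha> = \<beta> \<odot> flip \<beta>"
    by (intro Q_eqI) (auto simp: sat_mult_flip[OF assms(1)] sat_mult_flip[OF assms(2)])
  then show False using assms(3) by blast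
qed

section \<open>Multipliers that tell two elements apart by rank\<close>

lemma reps_update:
  assumes "\<alpha> \<in> Q" "is_reps \<alpha> q a b" "k \<in> {1..q}" "conn \<alpha> (Up i) (Up (a k))"
  shows "is_reps \<alpha> q (a(k := i)) b"
proof -
  have r1: "\<And>l. l \<in> {1..q} \<Longrightarrow> conn \<alpha> (Up (a l)) (Lo (b l))"
    and r2: "\<And>k l. k \<in> {1..q} \<Longrightarrow> l \<in> {1..q} \<Longrightarrow> conn \<alpha> (Up (a k)) (Up (a l)) \<Longrightarrow> k = l"
    and r3: "\<And>i j. conn \<alpha> (Up i) (Lo j) \<Longrightarrow> \<exists>k\<in>{1..q}. conn \<alpha> (Up i) (Up (a k))"
    using assms(2) unfolding is_reps_def by blast+
  have c: "conn \<alpha> p (Up ((a(k := i)) l)) \<longleftrightarrow> conn \<alpha> p (Up (a l))" for p l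
  proof (cases "l = k")
    case True
    then show ?thesis using conn_trans[OF assms(1) _ assms(4), of p]
        conn_trans[OF assms(1) _ conn_sym[OF assms(4)], of p] by (simp only: fun_upd_same) blast
  qed simp
  have c': "conn \<alpha> (Up ((a(k := i)) l)) p \<longleftrightarrow> conn \<alpha> (Up (a l)) p" for p l
    using c[of p l] conn_sym by blast
  show ?thesis unfolding is_reps_def c c' using r1 r2 r3 by blast
qed

text \<open>In rank \<open>q\<close> some \<open>v\<close> gives \<open>x \<odot> v = e q\<close>. A
  union of blocks of \<open>x\<close> containing the upper point \<open>k\<close> and no lower point
  would survive in this product, which \<open>e q\<close> does not allow.\<close>

lemma rank_drop1:
  assumes "q \<le> n" "x \<in> Q" "e q \<odot> x = x" "sat x A {}" "k \<in> A" "k \<in> {1..q}"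
  shows "part_rank x < q"
proof (rule ccontr)
  assume "\<not> part_rank x < q"
  then have "part_rank (e q \<odot> x) = q" using rank_mult(1)[of "e q" x] assms(1-3) by simp
  then obtain v where v: "v \<in> Q" "x \<odot> v = e q" using right_cancel_e[OF assms(1,2)] assms(3) by metis
  have "sat (x \<odot> v) A {}" using assms(2,4) v(1) sat_const(1)[OF v(1)] by (auto simp: sat_mult)
  then show False using v(2) assms by (auto simp: sat_e)
qed

text \<open>The same cancellation: \<open>e q\<close> can label \<open>k\<close> and
  \<open>l\<close> differently, so \<open>x\<close> must be able to do so in rank
  \<open>q\<close>.\<close>

lemma rank_drop2:
  assumes "q \<le> n" "x \<in> Q" "e q \<odot> x = x" "\<And>A B. sat x A B \<Longrightarrow> k \<in> A \<longleftrightarrow> l \<in> A" "k \<noteq> l" "k \<in> {1..q}"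
  shows "part_rank x < q"
proof (rule ccontr)
  assume "\<not> part_rank x < q"
  then have "part_rank (e q \<odot> x) = q" using rank_mult(1)[of "e q" x] assms(1-3) by simp
  then obtain v where v: "v \<in> Q" "x \<odot> v = e q" using right_cancel_e[OF assms(1,2)] assms(3) by metis
  have "sat (x \<odot> v) {k} {k}" using assms(1) by (simp add: v(2) sat_e)
  then obtain B where "sat x {k} B" using assms(2) v(1) by (auto simp: sat_mult)
  then show False using assms(4)[of "{k}" B] assms(5) by auto
qed

lemma e_sel:
  assumes "q \<le> n" "a ` {1..q} \<subseteq> {1..n}" shows "e q \<odot> sel q a = sel q a"
  by (rule Q_eqI) (use assms in \<open>auto simp: sat_mult sat_e sat_sel[OF assms]\<close>)

lemma e_absorb_left:
  assumes "q \<le> n" "x \<in> Q" "y \<in> Q" "e q \<odot> x = x" shows "e q \<odot> (x \<odot> y) = x \<odot> y"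
  using mult_assoc[OF e_Q[OF assms(1)] assms(2,3)] assms(4) by simp

lemma rank_sel_mult:
  assumes "\<alpha> \<in> Q" "is_reps \<alpha> q a b" shows "part_rank (sel q a \<odot> \<alpha>) = q"
proof -
  note r = reps_range[OF assms]
  have "q \<le> part_rank (sel q a \<odot> \<alpha>)"
    using rank_mult(1)[of "sel q a \<odot> \<alpha>" "flip (sel q b)"] reps_middle[OF assms] r(4) by simp
  moreover have "part_rank (sel q a \<odot> \<alpha>) \<le> q"
    using rank_mult(1)[of "e q" "sel q a \<odot> \<alpha>"] e_absorb_left[OF r(4) sel_Q assms(1) e_sel[OF r(4,1)]] r(4) by simp
  ultimately show ?thesis by simp
qed

text \<open>One of the selected threads is made to enter at \<open>i\<close>: it passes through
  \<open>\<alpha>\<close> and ends in \<open>\<beta>\<close>.\<close>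

lemma separate_dom:
  assumes "\<alpha> \<in> Q" "\<beta> \<in> Q" "part_rank \<alpha> = q" "in_dom \<alpha> i" "\<not> in_dom \<beta> i"
  shows "\<exists>w\<in>Q. part_rank (w \<odot> \<alpha>) = q \<and> part_rank (w \<odot> \<beta>) < q"
proof -
  obtain a b where ab: "is_reps \<alpha> q a b" using reps_exist[OF assms(1)] assms(3) by metis
  then obtain k where k: "k \<in> {1..q}" "conn \<alpha> (Up i) (Up (a k))"
    using assms(4) unfolding in_dom_def is_reps_def by blast
  define a' where "a' = a(k := i)"
  have ab': "is_reps \<alpha> q a' b" unfolding a'_def by (rule reps_update[OF assms(1) ab k])
  note r = reps_range[OF assms(1) ab']
  have ip: "i \<in> {1..n}" using conn_points[OF assms(1) k(2)] by simp
  let ?B = "{j. conn \<beta> (Up i) (Up j)}"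
  have "sat (sel q a') {k. a' k \<in> ?B} ?B" by (simp add: sat_sel[OF r(4,1)])
  then have s: "sat (sel q a' \<odot> \<beta>) {k. a' k \<in> ?B} {}"
    using upper_class[OF assms(2,5)] assms(2) by (auto simp: sat_mult)
  have "k \<in> {k. a' k \<in> ?B}" using conn_refl[OF assms(2), of "Up i"] ip by (simp add: a'_def)
  then have "part_rank (sel q a' \<odot> \<beta>) < q"
    using rank_drop1[OF r(4) mult_closed e_absorb_left[OF r(4) sel_Q assms(2) e_sel[OF r(4,1)]] s] k(1) by blast
  then show ?thesis using rank_sel_mult[OF assms(1) ab'] sel_Q by blast
qed

text \<open>Two of the selected threads are made to enter at \<open>i\<close> and \<open>j\<close>:
  they follow different transversals of \<open>\<beta>\<close> but merge in
  \<open>\<alpha>\<close>.\<close>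

lemma separate_ker_dom:
  assumes "\<alpha> \<in> Q" "\<beta> \<in> Q" "part_rank \<beta> = q" "in_dom \<beta> i" "in_dom \<beta> j"
    "conn \<alpha> (Up i) (Up j)" "\<not> conn \<beta> (Up i) (Up j)"
  shows "\<exists>w\<in>Q. part_rank (w \<odot> \<beta>) = q \<and> part_rank (w \<odot> \<alpha>) < q"
proof -
  obtain a b where ab: "is_reps \<beta> q a b" using reps_exist[OF assms(2)] assms(3) by metis
  then obtain k l where k: "k \<in> {1..q}" "conn \<beta> (Up i) (Up (a k))" and l: "l \<in> {1..q}" "conn \<beta> (Up j) (Up (a l))"
    using assms(4,5) unfolding in_dom_def is_reps_def by blast
  have kl: "k \<noteq> l" using k l assms(7) conn_trans[OF assms(2)] conn_sym by blast
  define a' where "a' = a(k := i, l := j)"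
  have "is_reps \<beta> q (a(k := i)) b" by (rule reps_update[OF assms(2) ab k])
  then have ab': "is_reps \<beta> q a' b" unfolding a'_def
    by (rule reps_update[OF assms(2)]) (use l kl in auto)
  note r = reps_range[OF assms(2) ab']
  have "k \<in> A \<longleftrightarrow> l \<in> A" if s: "sat (sel q a' \<odot> \<alpha>) A C" for A C
  proof -
    obtain B where B: "\<forall>k\<in>{1..q}. k \<in> A \<longleftrightarrow> a' k \<in> B" "sat \<alpha> B C"
      using s assms(1) by (auto simp: sat_mult sat_sel[OF r(4,1)])
    have "a' k = i" "a' l = j" using kl by (auto simp: a'_def)
    then show ?thesis using B(1) k(1) l(1) sat_conn(2)[OF B(2) assms(6)] by metis
  qed
  then have "part_rank (sel q a' \<odot> \<alpha>) < q"
    using rank_drop2[OF r(4) mult_closed e_absorb_left[OF r(4) sel_Q assms(1) e_sel[OF r(4,1)]] _ kl k(1)] by blast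
  then show ?thesis using rank_sel_mult[OF assms(2) ab'] sel_Q by blast
qed

text \<open>A thread that merely enters at \<open>i\<close> ends in both elements, so the multiplier
  has to use the connection from \<open>i\<close> to \<open>j\<close> as a bridge inside a
  thread.\<close>

lemma separate_ker_nondom:
  assumes "\<alpha> \<in> Q" "\<beta> \<in> Q" "part_rank \<alpha> = q" "1 \<le> q" "\<not> in_dom \<alpha> i" "\<And>i. in_dom \<alpha> i = in_dom \<beta> i"
    "conn \<alpha> (Up i) (Up j)" "\<not> conn \<beta> (Up i) (Up j)"
  shows "\<exists>w\<in>Q. part_rank (w \<odot> \<alpha>) = q \<and> part_rank (w \<odot> \<beta>) < q"
proof -
  obtain a b where ab: "is_reps \<alpha> q a b" using reps_exist[OF assms(1)] assms(3) by metis
  note r = reps_range[OF assms(1) ab]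
  have ip: "i \<in> {1..n}" "j \<in> {1..n}" using conn_points[OF assms(1,7)] by auto
  have one: "1 \<in> {1..q}" using assms(4) by simp
  have adom: "in_dom \<alpha> (a k)" if "k \<in> {1..q}" for k using ab that unfolding is_reps_def in_dom_def by blast
  txt \<open>Under \<open>w\<close> the point \<open>1\<close> reaches the transversal of \<open>a 1\<close> along \<open>1\<close>, \<open>i\<close>, \<open>j\<close>, \<open>a 1\<close> in \<open>\<alpha>\<close>, but the step from
    \<open>i\<close> to \<open>j\<close> is missing in \<open>\<beta>\<close>.\<close>
  define E where "E = {(Up 1, Lo i), (Lo j, Lo (a 1))} \<union> (\<lambda>k. (Up k, Lo (a k))) ` {2..q}"
  define w where "w = gen n E"
  have E: "E \<subseteq> points n \<times> points n"
  proof -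
    have "a k \<in> {1..n}" if "k \<in> {1..q}" for k using r(1) that by blast
    then have "(Up k, Lo (a k)) \<in> points n \<times> points n" if "k \<in> {2..q}" for k
      using that r(4) by simp
    moreover have "(Up 1, Lo i) \<in> points n \<times> points n" "(Lo j, Lo (a 1)) \<in> points n \<times> points n"
      using ip one r(4) \<open>\<And>k. k \<in> {1..q} \<Longrightarrow> a k \<in> {1..n}\<close>[OF one] by simp_all
    ultimately show ?thesis unfolding E_def by blast
  qed
  have wQ: "w \<in> Q" by (simp add: w_def)
  have sw: "sat w A B \<longleftrightarrow> (1 \<in> A \<longleftrightarrow> i \<in> B) \<and> (j \<in> B \<longleftrightarrow> a 1 \<in> B) \<and> (\<forall>k\<in>{2..q}. k \<in> A \<longleftrightarrow> a k \<in> B)" for A B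
    unfolding w_def sat_gen[OF E] unfolding E_def by (simp add: ball_Un)
  have split: "(\<forall>k\<in>{1..q}. R k) \<longleftrightarrow> R 1 \<and> (\<forall>k\<in>{2..q}. R k)" for R :: "nat \<Rightarrow> bool"
  proof -
    have "{1..q} = insert 1 {2..q}" using assms(4) by auto
    then show ?thesis by simp
  qed
  have ew: "e q \<odot> w = w"
  proof (rule Q_eqI)
    show "sat (e q \<odot> w) A B \<longleftrightarrow> sat w A B" for A B
      unfolding sat_mult[OF e_Q[OF r(4)] wQ] sat_e[OF r(4)] sw split by blast
  qed (use wQ in auto)
  have "w \<odot> \<alpha> \<odot> flip (sel q b) = e q"
  proof (rule Q_eqI)
    fix A D
    have sp: "sat (w \<odot> \<alpha> \<odot> flip (sel q b)) A D \<longleftrightarrow> (\<exists>B C. sat w A B \<and> sat \<alpha> B C \<and> (\<forall>k\<in>{1..q}. k \<in> D \<longleftrightarrow> b k \<in> C))"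
      using assms(1) wQ by (auto simp: sat_mult sat_flip sat_sel[OF r(4,2)])
    have abk: "a k \<in> B \<longleftrightarrow> b k \<in> C" if "sat \<alpha> B C" "k \<in> {1..q}" for B C k
      using sat_conn(1)[OF that(1)] ab that(2) unfolding is_reps_def by blast
    show "sat (w \<odot> \<alpha> \<odot> flip (sel q b)) A D \<longleftrightarrow> sat (e q) A D" unfolding sp sat_e[OF r(4)]
    proof
      assume "\<exists>B C. sat w A B \<and> sat \<alpha> B C \<and> (\<forall>k\<in>{1..q}. k \<in> D \<longleftrightarrow> b k \<in> C)"
      then obtain B C where BC: "sat w A B" "sat \<alpha> B C" "\<forall>k\<in>{1..q}. k \<in> D \<longleftrightarrow> b k \<in> C" by blast
      have "\<forall>k\<in>{1..q}. k \<in> A \<longleftrightarrow> a k \<in> B" unfolding split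
        using BC(1) sat_conn(2)[OF BC(2) assms(7)] unfolding sw by blast
      then show "\<forall>k\<in>{1..q}. k \<in> A \<longleftrightarrow> k \<in> D" using BC(3) abk[OF BC(2)] by blast
    next
      assume AD: "\<forall>k\<in>{1..q}. k \<in> A \<longleftrightarrow> k \<in> D"
      then have "sat (sel q a \<odot> \<alpha> \<odot> flip (sel q b)) A D" unfolding reps_middle[OF assms(1) ab] sat_e[OF r(4)] .
      then obtain B C where BC: "\<forall>k\<in>{1..q}. k \<in> A \<longleftrightarrow> a k \<in> B" "sat \<alpha> B C" "\<forall>k\<in>{1..q}. k \<in> D \<longleftrightarrow> b k \<in> C"
        unfolding sat_mult[OF mult_closed flip_Q] sat_mult[OF sel_Q assms(1)] sat_flip[OF sel_Q] sat_sel[OF r(4,1)] sat_sel[OF r(4,2)]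
        by blast
      let ?K = "{j. conn \<alpha> (Up i) (Up j)}"
      \<comment> \<open>The block used as a detour gets the label of the point 1. It belongs to no
        transversal, so the rest of the labelling is not disturbed.\<close>
      define B' where "B' = (if 1 \<in> A then B \<union> ?K else B - ?K)"
      have "sat \<alpha> B' C" unfolding B'_def using sat_upper_class[OF assms(1,5) BC(2)] by simp
      moreover have nK: "a k \<notin> ?K" if "k \<in> {1..q}" for k
        using adom[OF that] assms(5) in_dom_conn[OF assms(1)] by blast
      have K: "i \<in> ?K" "j \<in> ?K" using assms(7) conn_refl[OF assms(1), of "Up i"] ip by auto
      have "sat w A B'" unfolding sw B'_def using K nK BC(1)[unfolded split] one nK[OF one] by auto
      ultimately show "\<exists>B C. sat w A B \<and> sat \<alpha> B C \<and> (\<forall>k\<in>{1..q}. k \<in> D \<longleftrightarrow> b k \<in> C)" using BC(3) by blast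
    qed
  qed (use r(4) in auto)
  then have "q \<le> part_rank (w \<odot> \<alpha>)" using rank_mult(1)[of "w \<odot> \<alpha>" "flip (sel q b)"] r(4) by simp
  moreover have "part_rank (w \<odot> \<alpha>) \<le> q"
    using rank_mult(1)[of "e q" "w \<odot> \<alpha>"] e_absorb_left[OF r(4) wQ assms(1) ew] r(4) by simp
  ultimately have wa: "part_rank (w \<odot> \<alpha>) = q" by simp
  let ?B = "{j. conn \<beta> (Up i) (Up j)}"
  have nb: "\<not> in_dom \<beta> i" using assms(5,6) by blast
  have nK: "a k \<notin> ?B" if "k \<in> {1..q}" for k
    using adom[OF that] assms(6) nb in_dom_conn[OF assms(2)] by blast
  have "a k \<notin> ?B" if "k \<in> {2..q}" for k using nK[of k] that by simp
  then have "sat w {1} ?B" unfolding sw using nK[OF one] assms(8) conn_refl[OF assms(2), of "Up i"] ip by auto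
  then have "sat (w \<odot> \<beta>) {1} {}" using upper_class[OF assms(2) nb] assms(2) wQ by (auto simp: sat_mult)
  then have "part_rank (w \<odot> \<beta>) < q"
    by (rule rank_drop1[OF r(4) mult_closed e_absorb_left[OF r(4) wQ assms(2) ew]]) (use one in auto)
  then show ?thesis using wa wQ by blast
qed

text \<open>Different projections mean different domains or different upper kernels. A connection
  present in \<open>\<alpha>\<close> only lowers the rank of \<open>\<alpha>\<close> inside the
  common domain, but that of \<open>\<beta>\<close> outside it; therefore the conclusion is
  symmetric.\<close>

lemma separate:
  assumes "\<alpha> \<in> Q" "\<beta> \<in> Q" "part_rank \<alpha> = q" "part_rank \<beta> = q" "1 \<le> q" "\<alpha> \<odot> flip \<alpha> \<noteq> \<beta> \<odot> flip \<beta>"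
  shows "\<exists>w\<in>Q. (part_rank (w \<odot> \<alpha>) = q \<and> part_rank (w \<odot> \<beta>) < q) \<or> (part_rank (w \<odot> \<beta>) = q \<and> part_rank (w \<odot> \<alpha>) < q)"
proof (cases "\<exists>i. in_dom \<alpha> i \<noteq> in_dom \<beta> i")
  case True
  then show ?thesis using separate_dom[OF assms(1,2,3)] separate_dom[OF assms(2,1,4)] by blast
next
  case False
  then obtain i j where ij: "conn \<alpha> (Up i) (Up j) \<noteq> conn \<beta> (Up i) (Up j)"
    using mult_flip_differ[OF assms(1,2,6)] by blast
  have d: "in_dom \<alpha> i = in_dom \<beta> i" for i using False by blast
  have gen: "\<exists>w\<in>Q. (part_rank (w \<odot> \<alpha>) = q \<and> part_rank (w \<odot> \<beta>) < q) \<or> (part_rank (w \<odot> \<beta>) = q \<and> part_rank (w \<odot> \<alpha>) < q)"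
    if "\<alpha> \<in> Q" "\<beta> \<in> Q" "part_rank \<alpha> = q" "part_rank \<beta> = q" "conn \<alpha> (Up i) (Up j)" "\<not> conn \<beta> (Up i) (Up j)"
      "\<And>i. in_dom \<alpha> i = in_dom \<beta> i" for \<alpha> \<beta>
  proof (cases "in_dom \<alpha> i")
    case True
    then have "in_dom \<beta> i" "in_dom \<beta> j" using that(7) in_dom_conn[OF that(1,5)] by blast+
    then show ?thesis using separate_ker_dom[OF that(1,2,4) _ _ that(5,6)] by blast
  next
    case False
    then show ?thesis using separate_ker_nondom[OF that(1,2,3) assms(5) _ that(7,5,6)] by blast
  qed
  show ?thesis
    using gen[OF assms(1-4)] gen[OF assms(2,1,4,3)] ij d by blast
qed

section \<open>Classification of the congruences\<close>

lemma congD: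
  assumes "\<xi> \<in> congruences P"
  shows "(a, b) \<in> \<xi> \<Longrightarrow> a \<in> Q \<and> b \<in> Q" "a \<in> Q \<Longrightarrow> (a, a) \<in> \<xi>" "(a, b) \<in> \<xi> \<Longrightarrow> (b, a) \<in> \<xi>"
    "(a, b) \<in> \<xi> \<Longrightarrow> (b, c) \<in> \<xi> \<Longrightarrow> (a, c) \<in> \<xi>"
    "(a, b) \<in> \<xi> \<Longrightarrow> s \<in> Q \<Longrightarrow> (s \<odot> a, s \<odot> b) \<in> \<xi>" "(a, b) \<in> \<xi> \<Longrightarrow> s \<in> Q \<Longrightarrow> (a \<odot> s, b \<odot> s) \<in> \<xi>"
proof -
  have e: "equiv Q \<xi>" and m: "\<forall>a b s. (a, b) \<in> \<xi> \<longrightarrow> s \<in> Q \<longrightarrow> (s \<odot> a, s \<odot> b) \<in> \<xi> \<and> (a \<odot> s, b \<odot> s) \<in> \<xi>"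
    using assms unfolding congruences_iff by auto
  show "(a, b) \<in> \<xi> \<Longrightarrow> a \<in> Q \<and> b \<in> Q" using e by (auto simp: equiv_def)
  show "a \<in> Q \<Longrightarrow> (a, a) \<in> \<xi>" using e by (auto simp: equiv_def refl_on_def)
  show "(a, b) \<in> \<xi> \<Longrightarrow> (b, a) \<in> \<xi>" using e by (auto simp: equiv_def sym_def)
  show "(a, b) \<in> \<xi> \<Longrightarrow> (b, c) \<in> \<xi> \<Longrightarrow> (a, c) \<in> \<xi>" using e unfolding equiv_def by (meson transD)
  show "(a, b) \<in> \<xi> \<Longrightarrow> s \<in> Q \<Longrightarrow> (s \<odot> a, s \<odot> b) \<in> \<xi>" "(a, b) \<in> \<xi> \<Longrightarrow> s \<in> Q \<Longrightarrow> (a \<odot> s, b \<odot> s) \<in> \<xi>"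
    using m by blast+
qed

text \<open>The dual congruence, to which results on the upper row are applied in order to obtain
  those on the lower row.\<close>

definition flip_cong :: "pt set set rel \<Rightarrow> pt set set rel" where
  "flip_cong \<xi> = {(a, b). a \<in> Q \<and> b \<in> Q \<and> (flip a, flip b) \<in> \<xi>}"

lemma flip_cong_congruence:
  assumes "\<xi> \<in> congruences P" shows "flip_cong \<xi> \<in> congruences P"
  unfolding congruences_iff
proof (intro conjI allI impI)
  note c = congD[OF assms]
  show "equiv Q (flip_cong \<xi>)"
    unfolding flip_cong_def by (rule equivI) (auto simp: refl_on_def sym_def trans_def intro: c(2-4))
  fix a b s assume "(a, b) \<in> flip_cong \<xi>" "s \<in> Q"
  then show "(s \<odot> a, s \<odot> b) \<in> flip_cong \<xi>" "(a \<odot> s, b \<odot> s) \<in> flip_cong \<xi>"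
    using c(5,6)[of "flip a" "flip b" "flip s"] unfolding flip_cong_def by (auto simp: flip_mult)
qed

lemma flip_cong_iff: "a \<in> Q \<Longrightarrow> b \<in> Q \<Longrightarrow> (flip a, flip b) \<in> flip_cong \<xi> \<longleftrightarrow> (a, b) \<in> \<xi>"
  by (simp add: flip_cong_def)

section \<open>Congruences relating elements of different rank\<close>

definition drops :: "pt set set rel \<Rightarrow> nat \<Rightarrow> bool" where
  "drops \<xi> q \<longleftrightarrow> q \<le> n \<and> (\<exists>\<gamma>. part_rank \<gamma> < q \<and> (e q, \<gamma>) \<in> \<xi>)"

lemma drop_rank:
  assumes "\<xi> \<in> congruences P" "(a, b) \<in> \<xi>" "part_rank a = q" "part_rank b < q"
  shows "drops \<xi> q"
proof -
  note c = congD[OF assms(1)]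
  have Q: "a \<in> Q" "b \<in> Q" using c(1)[OF assms(2)] by auto
  obtain u v where uv: "u \<in> Q" "v \<in> Q" "u \<odot> a \<odot> v = e q" using rank_middle[OF Q(1)] assms(3) by metis
  have "(u \<odot> a \<odot> v, u \<odot> b \<odot> v) \<in> \<xi>" using c(5,6) assms(2) uv by blast
  then have "(e q, u \<odot> b \<odot> v) \<in> \<xi>" by (simp only: uv(3))
  moreover have "part_rank (u \<odot> b \<odot> v) < q" using rank_mult3[OF uv(1) Q(2) uv(2)] assms(4) by simp
  ultimately show ?thesis unfolding drops_def using rank_le_n[OF Q(1)] assms(3) by blast
qed

lemma drops_R:
  assumes "\<xi> \<in> congruences P" "(\<alpha>, \<beta>) \<in> \<xi>" "part_rank \<alpha> = q" "part_rank \<beta> = q" "1 \<le> q"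
    "\<alpha> \<odot> flip \<alpha> \<noteq> \<beta> \<odot> flip \<beta>"
  shows "drops \<xi> q"
proof -
  note c = congD[OF assms(1)]
  have Q: "\<alpha> \<in> Q" "\<beta> \<in> Q" using c(1)[OF assms(2)] by auto
  obtain w where w: "w \<in> Q" "(part_rank (w \<odot> \<alpha>) = q \<and> part_rank (w \<odot> \<beta>) < q) \<or> (part_rank (w \<odot> \<beta>) = q \<and> part_rank (w \<odot> \<alpha>) < q)"
    using separate[OF Q assms(3-6)] by blast
  then show ?thesis using drop_rank[OF assms(1)] c(3,5) assms(2) by blast
qed

lemma drops_L:
  assumes "\<xi> \<in> congruences P" "(\<alpha>, \<beta>) \<in> \<xi>" "part_rank \<alpha> = q" "part_rank \<beta> = q" "1 \<le> q"
    "flip \<alpha> \<odot> \<alpha> \<noteq> flip \<beta> \<odot> \<beta>"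
  shows "drops \<xi> q"
proof -
  have Q: "\<alpha> \<in> Q" "\<beta> \<in> Q" using congD(1)[OF assms(1,2)] by auto
  have "drops (flip_cong \<xi>) q"
    using drops_R[OF flip_cong_congruence[OF assms(1)], of "flip \<alpha>" "flip \<beta>"] assms(2-6) Q
    by (simp add: flip_cong_iff)
  then obtain \<gamma> where g: "q \<le> n" "part_rank \<gamma> < q" "(e q, \<gamma>) \<in> flip_cong \<xi>" unfolding drops_def by blast
  then have "(e q, flip \<gamma>) \<in> \<xi>" "\<gamma> \<in> Q" by (auto simp: flip_cong_def)
  then show ?thesis using g unfolding drops_def by (intro conjI exI[of _ "flip \<gamma>"]) auto
qed

text \<open>Equal projections let \<open>\<beta>\<close> be factored with the same outer factors as
  \<open>\<alpha>\<close>; the element in the middle lies in the local monoid at \<open>e q\<close>,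
  and its rank makes it a permutation.\<close>

lemma H_related_frame:
  assumes "\<alpha> \<in> Q" "\<beta> \<in> Q" "part_rank \<alpha> = q" "part_rank \<beta> = q"
    "\<alpha> \<odot> flip \<alpha> = \<beta> \<odot> flip \<beta>" "flip \<alpha> \<odot> \<alpha> = flip \<beta> \<odot> \<beta>"
  obtains s t u v \<sigma> where "frame q s t u v" "\<sigma> permutes {1..q}" "\<alpha> = s \<odot> e q \<odot> t" "\<beta> = s \<odot> bar n q \<sigma> \<odot> t"
proof -
  have q: "q \<le> n" using rank_le_n assms by blast
  obtain s0 t0 where st0: "s0 \<in> Q" "t0 \<in> Q" "s0 \<odot> e q \<odot> t0 = \<alpha>" using rank_factor[OF assms(1)] assms(3) by metis
  define s t where "s = s0 \<odot> e q" and "t = e q \<odot> t0"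
  obtain u v where fr: "frame q s t u v"
    using frame_exists[OF q st0(1,2) permutes_id] st0(3) assms(3) unfolding s_def t_def by metis
  have f: "s \<in> Q" "t \<in> Q" "u \<in> Q" "v \<in> Q" "s \<odot> e q = s" "e q \<odot> t = t" "e q \<odot> u = u"
    "v \<odot> e q = v" "u \<odot> s = e q" "t \<odot> v = e q" using fr by (auto simp: frame_def)
  note Q = f(1-4) e_Q[OF q] assms(1,2) flip_Q mult_closed
  have a: "\<alpha> = s \<odot> t"
  proof -
    have "s \<odot> t = s0 \<odot> (e q \<odot> e q) \<odot> t0" unfolding s_def t_def using st0(1,2) e_Q[OF q] by (simp only: mult_assoc mult_closed)
    then show ?thesis using q st0(3) by simp
  qed
  \<comment> \<open>\<open>\<alpha> \<odot> flip \<alpha>\<close> fixes \<open>\<beta>\<close> from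
    the left, so \<open>\<beta>\<close> starts with \<open>s\<close>; dually it ends with
    \<open>t\<close>.\<close>
  have b1: "\<beta> = s \<odot> (t \<odot> flip \<alpha> \<odot> \<beta>)"
  proof -
    have "\<beta> = \<alpha> \<odot> flip \<alpha> \<odot> \<beta>" unfolding assms(5) using flip_regular[OF assms(2)] by simp
    also have "\<dots> = s \<odot> t \<odot> flip \<alpha> \<odot> \<beta>" using a by simp
    finally show ?thesis using Q by (simp only: mult_assoc)
  qed
  have b2: "\<beta> = (\<beta> \<odot> flip \<alpha> \<odot> s) \<odot> t"
  proof -
    have "\<beta> \<odot> (flip \<alpha> \<odot> \<alpha>) = \<beta>" unfolding assms(6) using flip_regular[OF assms(2)] Q by (simp add: mult_assoc)
    then have "\<beta> = \<beta> \<odot> (flip \<alpha> \<odot> (s \<odot> t))" using a by simp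
    then show ?thesis using Q by (simp only: mult_assoc)
  qed
  define g where "g = u \<odot> \<beta> \<odot> v"
  have sub: "s \<odot> (u \<odot> \<beta>) = \<beta>"
  proof -
    let ?x = "t \<odot> flip \<alpha> \<odot> \<beta>"
    have "s \<odot> (u \<odot> (s \<odot> ?x)) = s \<odot> (u \<odot> s) \<odot> ?x" using Q by (simp only: mult_assoc)
    also have "\<dots> = s \<odot> ?x" using f by simp
    finally show ?thesis by (simp only: b1[symmetric])
  qed
  have bvt: "\<beta> \<odot> (v \<odot> t) = \<beta>"
  proof -
    let ?x = "\<beta> \<odot> flip \<alpha> \<odot> s"
    have "?x \<odot> t \<odot> (v \<odot> t) = ?x \<odot> ((t \<odot> v) \<odot> t)" using Q by (simp only: mult_assoc)
    also have "\<dots> = ?x \<odot> t" using f by simp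
    finally show ?thesis by (simp only: b2[symmetric])
  qed
  have sgt: "s \<odot> g \<odot> t = \<beta>"
  proof -
    have "s \<odot> g \<odot> t = s \<odot> (u \<odot> \<beta>) \<odot> (v \<odot> t)" unfolding g_def using Q by (simp only: mult_assoc)
    then show ?thesis by (simp only: sub bvt)
  qed
  have gQ: "g \<in> Q" by (simp add: g_def)
  have "e q \<odot> g \<odot> e q = (e q \<odot> u) \<odot> \<beta> \<odot> (v \<odot> e q)" unfolding g_def using Q by (simp only: mult_assoc)
  then have ege: "e q \<odot> g \<odot> e q = g" using f by (simp add: g_def)
  have "q \<le> part_rank g" using rank_mult3[OF f(1) gQ f(2)] sgt assms(4) by simp
  moreover have "part_rank g \<le> q" using rank_mult3[OF f(3) assms(2) f(4)] assms(4) g_def by simp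
  ultimately obtain \<sigma> where \<sigma>: "\<sigma> permutes {1..q}" "g = bar n q \<sigma>"
    using local_rank_q[OF q gQ ege] by (metis antisym)
  have "\<alpha> = s \<odot> e q \<odot> t" using a f by simp
  then show ?thesis using that[OF fr \<sigma>(1)] sgt \<sigma>(2) by simp
qed

section \<open>Normal subgroups read off a congruence\<close>

definition cong_perms :: "pt set set rel \<Rightarrow> nat \<Rightarrow> (nat \<Rightarrow> nat) set" where
  "cong_perms \<xi> q = {\<sigma>. \<sigma> permutes {1..q} \<and> (e q, bar n q \<sigma>) \<in> \<xi>}"

lemma cong_perms_normal:
  assumes "\<xi> \<in> congruences P" "q \<le> n" shows "normal (cong_perms \<xi> q) (sym_group q)"
proof -
  note c = congD[OF assms(1)]
  note bm = bar_mult[OF assms(2)] and bQ = bar_Q[OF assms(2)]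
  have id: "id \<in> cong_perms \<xi> q" unfolding cong_perms_def using c(2)[OF e_Q[OF assms(2)]] by (simp add: permutes_id)
  have comp: "\<sigma> \<circ> \<tau> \<in> cong_perms \<xi> q" if st: "\<sigma> \<in> cong_perms \<xi> q" "\<tau> \<in> cong_perms \<xi> q" for \<sigma> \<tau>
  proof -
    have p: "\<sigma> permutes {1..q}" "\<tau> permutes {1..q}" using st by (auto simp: cong_perms_def)
    have "(e q \<odot> bar n q \<sigma>, bar n q \<tau> \<odot> bar n q \<sigma>) \<in> \<xi>" using c(6) st(2) bQ[OF p(1)] by (auto simp: cong_perms_def)
    then have "(bar n q \<sigma>, bar n q (\<sigma> \<circ> \<tau>)) \<in> \<xi>" using e_bar[OF assms(2) p(1)] bm[OF p(2,1)] by simp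
    then show ?thesis using c(4) st(1) p permutes_compose unfolding cong_perms_def by blast
  qed
  have inv: "inv' \<sigma> \<in> cong_perms \<xi> q" if s: "\<sigma> \<in> cong_perms \<xi> q" for \<sigma>
  proof -
    have p: "\<sigma> permutes {1..q}" "inv' \<sigma> permutes {1..q}" using s permutes_inv by (auto simp: cong_perms_def)
    have "(e q \<odot> bar n q (inv' \<sigma>), bar n q \<sigma> \<odot> bar n q (inv' \<sigma>)) \<in> \<xi>" using c(6) s bQ[OF p(2)] by (auto simp: cong_perms_def)
    then have "(bar n q (inv' \<sigma>), e q) \<in> \<xi>" using e_bar[OF assms(2) p(2)] bar_inverse[OF assms(2) p(1)] by simp
    then show ?thesis using c(3) p unfolding cong_perms_def by blast
  qed
  have conj: "\<tau> \<circ> \<sigma> \<circ> inv' \<tau> \<in> cong_perms \<xi> q" if s: "\<sigma> \<in> cong_perms \<xi> q" and t: "\<tau> permutes {1..q}" for \<sigma> \<tau>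
  proof -
    have p: "\<sigma> permutes {1..q}" "inv' \<tau> permutes {1..q}" using s permutes_inv[OF t] by (auto simp: cong_perms_def)
    have "(bar n q (inv' \<tau>) \<odot> e q \<odot> bar n q \<tau>, bar n q (inv' \<tau>) \<odot> bar n q \<sigma> \<odot> bar n q \<tau>) \<in> \<xi>"
      using c(5,6) s bQ[OF p(2)] bQ[OF t] by (auto simp: cong_perms_def)
    moreover have "bar n q (inv' \<tau>) \<odot> e q \<odot> bar n q \<tau> = e q" using bar_inverse[OF assms(2) t] e_bar[OF assms(2) p(2)] by simp
    moreover have "bar n q (inv' \<tau>) \<odot> bar n q \<sigma> \<odot> bar n q \<tau> = bar n q (\<tau> \<circ> \<sigma> \<circ> inv' \<tau>)"
      using bm[OF p(2,1)] bm[OF permutes_compose[OF p(2,1)] t] by (simp add: comp_assoc)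
    ultimately show ?thesis using p t permutes_compose unfolding cong_perms_def by (simp add: permutes_compose)
  qed
  show ?thesis unfolding normal_sym_iff using id comp inv conj by (auto simp: cong_perms_def)
qed

lemma nu_cong_perms_subset:
  assumes "\<xi> \<in> congruences P" "q \<le> n" shows "nu P (bar n q ` cong_perms \<xi> q) \<subseteq> \<xi>"
proof (intro subrelI)
  note c = congD[OF assms(1)]
  fix \<alpha> \<beta> assume "(\<alpha>, \<beta>) \<in> nu P (bar n q ` cong_perms \<xi> q)"
  then obtain s t \<sigma> \<tau> where st: "s \<in> Q" "t \<in> Q" "\<sigma> \<in> cong_perms \<xi> q" "\<tau> \<in> cong_perms \<xi> q" "\<alpha> = s \<odot> bar n q \<sigma> \<odot> t" "\<beta> = s \<odot> bar n q \<tau> \<odot> t"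
    unfolding nu_iff[OF assms(2) normal_sym_nonempty(1,2)[OF cong_perms_normal[OF assms]]] by blast
  then have "(bar n q \<sigma>, bar n q \<tau>) \<in> \<xi>" unfolding cong_perms_def using c(3,4) by blast
  then show "(\<alpha>, \<beta>) \<in> \<xi>" unfolding st(5,6) using c(5,6) st(1,2) by blast
qed

text \<open>The image of a moved point \<open>i\<close> is deleted from both rows: the identity
  becomes \<open>e (p - 1)\<close>, whereas \<open>\<sigma>\<close> loses the thread that starts at
  \<open>i\<close>.\<close>

lemma drops_below:
  assumes "\<xi> \<in> congruences P" "2 \<le> p" "p \<le> n" "\<sigma> \<in> cong_perms \<xi> p" "\<sigma> \<noteq> id"
  shows "drops \<xi> (p - 1)"
proof -
  note c = congD[OF assms(1)]
  have s: "\<sigma> permutes {1..p}" "(e p, bar n p \<sigma>) \<in> \<xi>" using assms(4) by (auto simp: cong_perms_def)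
  obtain i where i: "\<sigma> i \<noteq> i" using assms(5) by (auto simp: fun_eq_iff)
  have ip: "i \<in> {1..p}" using i permutes_not_in[OF s(1)] by blast
  define i' where "i' = \<sigma> i"
  have i'p: "i' \<in> {1..p}" "i' \<noteq> i" using permutes_in_image[OF s(1)] ip i by (auto simp: i'_def)
  define q where "q = p - 1"
  have q: "q \<le> n" "1 \<le> q" using assms by (auto simp: q_def)
  \<comment> \<open>The increasing enumeration of {1..p} without \<open>i'\<close>.\<close>
  define a where "a k = (if k < i' then k else k + 1)" for k :: nat
  have ap: "a k \<in> {1..p}" "a k \<noteq> i'" if "k \<in> {1..q}" for k using that i'p by (auto simp: a_def q_def)
  have an: "a ` {1..q} \<subseteq> {1..n}" using ap(1) assms(3) by force
  have ai: "a k = a l \<longleftrightarrow> k = l" for k l by (auto simp: a_def)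
  obtain k where k: "k \<in> {1..q}" "a k = i"
  proof (cases "i < i'")
    case True then show ?thesis using that[of i] ip i'p by (auto simp: a_def q_def)
  next
    case False
    then have "i' < i" "1 \<le> i'" "i \<le> p" using ip i'p by auto
    then have "1 \<le> i - 1" "i - 1 \<le> p - 1" "\<not> i - 1 < i'" "i - 1 + 1 = i" by linarith+
    then show ?thesis using that[of "i - 1"] by (simp add: a_def q_def)
  qed
  let ?w = "sel q a"
  note ss = sat_sel[OF q(1) an]
  have 1: "?w \<odot> e p \<odot> flip ?w = e q"
  proof (rule Q_eqI)
    fix A D
    show "sat (?w \<odot> e p \<odot> flip ?w) A D = sat (e q) A D"
      unfolding sat_mult[OF mult_closed flip_Q] sat_mult[OF sel_Q e_Q[OF assms(3)]] sat_flip[OF sel_Q] ss sat_e[OF q(1)] sat_e[OF assms(3)]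
    proof
      assume r: "\<forall>k\<in>{1..q}. (k \<in> A) = (k \<in> D)"
      have "\<forall>k\<in>{1..q}. (k \<in> A) = (a k \<in> a ` (A \<inter> {1..q}))" "\<forall>k\<in>{1..q}. (k \<in> D) = (a k \<in> a ` (A \<inter> {1..q}))"
        using r ai by auto
      then show "\<exists>B. (\<exists>Ba. (\<forall>k\<in>{1..q}. (k \<in> A) = (a k \<in> Ba)) \<and> (\<forall>k\<in>{1..p}. (k \<in> Ba) = (k \<in> B))) \<and> (\<forall>k\<in>{1..q}. (k \<in> D) = (a k \<in> B))"
        by blast
    qed (use ap(1) in blast)
  qed (use q in auto)
  have bQ: "bar n p \<sigma> \<in> Q" using assms(3) s(1) by simp
  have xi: "(e q, ?w \<odot> bar n p \<sigma> \<odot> flip ?w) \<in> \<xi>" using c(5,6) s(2) 1 sel_Q flip_Q by metis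
  have im: "\<sigma> m = i' \<longleftrightarrow> m = i" for m using permutes_inj[OF s(1)] unfolding i'_def by (meson injD)
  have "sat ?w {k} {i}" unfolding ss using k ai by auto
  moreover have "sat (bar n p \<sigma>) {i} {i'}" unfolding sat_bar[OF assms(3) s(1)] using im by auto
  moreover have "sat (flip ?w) {i'} {}" unfolding sat_flip[OF sel_Q] ss using ap by auto
  ultimately have "sat (?w \<odot> bar n p \<sigma> \<odot> flip ?w) {k} {}" using bQ by (auto simp: sat_mult)
  moreover have "e q \<odot> (?w \<odot> bar n p \<sigma> \<odot> flip ?w) = ?w \<odot> bar n p \<sigma> \<odot> flip ?w"
    using e_absorb_left[OF q(1) sel_Q mult_closed e_sel[OF q(1) an], of "bar n p \<sigma>" "flip ?w"] bQ by (simp add: mult_assoc)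
  ultimately have "part_rank (?w \<odot> bar n p \<sigma> \<odot> flip ?w) < q"
    using rank_drop1[OF q(1) mult_closed] k(1) by blast
  then show ?thesis using xi q(1) unfolding drops_def q_def by blast
qed

text \<open>Without a drop in rank \<open>p\<close> a related pair is H-related, so it differs by a
  nontrivial permutation, and then the rank just below does drop. This confines such pairs to the
  rank directly above the dropping ones.\<close>

lemma nondrop_pair:
  assumes "\<xi> \<in> congruences P" "(\<alpha>, \<beta>) \<in> \<xi>" "\<alpha> \<noteq> \<beta>" "part_rank \<alpha> = p" "part_rank \<beta> \<le> p" "1 \<le> p" "\<not> drops \<xi> p"
  shows "2 \<le> p" "drops \<xi> (p - 1)" "(\<alpha>, \<beta>) \<in> nu P (bar n p ` cong_perms \<xi> p)" "cong_perms \<xi> p \<noteq> {id}"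
proof -
  note c = congD[OF assms(1)]
  have Q: "\<alpha> \<in> Q" "\<beta> \<in> Q" using c(1)[OF assms(2)] by auto
  have p: "p \<le> n" using rank_le_n[OF Q(1)] assms(4) by simp
  have rb: "part_rank \<beta> = p" using drop_rank[OF assms(1,2,4)] assms(5,7) by linarith
  have R: "\<alpha> \<odot> flip \<alpha> = \<beta> \<odot> flip \<beta>" using drops_R[OF assms(1,2,4) rb assms(6)] assms(7) by blast
  have L: "flip \<alpha> \<odot> \<alpha> = flip \<beta> \<odot> \<beta>" using drops_L[OF assms(1,2,4) rb assms(6)] assms(7) by blast
  obtain s t u v \<sigma> where f: "frame p s t u v" "\<sigma> permutes {1..p}" "\<alpha> = s \<odot> e p \<odot> t" "\<beta> = s \<odot> bar n p \<sigma> \<odot> t"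
    using H_related_frame[OF Q assms(4) rb R L] .
  have st: "s \<in> Q" "t \<in> Q" "u \<in> Q" "v \<in> Q" using f(1) by (auto simp: frame_def)
  have "(u \<odot> \<alpha> \<odot> v, u \<odot> \<beta> \<odot> v) \<in> \<xi>" using c(5,6) assms(2) st by blast
  then have "(e p, bar n p \<sigma>) \<in> \<xi>" using frame_mid[OF f(1) f(2)] frame_mid[OF f(1) permutes_id] f(3,4) by simp
  then have N: "\<sigma> \<in> cong_perms \<xi> p" using f(2) by (simp add: cong_perms_def)
  have ne: "\<sigma> \<noteq> id" using assms(3) f(3,4) by auto
  then show "2 \<le> p" using permutes_small[OF _ f(2)] by fastforce
  then show "drops \<xi> (p - 1)" using drops_below[OF assms(1) _ p N ne] by blast
  note nn = normal_sym_nonempty[OF cong_perms_normal[OF assms(1) p]]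
  show "(\<alpha>, \<beta>) \<in> nu P (bar n p ` cong_perms \<xi> p)" unfolding nu_iff[OF p nn(1,2)]
    using assms(4) rb st(1,2) N nn(3) f(3,4) by blast
  show "cong_perms \<xi> p \<noteq> {id}" using N ne by blast
qed

section \<open>Passing from a dropping rank to smaller ranks\<close>

lemma dom_or_ker_defect:
  assumes "q \<le> n" "\<delta> \<in> Q" "part_rank \<delta> < q"
  shows "(\<exists>i\<in>{1..q}. \<not> in_dom \<delta> i) \<or> (\<exists>i\<in>{1..q}. \<exists>j\<in>{1..q}. i \<noteq> j \<and> conn \<delta> (Up i) (Up j))"
proof (rule ccontr)
  assume "\<not> ?thesis"
  then have d: "\<And>i. i \<in> {1..q} \<Longrightarrow> in_dom \<delta> i"
    and k: "\<And>i j. i \<in> {1..q} \<Longrightarrow> j \<in> {1..q} \<Longrightarrow> conn \<delta> (Up i) (Up j) \<Longrightarrow> i = j" by blast+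
  obtain a b where ab: "is_reps \<delta> (part_rank \<delta>) a b" using reps_exist[OF assms(2)] .
  have "\<forall>i\<in>{1..q}. \<exists>k\<in>{1..part_rank \<delta>}. conn \<delta> (Up i) (Up (a k))"
    using d ab unfolding in_dom_def is_reps_def by blast
  then obtain f where f: "\<And>i. i \<in> {1..q} \<Longrightarrow> f i \<in> {1..part_rank \<delta>} \<and> conn \<delta> (Up i) (Up (a (f i)))"
    by metis
  have "inj_on f {1..q}"
  proof (rule inj_onI)
    fix x y assume "x \<in> {1..q}" "y \<in> {1..q}" "f x = f y"
    then show "x = y" using f[of x] f[of y] conn_trans[OF assms(2)] conn_sym k by metis
  qed
  then have "q \<le> part_rank \<delta>" using card_inj_on_le[of f "{1..q}" "{1..part_rank \<delta>}"] f by fastforce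
  then show False using assms(3) by simp
qed

text \<open>The defect of \<open>\<gamma>\<close> lives on a set \<open>X\<close> of one or two
  points. Restriction to any \<open>m\<close> points containing \<open>X\<close> preserves it; the
  last hypothesis guarantees that \<open>X\<close> fits.\<close>

lemma drops_smaller:
  assumes "\<xi> \<in> congruences P" "drops \<xi> q" "1 \<le> m" "m \<le> q"
    "2 \<le> m \<or> (\<exists>\<gamma> i. (e q, \<gamma>) \<in> \<xi> \<and> part_rank \<gamma> < q \<and> i \<in> {1..q} \<and> \<not> in_dom \<gamma> i)"
  shows "drops \<xi> m"
proof -
  note c = congD[OF assms(1)]
  have q: "q \<le> n" using assms(2) by (simp add: drops_def)
  have mn: "m \<le> n" using q assms(4) by simp
  obtain \<gamma> X where g: "(e q, \<gamma>) \<in> \<xi>" and X: "X \<subseteq> {1..q}" "card X \<le> m"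
    and X': "(\<exists>i\<in>X. \<not> in_dom \<gamma> i) \<or> (\<exists>i\<in>X. \<exists>j\<in>X. i \<noteq> j \<and> conn \<gamma> (Up i) (Up j))"
  proof (cases "\<exists>\<gamma> i. (e q, \<gamma>) \<in> \<xi> \<and> part_rank \<gamma> < q \<and> i \<in> {1..q} \<and> \<not> in_dom \<gamma> i")
    case True
    then obtain \<gamma> i where "(e q, \<gamma>) \<in> \<xi>" "i \<in> {1..q}" "\<not> in_dom \<gamma> i" by blast
    then show ?thesis using that[of \<gamma> "{i}"] assms(3) by auto
  next
    case False
    then have m2: "2 \<le> m" using assms(5) by blast
    obtain \<gamma> where gg: "part_rank \<gamma> < q" "(e q, \<gamma>) \<in> \<xi>" using assms(2) unfolding drops_def by blast
    have "\<gamma> \<in> Q" using c(1)[OF gg(2)] by simp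
    then obtain i j where "i \<in> {1..q}" "j \<in> {1..q}" "i \<noteq> j" "conn \<gamma> (Up i) (Up j)"
      using dom_or_ker_defect[OF q _ gg(1)] False gg by blast
    then show ?thesis using that[of \<gamma> "{i, j}"] m2 gg by auto
  qed
  have gQ: "\<gamma> \<in> Q" using c(1)[OF g] by simp
  have "m \<le> card {1..q}" using assms(4) by simp
  then obtain Y where Y: "X \<subseteq> Y" "Y \<subseteq> {1..q}" "card Y = m"
    using exists_subset_between[OF X(2) _ X(1)] by auto
  have "finite Y" using Y(2) finite_subset by auto
  then obtain a where a: "bij_betw a {1..m} Y" using ex_bij_betw_nat_finite_1 Y(3) by metis
  have aY: "a ` {1..m} = Y" using a by (rule bij_betw_imp_surj_on)
  have an: "a ` {1..m} \<subseteq> {1..n}" using aY Y(2) q by auto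
  have ai: "\<And>k l. k \<in> {1..m} \<Longrightarrow> l \<in> {1..m} \<Longrightarrow> a k = a l \<Longrightarrow> k = l"
    using a unfolding bij_betw_def by (meson inj_onD)
  have aq: "a k \<in> {1..q}" if "k \<in> {1..m}" for k using that aY Y(2) by blast
  let ?w = "sel m a"
  note ss = sat_sel[OF mn an]
  have 1: "?w \<odot> e q \<odot> flip ?w = e m"
  proof (rule Q_eqI)
    fix A D
    show "sat (?w \<odot> e q \<odot> flip ?w) A D = sat (e m) A D"
      unfolding sat_mult[OF mult_closed flip_Q] sat_mult[OF sel_Q e_Q[OF q]] sat_flip[OF sel_Q] ss sat_e[OF q] sat_e[OF mn]
    proof
      assume r: "\<forall>k\<in>{1..m}. (k \<in> A) = (k \<in> D)"
      have "(k \<in> A) = (a k \<in> a ` (A \<inter> {1..m}))" if "k \<in> {1..m}" for k using that ai by blast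
      moreover from this have "(k \<in> D) = (a k \<in> a ` (A \<inter> {1..m}))" if "k \<in> {1..m}" for k using that r by blast
      ultimately have "\<forall>k\<in>{1..m}. (k \<in> A) = (a k \<in> a ` (A \<inter> {1..m}))" "\<forall>k\<in>{1..m}. (k \<in> D) = (a k \<in> a ` (A \<inter> {1..m}))"
        by blast+
      then show "\<exists>B. (\<exists>Ba. (\<forall>k\<in>{1..m}. (k \<in> A) = (a k \<in> Ba)) \<and> (\<forall>k\<in>{1..q}. (k \<in> Ba) = (k \<in> B))) \<and> (\<forall>k\<in>{1..m}. (k \<in> D) = (a k \<in> B))"
        by blast
    qed (use aq in blast)
  qed (use mn in auto)
  have xi: "(e m, ?w \<odot> \<gamma> \<odot> flip ?w) \<in> \<xi>" using c(5,6) g 1 sel_Q flip_Q by metis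
  have em: "e m \<odot> (?w \<odot> \<gamma> \<odot> flip ?w) = ?w \<odot> \<gamma> \<odot> flip ?w"
    using e_absorb_left[OF mn sel_Q mult_closed e_sel[OF mn an], of \<gamma> "flip ?w"] gQ by (simp add: mult_assoc)
  have "part_rank (?w \<odot> \<gamma> \<odot> flip ?w) < m" using X'
  proof (elim disjE bexE conjE)
    fix i assume i: "i \<in> X" "\<not> in_dom \<gamma> i"
    then obtain k where k: "k \<in> {1..m}" "a k = i" using Y(1) aY by blast
    let ?B = "{j. conn \<gamma> (Up i) (Up j)}"
    have "sat ?w {k. a k \<in> ?B} ?B" unfolding ss by simp
    moreover have "sat (flip ?w) {} {}" by (rule sat_const) simp
    ultimately have "sat (?w \<odot> \<gamma> \<odot> flip ?w) {k. a k \<in> ?B} {}" using upper_class[OF gQ i(2)] gQ by (auto simp: sat_mult)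
    moreover have "a k \<in> {1..n}" using k(1) an by blast
    then have "k \<in> {k. a k \<in> ?B}" using conn_refl[OF gQ, of "Up i"] k(2) by simp
    ultimately show ?thesis using rank_drop1[OF mn mult_closed em] k(1) by blast
  next
    fix i j assume ij: "i \<in> X" "j \<in> X" "i \<noteq> j" "conn \<gamma> (Up i) (Up j)"
    then obtain k l where kl: "k \<in> {1..m}" "a k = i" "l \<in> {1..m}" "a l = j" using Y(1) aY by blast
    have "k \<in> A \<longleftrightarrow> l \<in> A" if s: "sat (?w \<odot> \<gamma> \<odot> flip ?w) A D" for A D
    proof -
      obtain B C where B: "\<forall>k\<in>{1..m}. (k \<in> A) = (a k \<in> B)" "sat \<gamma> B C"
        using s gQ unfolding sat_mult[OF mult_closed flip_Q] sat_mult[OF sel_Q gQ] ss by blast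
      then show ?thesis using kl sat_conn(2)[OF B(2) ij(4)] by metis
    qed
    then show ?thesis using rank_drop2[OF mn mult_closed em, of k l] kl ij(3) by blast
  qed
  then show ?thesis using xi mn unfolding drops_def by blast
qed

text \<open>If only kernel defects are available, the roles are exchanged: \<open>\<gamma>\<close>
  joins an upper point \<open>i'\<close> to a lower point \<open>k\<close> with k \<noteq> i'.
  Restricted to these two points, \<open>\<gamma>\<close> becomes \<open>e 1\<close>, while
  \<open>e q\<close> falls to rank 0.\<close>

lemma drops_one:
  assumes "\<xi> \<in> congruences P" "drops \<xi> q" "2 \<le> q" shows "drops \<xi> 1"
proof (cases "\<exists>\<gamma> i. (e q, \<gamma>) \<in> \<xi> \<and> part_rank \<gamma> < q \<and> i \<in> {1..q} \<and> \<not> in_dom \<gamma> i")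
  case True
  then show ?thesis using drops_smaller[OF assms(1,2), of 1] assms(3) by auto
next
  case False
  note c = congD[OF assms(1)]
  have q: "q \<le> n" using assms(2) by (simp add: drops_def)
  have n1: "1 \<le> n" using assms(3) q by simp
  obtain \<gamma> where gg: "part_rank \<gamma> < q" "(e q, \<gamma>) \<in> \<xi>" using assms(2) unfolding drops_def by blast
  have gQ: "\<gamma> \<in> Q" using c(1)[OF gg(2)] by simp
  obtain i j where ij: "i \<in> {1..q}" "j \<in> {1..q}" "i \<noteq> j" "conn \<gamma> (Up i) (Up j)"
    using dom_or_ker_defect[OF q gQ gg(1)] False gg by blast
  have "in_dom \<gamma> i" using False gg ij by blast
  then obtain k where k: "conn \<gamma> (Up i) (Lo k)" unfolding in_dom_def by blast
  have kn: "k \<in> {1..n}" using conn_points[OF gQ k] by simp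
  \<comment> \<open>Both \<open>i\<close> and \<open>j\<close> are joined to the lower point
    \<open>k\<close>, and at least one of them differs from \<open>k\<close>.\<close>
  obtain i' where i': "i' \<in> {1..q}" "i' \<noteq> k" "conn \<gamma> (Up i') (Lo k)"
    using ij k conn_trans[OF gQ conn_sym[OF ij(4)] k] by metis
  let ?w = "sel 1 (\<lambda>_. i')" and ?v = "flip (sel 1 (\<lambda>_. k))"
  have an: "(\<lambda>_. i') ` {1..1} \<subseteq> {1..n}" "(\<lambda>_. k) ` {1..1} \<subseteq> {1..n}" using i' q kn by auto
  have sw: "sat ?w A B \<longleftrightarrow> (1 \<in> A \<longleftrightarrow> i' \<in> B)" for A B using sat_sel[OF n1 an(1)] by simp
  have sv: "sat ?v A B \<longleftrightarrow> (1 \<in> B \<longleftrightarrow> k \<in> A)" for A B using sat_sel[OF n1 an(2)] sat_flip[OF sel_Q] by simp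
  have "sat (?w \<odot> e q \<odot> ?v) {1} {}"
    unfolding sat_mult[OF mult_closed flip_Q] sat_mult[OF sel_Q e_Q[OF q]] sw sv sat_e[OF q]
    using i' by (intro exI[of _ "{i'}"] conjI) auto
  then have 0: "part_rank (?w \<odot> e q \<odot> ?v) < 1"
    using rank_drop1[OF n1 mult_closed, of "?w \<odot> e q" ?v "{1}" 1]
      e_absorb_left[OF n1 sel_Q mult_closed e_sel[OF n1 an(1)], of "e q" ?v] q by (simp add: mult_assoc)
  have "?w \<odot> \<gamma> \<odot> ?v = e 1"
  proof (rule Q_eqI)
    fix A D
    show "sat (?w \<odot> \<gamma> \<odot> ?v) A D \<longleftrightarrow> sat (e 1) A D"
      unfolding sat_mult[OF mult_closed flip_Q] sat_mult[OF sel_Q gQ] sw sv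
    proof
      assume "\<exists>B. (\<exists>Ba. (1 \<in> A) = (i' \<in> Ba) \<and> sat \<gamma> Ba B) \<and> (1 \<in> D) = (k \<in> B)"
      then show "sat (e 1) A D" using sat_conn(1)[OF _ i'(3)] by (auto simp: sat_e[OF n1])
    next
      assume "sat (e 1) A D"
      then have "1 \<in> A \<longleftrightarrow> 1 \<in> D" by (simp add: sat_e[OF n1])
      then show "\<exists>B. (\<exists>Ba. (1 \<in> A) = (i' \<in> Ba) \<and> sat \<gamma> Ba B) \<and> (1 \<in> D) = (k \<in> B)"
        using sat_const[OF gQ] by (cases "1 \<in> A") auto
    qed
  qed (use n1 in auto)
  then have "part_rank (?w \<odot> \<gamma> \<odot> ?v) = 1" using n1 by simp
  moreover have "(?w \<odot> \<gamma> \<odot> ?v, ?w \<odot> e q \<odot> ?v) \<in> \<xi>" using c(3,5,6) gg(2) sel_Q flip_Q by blast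
  ultimately show ?thesis using drop_rank[OF assms(1)] 0 by blast
qed

text \<open>Multiplication by \<open>e 1\<close> on both sides turns the element of rank 0 related
  to \<open>e 1\<close> into \<open>e 0\<close>. Replacing \<open>e 1\<close> by \<open>e 0\<close>
  in a factorization of \<open>\<alpha>\<close> then produces its retraction.\<close>

lemma drops_1_hat:
  assumes "\<xi> \<in> congruences P" "drops \<xi> 1" "\<alpha> \<in> I 1" shows "(\<alpha>, \<alpha> \<odot> e 0 \<odot> \<alpha>) \<in> \<xi>"
proof -
  note c = congD[OF assms(1)]
  obtain \<gamma> where g: "1 \<le> n" "part_rank \<gamma> < 1" "(e 1, \<gamma>) \<in> \<xi>" using assms(2) unfolding drops_def by blast
  have gQ: "\<gamma> \<in> Q" using c(1)[OF g(3)] by simp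
  have e1: "e 1 \<in> Q" using g(1) by simp
  have g0: "\<gamma> \<in> I 0" using gQ g(2) by (simp add: I_iff)
  have "e 1 \<odot> \<gamma> \<odot> e 1 = e 1 \<odot> (\<gamma> \<odot> e 0 \<odot> \<gamma>) \<odot> e 1" using rank0_hat[OF g0] by simp
  also have "\<dots> = (e 1 \<odot> \<gamma> \<odot> e 0) \<odot> \<gamma> \<odot> e 1" using gQ e1 by (simp add: mult_assoc)
  also have "\<dots> = e 0" using e1_e0[OF g(1) gQ] by simp
  finally have "(e 1 \<odot> e 1 \<odot> e 1, e 0) \<in> \<xi>" using c(5,6) g(3) e1 by metis
  then have e10: "(e 1, e 0) \<in> \<xi>" using g(1) by simp
  obtain s t where st: "s \<in> Q" "t \<in> Q" "\<alpha> = s \<odot> e 1 \<odot> t"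
    using rank_le_via_e[of \<alpha> 1] assms(3) g(1) by (auto simp: I_iff)
  have "\<alpha> \<odot> e 0 \<odot> \<alpha> = s \<odot> (e 1 \<odot> t \<odot> e 0) \<odot> (s \<odot> e 1) \<odot> t" using st e1 by (simp add: mult_assoc)
  also have "\<dots> = s \<odot> (e 0 \<odot> s \<odot> e 1) \<odot> t" using e1_e0[OF g(1) st(2)] st e1 by (simp add: mult_assoc)
  also have "\<dots> = s \<odot> e 0 \<odot> t" using e1_e0[OF g(1) st(1)] by simp
  finally show ?thesis using c(5,6) e10 st by metis
qed

section \<open>Collapse of the upper and lower kernels\<close>

definition zU :: "(nat \<times> nat) set \<Rightarrow> pt set set" where
  "zU E = gen n ((\<lambda>(c, d). (Up c, Up d)) ` E)"

lemma sat_zU: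
  assumes "E \<subseteq> {1..n} \<times> {1..n}" shows "sat (zU E) A B \<longleftrightarrow> (\<forall>(c, d)\<in>E. c \<in> A \<longleftrightarrow> d \<in> A)"
proof -
  have "(\<lambda>(c, d). (Up c, Up d)) ` E \<subseteq> points n \<times> points n" using assms by auto
  then show ?thesis unfolding zU_def by (subst sat_gen) (auto simp: case_prod_unfold)
qed

lemma zU_Q [simp]: "zU E \<in> Q"
  by (simp add: zU_def)

lemma sat_mult_e0: "\<alpha> \<in> Q \<Longrightarrow> sat (\<alpha> \<odot> e 0) A B \<longleftrightarrow> (\<forall>i j. conn \<alpha> (Up i) (Up j) \<longrightarrow> i \<in> A \<longrightarrow> j \<in> A)"
proof -
  assume a: "\<alpha> \<in> Q"
  have "sat (\<alpha> \<odot> e 0) A B \<longleftrightarrow> (\<exists>C. sat \<alpha> A C)" using a by (simp add: sat_mult)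
  also have "\<dots> \<longleftrightarrow> sat (\<alpha> \<odot> flip \<alpha>) A A" using a by (simp add: sat_mult sat_flip)
  also have "\<dots> \<longleftrightarrow> (\<forall>i j. conn \<alpha> (Up i) (Up j) \<longrightarrow> i \<in> A \<longrightarrow> j \<in> A)" using sat_mult_flip[OF a] by blast
  finally show ?thesis .
qed

text \<open>A connection present in \<open>\<alpha>\<close> and absent from \<open>\<beta>\<close>
  can be moved to any two upper points \<open>k\<close> and \<open>l\<close>, which relates the
  element joining just these two to \<open>e 0\<close>. Every upper kernel arises by adding such
  connections one at a time.\<close>

lemma kernels_collapse:
  assumes "\<xi> \<in> congruences P" "(\<alpha>, \<beta>) \<in> \<xi>" "conn \<alpha> (Up i) (Up j)" "\<not> conn \<beta> (Up i) (Up j)" "\<gamma> \<in> Q"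
  shows "(\<gamma> \<odot> e 0, e 0) \<in> \<xi>"
proof -
  note c = congD[OF assms(1)]
  have Q: "\<alpha> \<in> Q" "\<beta> \<in> Q" using c(1)[OF assms(2)] by auto
  have ij: "i \<in> {1..n}" "j \<in> {1..n}" using conn_points[OF Q(1) assms(3)] by auto
  have single: "(zU {(k, l)}, e 0) \<in> \<xi>" if kl: "k \<in> {1..n}" "l \<in> {1..n}" for k l
  proof (cases "k = l")
    case True
    have "zU {(k, l)} = e 0" by (rule Q_eqI) (use kl True in \<open>auto simp: sat_zU\<close>)
    then show ?thesis using c(2)[of "e 0"] by simp
  next
    case False
    \<comment> \<open>\<open>w\<close> leads \<open>k\<close> to \<open>i\<close> and
      \<open>l\<close> to \<open>j\<close>: through \<open>\<alpha>\<close> they become joined,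
      through \<open>\<beta>\<close> they stay independent.\<close>
    define w where "w = gen n {(Up k, Lo i), (Up l, Lo j)}"
    have w: "sat w A B \<longleftrightarrow> (k \<in> A \<longleftrightarrow> i \<in> B) \<and> (l \<in> A \<longleftrightarrow> j \<in> B)" for A B
      unfolding w_def by (subst sat_gen) (use ij kl in auto)
    have wQ: "w \<in> Q" by (simp add: w_def)
    have "w \<odot> (\<alpha> \<odot> e 0) = zU {(k, l)}"
    proof (rule Q_eqI)
      fix A D
      have "sat (w \<odot> (\<alpha> \<odot> e 0)) A D \<longleftrightarrow> (\<exists>B. (k \<in> A \<longleftrightarrow> i \<in> B) \<and> (l \<in> A \<longleftrightarrow> j \<in> B) \<and>
          (\<forall>i j. conn \<alpha> (Up i) (Up j) \<longrightarrow> i \<in> B \<longrightarrow> j \<in> B))"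
        unfolding sat_mult[OF wQ mult_closed] w sat_mult_e0[OF Q(1)] by blast
      also have "\<dots> \<longleftrightarrow> (k \<in> A \<longleftrightarrow> l \<in> A)"
      proof
        assume "k \<in> A \<longleftrightarrow> l \<in> A"
        then show "\<exists>B. (k \<in> A \<longleftrightarrow> i \<in> B) \<and> (l \<in> A \<longleftrightarrow> j \<in> B) \<and> (\<forall>i j. conn \<alpha> (Up i) (Up j) \<longrightarrow> i \<in> B \<longrightarrow> j \<in> B)"
          by (intro exI[of _ "if k \<in> A then UNIV else {}"]) auto
      qed (use assms(3) conn_sym in blast)
      also have "\<dots> \<longleftrightarrow> sat (zU {(k, l)}) A D" using kl by (simp add: sat_zU)
      finally show "sat (w \<odot> (\<alpha> \<odot> e 0)) A D \<longleftrightarrow> sat (zU {(k, l)}) A D" .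
    qed auto
    moreover have "w \<odot> (\<beta> \<odot> e 0) = e 0"
    proof (rule Q_eqI)
      fix A D
      let ?K = "{m. conn \<beta> (Up i) (Up m)}"
      have K: "i \<in> ?K" "j \<notin> ?K" using assms(4) conn_refl[OF Q(2), of "Up i"] ij by auto
      have K1: "x \<in> ?K \<longleftrightarrow> y \<in> ?K" if "conn \<beta> (Up x) (Up y)" for x y
        using that conn_trans[OF Q(2)] conn_sym by blast
      have "\<exists>B. (k \<in> A \<longleftrightarrow> i \<in> B) \<and> (l \<in> A \<longleftrightarrow> j \<in> B) \<and> (\<forall>i j. conn \<beta> (Up i) (Up j) \<longrightarrow> i \<in> B \<longrightarrow> j \<in> B)"
      \<comment> \<open>One witness for each of the four labellings of \<open>k\<close> and
        \<open>l\<close>; the class of \<open>i\<close> in \<open>\<beta>\<close> separates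
        \<open>i\<close> from \<open>j\<close>.\<close>
      proof (intro exI[of _ "if k \<in> A then (if l \<in> A then UNIV else ?K) else (if l \<in> A then - ?K else {})"] conjI allI impI)
        fix x y assume "conn \<beta> (Up x) (Up y)" "x \<in> (if k \<in> A then (if l \<in> A then UNIV else ?K) else (if l \<in> A then - ?K else {}))"
        then show "y \<in> (if k \<in> A then (if l \<in> A then UNIV else ?K) else (if l \<in> A then - ?K else {}))"
          using K1[of x y] by (auto split: if_splits)
      qed (use K in auto)
      then show "sat (w \<odot> (\<beta> \<odot> e 0)) A D \<longleftrightarrow> sat (e 0) A D"
        unfolding sat_mult[OF wQ mult_closed] w sat_mult_e0[OF Q(2)] conj_assoc by (simp only: sat_e0)
    qed auto
    moreover have "(w \<odot> (\<alpha> \<odot> e 0), w \<odot> (\<beta> \<odot> e 0)) \<in> \<xi>" using c(5,6) assms(2) wQ e_Q[OF le0] by blast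
    ultimately show ?thesis by simp
  qed
  define z where "z = e 0"
  have all: "(zU E, z) \<in> \<xi>" if "finite E" "E \<subseteq> {1..n} \<times> {1..n}" for E
    using that
  proof (induction E rule: finite_induct)
    case empty
    have "zU {} = e 0" by (rule Q_eqI) (auto simp: sat_zU)
    then show ?case using c(2)[OF e_Q[OF le0]] by (simp only: z_def)
  next
    case (insert p E)
    obtain k l where p: "p = (k, l)" by (cases p)
    then have kl: "k \<in> {1..n}" "l \<in> {1..n}" and E: "E \<subseteq> {1..n} \<times> {1..n}" using insert.prems by auto
    \<comment> \<open>The identity with one more connection, between \<open>k\<close> and
      \<open>l\<close>: multiplying by it adds this pair to \<open>E\<close>.\<close>
    define w where "w = gen n (insert (Up k, Up l) ((\<lambda>m. (Up m, Lo m)) ` {1..n}))"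
    have sw: "sat w A B \<longleftrightarrow> (k \<in> A \<longleftrightarrow> l \<in> A) \<and> (\<forall>m\<in>{1..n}. m \<in> A \<longleftrightarrow> m \<in> B)" for A B
    proof -
      have "insert (Up k, Up l) ((\<lambda>m. (Up m, Lo m)) ` {1..n}) \<subseteq> points n \<times> points n" using kl by auto
      then show ?thesis unfolding w_def by (subst sat_gen) auto
    qed
    have wQ: "w \<in> Q" by (simp add: w_def)
    have inE: "(\<forall>(c, d)\<in>E. c \<in> A \<longleftrightarrow> d \<in> A) \<longleftrightarrow> (\<forall>(c, d)\<in>E. c \<in> B \<longleftrightarrow> d \<in> B)"
      if AB: "\<forall>m\<in>{1..n}. m \<in> A \<longleftrightarrow> m \<in> B" for A B
    proof (rule ball_cong[OF refl])
      fix x assume "x \<in> E"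
      then show "(case x of (c, d) \<Rightarrow> c \<in> A \<longleftrightarrow> d \<in> A) \<longleftrightarrow> (case x of (c, d) \<Rightarrow> c \<in> B \<longleftrightarrow> d \<in> B)"
        using AB E by (cases x) auto
    qed
    have ins: "sat (zU (insert p E)) A D \<longleftrightarrow> (k \<in> A \<longleftrightarrow> l \<in> A) \<and> (\<forall>(c, d)\<in>E. c \<in> A \<longleftrightarrow> d \<in> A)" for A D
      unfolding sat_zU[OF insert.prems] by (simp add: p)
    have "w \<odot> zU E = zU (insert p E)"
    proof (rule Q_eqI)
      fix A D
      show "sat (w \<odot> zU E) A D \<longleftrightarrow> sat (zU (insert p E)) A D"
        unfolding sat_mult[OF wQ zU_Q] sw sat_zU[OF E] ins using inE by blast
    qed auto
    moreover have "w \<odot> e 0 = zU {(k, l)}"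
    proof (rule Q_eqI)
      fix A D
      have "sat (zU {(k, l)}) A D \<longleftrightarrow> (k \<in> A \<longleftrightarrow> l \<in> A)" using kl by (simp add: sat_zU)
      then show "sat (w \<odot> e 0) A D \<longleftrightarrow> sat (zU {(k, l)}) A D"
        unfolding sat_mult[OF wQ e_Q[OF le0]] sw using sat_e0 by blast
    qed auto
    ultimately have "(zU (insert p E), zU {(k, l)}) \<in> \<xi>" using c(5)[OF insert.IH[OF E] wQ] by (simp add: z_def)
    then show ?case using c(4) single[OF kl] unfolding z_def by blast
  qed
  define E where "E = {(k, l). conn \<gamma> (Up k) (Up l)}"
  have E: "E \<subseteq> {1..n} \<times> {1..n}" unfolding E_def using conn_points[OF assms(5)] in_points(1) by blast
  then have "finite E" using finite_subset by blast
  have "\<gamma> \<odot> e 0 = zU E"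
  proof (rule Q_eqI)
    fix A B
    show "sat (\<gamma> \<odot> e 0) A B \<longleftrightarrow> sat (zU E) A B"
      unfolding sat_mult_e0[OF assms(5)] sat_zU[OF E] using conn_sym unfolding E_def by blast
  qed auto
  then show ?thesis using all[OF \<open>finite E\<close> E] by (simp add: z_def)
qed

lemma left_collapse:
  assumes "\<xi> \<in> congruences P" "(\<alpha>, \<beta>) \<in> \<xi>" "\<alpha> \<odot> e 0 \<noteq> \<beta> \<odot> e 0" "\<gamma> \<in> Q"
  shows "(\<gamma> \<odot> e 0, e 0) \<in> \<xi>"
proof -
  note c = congD[OF assms(1)]
  have Q: "\<alpha> \<in> Q" "\<beta> \<in> Q" using c(1)[OF assms(2)] by auto
  have "\<exists>i j. conn \<alpha> (Up i) (Up j) \<noteq> conn \<beta> (Up i) (Up j)"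
  proof (rule ccontr)
    assume "\<not> ?thesis"
    then have "\<alpha> \<odot> e 0 = \<beta> \<odot> e 0" by (intro Q_eqI) (auto simp: sat_mult_e0[OF Q(1)] sat_mult_e0[OF Q(2)])
    then show False using assms(3) by simp
  qed
  then show ?thesis
    using kernels_collapse[OF assms(1,2) _ _ assms(4)] kernels_collapse[OF assms(1) c(3)[OF assms(2)] _ _ assms(4)] by blast
qed

lemma right_collapse:
  assumes "\<xi> \<in> congruences P" "(\<alpha>, \<beta>) \<in> \<xi>" "e 0 \<odot> \<alpha> \<noteq> e 0 \<odot> \<beta>" "\<gamma> \<in> Q"
  shows "(e 0 \<odot> \<gamma>, e 0) \<in> \<xi>"
proof -
  have Q: "\<alpha> \<in> Q" "\<beta> \<in> Q" using congD(1)[OF assms(1,2)] by auto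
  have f: "flip x \<odot> e 0 = flip (e 0 \<odot> x)" if "x \<in> Q" for x using that by (simp add: flip_mult)
  have "flip (e 0 \<odot> \<alpha>) \<noteq> flip (e 0 \<odot> \<beta>)" using assms(3) by (metis flip_flip mult_closed)
  then have "flip \<alpha> \<odot> e 0 \<noteq> flip \<beta> \<odot> e 0" using f Q by simp
  then have "(flip \<gamma> \<odot> e 0, e 0) \<in> flip_cong \<xi>"
    using left_collapse[OF flip_cong_congruence[OF assms(1)], of "flip \<alpha>" "flip \<beta>" "flip \<gamma>"] assms(2) Q
    by (simp add: flip_cong_iff)
  then have "(flip (e 0 \<odot> \<gamma>), flip (e 0)) \<in> flip_cong \<xi>" using f[OF assms(4)] by simp
  then show ?thesis using flip_cong_iff[OF mult_closed e_Q[OF le0]] by simp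
qed

text \<open>An element \<open>z\<close> joining 1 and 2 is placed behind both sides:
  \<open>\<gamma>\<close>, of rank at most 1, absorbs it next to \<open>e 0\<close>, while
  \<open>e 2\<close> keeps it. This relates two elements with different upper kernels.\<close>

lemma rank2_left_collapse:
  assumes "\<xi> \<in> congruences P" "2 \<le> n" "(e 2, \<gamma>) \<in> \<xi>" "part_rank \<gamma> < 2" "x \<in> Q"
  shows "(x \<odot> e 0, e 0) \<in> \<xi>"
proof -
  note c = congD[OF assms(1)]
  have gQ: "\<gamma> \<in> Q" using c(1)[OF assms(3)] by simp
  have n1: "1 \<le> n" using assms(2) by simp
  have g1: "\<gamma> \<in> I 1" using gQ assms(4) by (simp add: I_iff)
  define z where "z = zU {(1, 2)}"
  have zQ: "z \<in> Q" by (simp add: z_def)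
  have "(e 2 \<odot> z \<odot> e 0, \<gamma> \<odot> z \<odot> e 0) \<in> \<xi>" using c(6) assms(3) zQ e_Q[OF le0] by blast
  then have 1: "(e 2 \<odot> z \<odot> e 0, \<gamma> \<odot> e 0) \<in> \<xi>" using absorb_e0(1)[OF n1 g1 zQ] by simp
  have "(e 2 \<odot> e 0, \<gamma> \<odot> e 0) \<in> \<xi>" using c(6) assms(3) e_Q[OF le0] by blast
  then have "(e 0, \<gamma> \<odot> e 0) \<in> \<xi>" using assms(2) by (simp add: e_mult_e)
  then have 2: "(e 2 \<odot> z \<odot> e 0, e 0) \<in> \<xi>" using 1 c(3,4) by blast
  have "{1..2::nat} = {1, 2}" by auto
  then have "\<not> sat (e 2 \<odot> z \<odot> e 0 \<odot> e 0) {1} {}"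
    using assms(2) zQ by (auto simp: sat_mult sat_e z_def sat_zU)
  then have "e 2 \<odot> z \<odot> e 0 \<odot> e 0 \<noteq> e 0 \<odot> e 0" by (metis e_e le0 sat_e0)
  then show ?thesis using left_collapse[OF assms(1) 2] assms(5) by blast
qed

lemma rank2_right_collapse:
  assumes "\<xi> \<in> congruences P" "2 \<le> n" "(e 2, \<gamma>) \<in> \<xi>" "part_rank \<gamma> < 2" "x \<in> Q"
  shows "(e 0 \<odot> x, e 0) \<in> \<xi>"
proof -
  have gQ: "\<gamma> \<in> Q" using congD(1)[OF assms(1,3)] by simp
  have "(e 2, flip \<gamma>) \<in> flip_cong \<xi>"
    using flip_cong_iff[OF e_Q[OF assms(2)] gQ] assms(2,3) by simp
  then have "(flip x \<odot> e 0, e 0) \<in> flip_cong \<xi>"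
    using rank2_left_collapse[OF flip_cong_congruence[OF assms(1)] assms(2), of "flip \<gamma>"] assms(4) gQ by simp
  then have "(flip (e 0 \<odot> x), flip (e 0)) \<in> flip_cong \<xi>" using assms(5) by (simp add: flip_mult)
  then show ?thesis using flip_cong_iff[OF mult_closed e_Q[OF le0]] by simp
qed

lemma hat_split:
  assumes "\<xi> \<in> congruences P" "x \<in> Q" "(x \<odot> e 0, y) \<in> \<xi>" "(e 0 \<odot> x, z) \<in> \<xi>"
  shows "(x \<odot> e 0 \<odot> x, y \<odot> z) \<in> \<xi>"
proof -
  note c = congD[OF assms(1)]
  have Q: "y \<in> Q" "z \<in> Q" using c(1) assms(3,4) by blast+
  have "(x \<odot> e 0 \<odot> (e 0 \<odot> x), y \<odot> (e 0 \<odot> x)) \<in> \<xi>" using c(6)[OF assms(3)] by simp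
  moreover have "(y \<odot> (e 0 \<odot> x), y \<odot> z) \<in> \<xi>" using c(5)[OF assms(4) Q(1)] .
  moreover have "x \<odot> e 0 \<odot> (e 0 \<odot> x) = x \<odot> (e 0 \<odot> e 0) \<odot> x" using assms(2) e_Q[OF le0] by (simp only: mult_assoc mult_closed)
  ultimately show ?thesis using c(4) by simp
qed

text \<open>In rank 1 every element is related to its retraction, whose upper and lower kernels
  collapse separately. Higher ranks follow by induction, since each \<open>e m\<close> is related to
  an element of smaller rank.\<close>

lemma drops_collapse:
  assumes "\<xi> \<in> congruences P" "drops \<xi> q" "2 \<le> q"
  shows "x \<in> I q \<Longrightarrow> (x, e 0) \<in> \<xi>"
proof -
  note c = congD[OF assms(1)]
  have q: "q \<le> n" using assms(2) by (simp add: drops_def)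
  have n2: "2 \<le> n" using q assms(3) by simp
  have dr: "drops \<xi> m" if "2 \<le> m" "m \<le> q" for m using drops_smaller[OF assms(1,2) _ that(2)] that by simp
  define z where "z = e 0"
  have cl: "\<forall>x\<in>I m. (x, z) \<in> \<xi>" if "1 \<le> m" "m \<le> q" for m
    using that
  proof (induction m rule: nat_induct_at_least)
    case base
    obtain \<gamma> where g: "part_rank \<gamma> < 2" "(e 2, \<gamma>) \<in> \<xi>" using dr[of 2] assms(3) unfolding drops_def by auto
    show ?case
    proof
      fix x assume x: "x \<in> I 1"
      then have xQ: "x \<in> Q" by (simp add: I_iff)
      have "(x \<odot> e 0 \<odot> x, e 0 \<odot> e 0) \<in> \<xi>"
        using hat_split[OF assms(1) xQ rank2_left_collapse[OF assms(1) n2 g(2,1) xQ] rank2_right_collapse[OF assms(1) n2 g(2,1) xQ]] .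
      then show "(x, z) \<in> \<xi>" using drops_1_hat[OF assms(1) drops_one[OF assms] x] c(4) by (simp add: z_def)
    qed
  next
    case (Suc m)
    obtain \<gamma> where g: "part_rank \<gamma> < Suc m" "(e (Suc m), \<gamma>) \<in> \<xi>" using dr[of "Suc m"] Suc unfolding drops_def by auto
    have gQ: "\<gamma> \<in> Q" using c(1)[OF g(2)] by simp
    have IH: "\<forall>x\<in>I m. (x, z) \<in> \<xi>" using Suc by simp
    show ?case
    proof
      fix x assume x: "x \<in> I (Suc m)"
      then obtain s t where st: "s \<in> Q" "t \<in> Q" "x = s \<odot> e (Suc m) \<odot> t"
        using rank_le_via_e[of x "Suc m"] Suc.prems q by (auto simp: I_iff)
      have "(x, s \<odot> \<gamma> \<odot> t) \<in> \<xi>" unfolding st(3) using c(5,6) g(2) st(1,2) by blast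
      moreover have "s \<odot> \<gamma> \<odot> t \<in> I m" using rank_mult3[OF st(1) gQ st(2)] g(1) by (simp add: I_iff)
      ultimately show "(x, z) \<in> \<xi>" using IH c(4) by blast
    qed
  qed
  have "1 \<le> q" using assms(3) by linarith
  then have "\<forall>x\<in>I q. (x, z) \<in> \<xi>" using cl by blast
  then show "x \<in> I q \<Longrightarrow> (x, e 0) \<in> \<xi>" by (simp add: z_def)
qed

section \<open>The two cases of the classification\<close>

lemma classify_high:
  assumes \<xi>: "\<xi> \<in> congruences P" and "drops \<xi> q0" "2 \<le> q0"
  obtains q where "2 \<le> q" "q \<le> n" "\<xi> = R_rees n q"
    | q N where "3 \<le> q" "q \<le> n" "nontriv_normal q N" "\<xi> = R_norm n q N"
proof -
  note c = congD[OF \<xi>]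
  define q where "q = Max {q. drops \<xi> q}"
  have fin: "finite {q. drops \<xi> q}" by (rule finite_subset[of _ "{..n}"]) (auto simp: drops_def)
  have dq: "drops \<xi> q" and q2: "2 \<le> q"
    using Max_in[OF fin] Max_ge[OF fin, of q0] assms(2,3) unfolding q_def by auto
  have max: "p \<le> q" if "drops \<xi> p" for p using Max_ge[OF fin] that unfolding q_def by simp
  have qn: "q \<le> n" using dq by (simp add: drops_def)
  have coll: "(x, y) \<in> \<xi>" if "x \<in> I q" "y \<in> I q" for x y
    using drops_collapse[OF \<xi> dq q2] that c(3,4) by blast
  \<comment> \<open>The element of larger rank is put first; symmetry of \<open>\<xi>\<close> and of
    \<open>nu\<close> covers the other order.\<close>
  have half: "\<alpha> \<in> I q \<and> \<beta> \<in> I q \<or> (q < n \<and> (\<alpha>, \<beta>) \<in> nu P (bar n (Suc q) ` cong_perms \<xi> (Suc q)) \<and> cong_perms \<xi> (Suc q) \<noteq> {id})"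
    if ab: "(\<alpha>, \<beta>) \<in> \<xi>" "\<alpha> \<noteq> \<beta>" "part_rank \<beta> \<le> part_rank \<alpha>" for \<alpha> \<beta>
  proof (cases "part_rank \<alpha> \<le> q")
    case True
    then show ?thesis using c(1)[OF ab(1)] ab(3) by (auto simp: I_iff)
  next
    case False
    then have nd: "\<not> drops \<xi> (part_rank \<alpha>)" using max by blast
    have p1: "1 \<le> part_rank \<alpha>" using False by simp
    note np = nondrop_pair[OF \<xi> ab(1,2) refl ab(3) p1 nd]
    have "part_rank \<alpha> = Suc q" using max[OF np(2)] False by linarith
    then show ?thesis using np(3,4) rank_le_n[of \<alpha>] c(1)[OF ab(1)] by auto
  qed
  have pairs: "\<alpha> \<in> I q \<and> \<beta> \<in> I q \<or> (q < n \<and> (\<alpha>, \<beta>) \<in> nu P (bar n (Suc q) ` cong_perms \<xi> (Suc q)) \<and> cong_perms \<xi> (Suc q) \<noteq> {id})"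
    if ab: "(\<alpha>, \<beta>) \<in> \<xi>" "\<alpha> \<noteq> \<beta>" for \<alpha> \<beta>
    using half[OF ab] half[OF c(3)[OF ab(1)]] ab(2) nu_sym nat_le_linear by metis
  have sub: "R_rees n q \<subseteq> \<xi>" using coll c(2) by (auto simp: R_rees_eq)
  show ?thesis
  proof (cases "q < n \<and> cong_perms \<xi> (Suc q) \<noteq> {id}")
    case True
    then have qn': "Suc q \<le> n" by simp
    have "\<xi> = R_norm n (Suc q) (cong_perms \<xi> (Suc q))"
    proof
      show "\<xi> \<subseteq> R_norm n (Suc q) (cong_perms \<xi> (Suc q))" using pairs c(1) by (fastforce simp: R_norm_eq)
      show "R_norm n (Suc q) (cong_perms \<xi> (Suc q)) \<subseteq> \<xi>"
        using nu_cong_perms_subset[OF \<xi> qn'] sub by (auto simp: R_norm_eq R_rees_eq)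
    qed
    moreover have "nontriv_normal (Suc q) (cong_perms \<xi> (Suc q))"
      using True cong_perms_normal[OF \<xi> qn'] unfolding nontriv_normal_def by blast
    moreover have "3 \<le> Suc q" using q2 by simp
    ultimately show ?thesis using that(2) qn' by blast
  next
    case False
    have "\<xi> \<subseteq> R_rees n q"
    proof (intro subrelI)
      fix a b assume ab: "(a, b) \<in> \<xi>"
      then show "(a, b) \<in> R_rees n q" using pairs[OF ab] False c(1)[OF ab] by (cases "a = b") (auto simp: R_rees_eq)
    qed
    then show ?thesis using that(1)[of q] q2 qn sub by blast
  qed
qed

lemma classify_low:
  assumes \<xi>: "\<xi> \<in> congruences P" and n2: "2 \<le> n" and nd: "\<And>q. drops \<xi> q \<Longrightarrow> q < 2"
  obtains x i where "\<xi> = xi n x i"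
proof -
  note c = congD[OF \<xi>]
  let ?N = "cong_perms \<xi> 2"
  have n1: "1 \<le> n" using n2 by simp
  have NN: "normal ?N (sym_group 2)" by (rule cong_perms_normal[OF \<xi> n2])
  have drops0: "\<not> drops \<xi> 0" by (simp add: drops_def)
  define k where "k = (if drops \<xi> 1 then 1 else 0 :: nat)"
  have N1: "drops \<xi> 1" if ne: "?N \<noteq> {id}"
  proof -
    obtain \<sigma> where s: "\<sigma> \<in> ?N" "\<sigma> \<noteq> id" using ne normal_sym_nonempty(3)[OF NN] by blast
    have "2 - 1 = (1::nat)" by simp
    then show ?thesis using drops_below[OF \<xi> le_refl n2 s] by (simp only:)
  qed
  have Nall: "?N = {\<sigma>. \<sigma> permutes {1..2}}" if "?N \<noteq> {id}"
  proof -
    have eq: "{\<sigma>. \<sigma> permutes {1..2::nat}} = {id, transpose 1 2}" unfolding permutes_2 by auto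
    have "?N \<subseteq> {id, transpose 1 2}" using normal_sym_nonempty(1)[OF NN] unfolding eq .
    then show ?thesis unfolding eq using that normal_sym_nonempty(3)[OF NN] by blast
  qed
  define i where "i = (if ?N \<noteq> {id} then CS2 else if drops \<xi> 1 then C1 else C0)"
  have lev: "lev i = k" using N1 by (auto simp: i_def k_def)
  define Lz where "Lz \<longleftrightarrow> (\<exists>a b. (a, b) \<in> \<xi> \<and> a \<odot> e 0 \<noteq> b \<odot> e 0)"
  define Rz where "Rz \<longleftrightarrow> (\<exists>a b. (a, b) \<in> \<xi> \<and> e 0 \<odot> a \<noteq> e 0 \<odot> b)"
  \<comment> \<open>The letters cross over: if related elements may differ in their upper kernels
    only, then the lower kernels have to agree, and this is \<open>Lambda\<close>.\<close>
  define x where "x = (if Lz then (if Rz then RR else Lambda) else (if Rz then Rho else Mu))"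
  have half: "a \<in> I k \<and> b \<in> I k \<or> (?N \<noteq> {id} \<and> (a, b) \<in> nu P (bar n 2 ` ?N))"
    if ab: "(a, b) \<in> \<xi>" "a \<noteq> b" "part_rank b \<le> part_rank a" for a b
  proof -
    have Q: "a \<in> Q" "b \<in> Q" using c(1)[OF ab(1)] by auto
    consider "part_rank a = 0" | "drops \<xi> (part_rank a)" "1 \<le> part_rank a" | "\<not> drops \<xi> (part_rank a)" "1 \<le> part_rank a" by linarith
    then show ?thesis
    proof cases
      case 1 then show ?thesis using Q ab(3) by (auto simp: I_iff)
    next
      case 2
      then have "part_rank a = 1" using nd by fastforce
      then show ?thesis using 2 Q ab(3) by (auto simp: I_iff k_def)
    next
      case 3
      note np = nondrop_pair[OF \<xi> ab(1,2) refl ab(3) 3(2,1)]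
      have "part_rank a - 1 < 2" using nd[OF np(2)] .
      moreover have "part_rank a - 1 \<noteq> 0" using np(1) by simp
      ultimately have "part_rank a = 2" by linarith
      then show ?thesis using np(3,4) by simp
    qed
  qed
  have pairs: "a \<in> I k \<and> b \<in> I k \<or> (i = CS2 \<and> (a, b) \<in> nu P (Sbar 2))" if ab: "(a, b) \<in> \<xi>" "a \<noteq> b" for a b
  proof -
    have "a \<in> I k \<and> b \<in> I k \<or> (?N \<noteq> {id} \<and> (a, b) \<in> nu P (bar n 2 ` ?N))"
      using half[OF ab] half[OF c(3)[OF ab(1)]] ab(2) nu_sym nat_le_linear by metis
    then show ?thesis using Nall by (auto simp: i_def)
  qed
  have ag: "agree x a b" if "(a, b) \<in> \<xi>" for a b
    using that unfolding x_def Lz_def Rz_def by auto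
  have conv: "(a, b) \<in> \<xi>" if ab: "a \<in> I k" "b \<in> I k" "agree x a b" for a b
  proof -
    have Q: "a \<in> Q" "b \<in> Q" using ab by (auto simp: I_iff)
    \<comment> \<open>Every element of I_k is related to its retraction, and the retraction splits
      into the two products with \<open>e 0\<close>. These are compared separately in
      \<open>L\<close> and \<open>R\<close>.\<close>
    have hat: "(y, y \<odot> e 0 \<odot> y) \<in> \<xi>" if y: "y \<in> I k" for y
    proof (cases "drops \<xi> 1")
      case True then show ?thesis using drops_1_hat[OF \<xi> True] y by (simp add: k_def)
    next
      case False then show ?thesis using rank0_hat[of y] y c(2)[of y] by (simp add: k_def I_iff)
    qed
    have L: "(a \<odot> e 0, b \<odot> e 0) \<in> \<xi>"
    proof (cases Lz)
      case True
      then obtain a' b' where "(a', b') \<in> \<xi>" "a' \<odot> e 0 \<noteq> b' \<odot> e 0" unfolding Lz_def by blast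
      then show ?thesis using left_collapse[OF \<xi>] Q c(3,4) by blast
    next
      case False
      then have "a \<odot> e 0 = b \<odot> e 0" using ab(3) by (auto simp: x_def split: if_splits)
      then show ?thesis using c(2)[OF mult_closed] by simp
    qed
    have R: "(e 0 \<odot> a, e 0 \<odot> b) \<in> \<xi>"
    proof (cases Rz)
      case True
      then obtain a' b' where "(a', b') \<in> \<xi>" "e 0 \<odot> a' \<noteq> e 0 \<odot> b'" unfolding Rz_def by blast
      then show ?thesis using right_collapse[OF \<xi>] Q c(3,4) by blast
    next
      case False
      then have "e 0 \<odot> a = e 0 \<odot> b" using ab(3) by (auto simp: x_def split: if_splits)
      then show ?thesis using c(2)[OF mult_closed] by simp
    qed
    have "(a \<odot> e 0 \<odot> a, b \<odot> e 0 \<odot> (e 0 \<odot> b)) \<in> \<xi>" by (rule hat_split[OF \<xi> Q(1) L R])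
    moreover have "b \<odot> e 0 \<odot> (e 0 \<odot> b) = b \<odot> (e 0 \<odot> e 0) \<odot> b" using Q e_Q[OF le0] by (simp only: mult_assoc mult_closed)
    ultimately have "(a \<odot> e 0 \<odot> a, b \<odot> e 0 \<odot> b) \<in> \<xi>" by simp
    then show ?thesis using hat[OF ab(1)] hat[OF ab(2)] c(3,4) by blast
  qed
  have "\<xi> = xi n x i"
  proof
    show "\<xi> \<subseteq> xi n x i"
    proof (intro subrelI)
      fix a b assume ab: "(a, b) \<in> \<xi>"
      show "(a, b) \<in> xi n x i" unfolding xi_eq[OF n2] lev
        using pairs[OF ab] ag[OF ab] c(1)[OF ab] by (cases "a = b") auto
    qed
    have "nu P (Sbar 2) \<subseteq> \<xi>" if "i = CS2"
      using nu_cong_perms_subset[OF \<xi> n2] Nall that by (auto simp: i_def split: if_splits)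
    then show "xi n x i \<subseteq> \<xi>" unfolding xi_eq[OF n2] lev using conv c(2) by (auto split: if_splits)
  qed
  then show ?thesis by (rule that)
qed

section \<open>The order on the congruences\<close>

text \<open>The pairs (\<open>e p\<close>, \<open>e 0\<close>) serve as probes: they show up to
  which rank a congruence identifies the idempotents with \<open>e 0\<close>.\<close>

lemma rees_e_iff: "p \<le> n \<Longrightarrow> (e p, e 0) \<in> R_rees n q \<longleftrightarrow> p \<le> q"
proof -
  assume p: "p \<le> n"
  have "p = 0" if "e p = e 0" using that rank_e[OF p] rank_e[OF le0] by simp
  then show ?thesis using p by (auto simp: R_rees_eq I_iff)
qed

lemma norm_e_iff:
  assumes "p \<le> n" "1 \<le> q" "q \<le> n" "normal N (sym_group q)"
  shows "(e p, e 0) \<in> R_norm n q N \<longleftrightarrow> p \<le> q - 1"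
proof -
  have "p = 0" if "e p = e 0" using that rank_e[OF assms(1)] rank_e[OF le0] by simp
  moreover have "(e p, e 0) \<notin> nu P (bar n q ` N)" using nu_ranks(4)[OF assms(3,4)] assms(2) by fastforce
  ultimately show ?thesis using assms(1) by (auto simp: R_norm_eq I_iff)
qed

lemma xi_e_iff:
  assumes "2 \<le> n" "p \<le> n" shows "(e p, e 0) \<in> xi n x i \<longleftrightarrow> p \<le> lev i"
proof -
  have n1: "1 \<le> n" using assms by simp
  have 0: "p = 0" if "e p = e 0" using that rank_e[OF assms(2)] rank_e[OF le0] by simp
  have nn: "(e p, e 0) \<notin> nu P (Sbar 2)"
  proof
    assume "(e p, e 0) \<in> nu P (Sbar 2)"
    then show False using nu_ranks(4)[OF assms(1) normal_full] rank_e[OF le0] by fastforce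
  qed
  have ag: "agree x (e p) (e 0)" using assms(2) by - (rule agree_mono, simp add: e_mult_e)
  have I: "e p \<in> I (lev i) \<longleftrightarrow> p \<le> lev i" "e 0 \<in> I (lev i)" using assms(2) by (simp_all add: I_iff)
  have id: "(e p, e 0) \<in> Id_on Q \<Longrightarrow> p \<le> lev i" using 0 by blast
  show ?thesis unfolding xi_eq[OF assms(1)] using nn ag I id by (cases "i = CS2") auto
qed

text \<open>\<open>N\<close> can be recovered from \<open>nu\<close>: by \<open>frame_shift\<close>
  the permutation \<open>\<sigma>\<close> is conjugate to a quotient of two elements of
  \<open>N\<close>.\<close>

lemma nu_e_bar:
  assumes "q \<le> n" "normal N (sym_group q)" "\<sigma> permutes {1..q}"
  shows "(e q, bar n q \<sigma>) \<in> nu P (bar n q ` N) \<longleftrightarrow> \<sigma> \<in> N"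
proof
  note N = normal_sym_nonempty[OF assms(2)]
  note iff = nu_iff[OF assms(1) N(1,2)]
  assume "(e q, bar n q \<sigma>) \<in> nu P (bar n q ` N)"
  then obtain s t \<tau> \<tau>' where h: "s \<in> Q" "t \<in> Q" "\<tau> \<in> N" "\<tau>' \<in> N" "e q = s \<odot> bar n q \<tau> \<odot> t" "bar n q \<sigma> = s \<odot> bar n q \<tau>' \<odot> t"
    unfolding iff by blast
  have p: "\<tau> permutes {1..q}" "\<tau>' permutes {1..q}" using h N by auto
  have fr: "frame q (e q) (e q) (e q) (e q)" unfolding frame_def using assms(1) by simp
  have "e q \<odot> bar n q id \<odot> e q = e q" using assms(1) by simp
  then have "e q \<odot> bar n q id \<odot> e q = s \<odot> bar n q \<tau> \<odot> t" using h(5) by (rule trans)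
  then obtain g h' where g: "g permutes {1..q}" "h' permutes {1..q}" "id = h' \<circ> \<tau> \<circ> g"
    "s \<odot> bar n q \<tau>' \<odot> t = e q \<odot> bar n q (h' \<circ> \<tau>' \<circ> g) \<odot> e q"
    using frame_shift[OF fr h(1,2) permutes_id p(1)] p(2) by metis
  have gp: "(h' \<circ> \<tau>' \<circ> g) permutes {1..q}" using g(1,2) p(2) by (intro permutes_compose)
  then have "bar n q \<sigma> = bar n q (h' \<circ> \<tau>' \<circ> g)" using h(6) g(4) assms(1) by simp
  then have s: "\<sigma> = h' \<circ> \<tau>' \<circ> g" by (rule bar_inj[OF assms(3) gp])
  have "h' \<circ> \<tau>' \<circ> g = (h' \<circ> (\<tau>' \<circ> inv' \<tau>) \<circ> inv' h') \<circ> (h' \<circ> \<tau> \<circ> g)"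
  proof
    fix x
    show "(h' \<circ> \<tau>' \<circ> g) x = ((h' \<circ> (\<tau>' \<circ> inv' \<tau>) \<circ> inv' h') \<circ> (h' \<circ> \<tau> \<circ> g)) x"
      using permutes_inverses(2)[OF g(2)] permutes_inverses(2)[OF p(1)] by simp
  qed
  then have "\<sigma> = h' \<circ> (\<tau>' \<circ> inv' \<tau>) \<circ> inv' h'" unfolding s g(3)[symmetric] by (simp only: comp_id)
  then show "\<sigma> \<in> N" using normal_sym_conj[OF assms(2) g(2)] normal_sym_comp[OF assms(2)] normal_sym_inv[OF assms(2)] h(3,4) by blast
next
  note N = normal_sym_nonempty[OF assms(2)]
  assume s: "\<sigma> \<in> N"
  have *: "bar n q \<pi> = e n \<odot> bar n q \<pi> \<odot> e n" if "\<pi> permutes {1..q}" for \<pi> using bar_Q[OF assms(1) that] by simp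
  from *[OF permutes_id] *[OF assms(3)] show "(e q, bar n q \<sigma>) \<in> nu P (bar n q ` N)"
    unfolding nu_iff[OF assms(1) N(1,2)] using assms(1,3) s N(3) e_Q[OF le_refl] rank_e rank_bar by blast
qed

lemma norm_bar_iff:
  assumes "1 \<le> q" "q \<le> n" "normal N (sym_group q)" "\<sigma> permutes {1..q}"
  shows "(e q, bar n q \<sigma>) \<in> R_norm n q N \<longleftrightarrow> \<sigma> \<in> N"
proof -
  have "e q \<notin> I (q - 1)" using assms(1,2) by (simp add: I_iff)
  moreover have "\<sigma> \<in> N" if "e q = bar n q \<sigma>"
    using bar_inj[OF permutes_id assms(4) that] normal_sym_nonempty(3)[OF assms(3)] by simp
  ultimately show ?thesis using nu_e_bar[OF assms(2-4)] by (auto simp: R_norm_eq)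
qed

lemma norm_inj:
  assumes "1 \<le> q" "q \<le> n" "normal N (sym_group q)" "normal N' (sym_group q)" "R_norm n q N = R_norm n q N'"
  shows "N = N'"
  using norm_bar_iff[OF assms(1-3)] norm_bar_iff[OF assms(1,2,4)] assms(5) normal_sym_nonempty(1)[OF assms(3)]
    normal_sym_nonempty(1)[OF assms(4)] by blast

lemma rees_less_norm:
  assumes "1 \<le> q" "q \<le> n" "nontriv_normal q N" shows "R_rees n (q - 1) \<subset> R_norm n q N"
proof
  have N: "normal N (sym_group q)" "N \<noteq> {id}" using assms(3) by (auto simp: nontriv_normal_def)
  note N' = normal_sym_nonempty[OF N(1)]
  show "R_rees n (q - 1) \<subseteq> R_norm n q N" by (auto simp: R_norm_eq R_rees_eq)
  obtain \<sigma> where s: "\<sigma> \<in> N" "\<sigma> \<noteq> id" using N(2) N'(3) by blast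
  have p: "\<sigma> permutes {1..q}" using s N' by blast
  have "(e q, bar n q \<sigma>) \<in> R_norm n q N" using norm_bar_iff[OF assms(1,2) N(1) p] s by simp
  moreover have "(e q, bar n q \<sigma>) \<notin> R_rees n (q - 1)"
    using bar_inj[OF permutes_id p] s(2) assms(1,2) by (auto simp: R_rees_eq I_iff)
  ultimately show "R_rees n (q - 1) \<noteq> R_norm n q N" by blast
qed

lemma norm_less_norm:
  assumes "1 \<le> q" "q \<le> n" "normal N (sym_group q)" "normal N' (sym_group q)" "N \<subset> N'"
  shows "R_norm n q N \<subset> R_norm n q N'"
proof
  have "nu P (bar n q ` N) \<subseteq> nu P (bar n q ` N')"
    unfolding nu_def using assms(5) by (intro Int_mono) blast+
  then show "R_norm n q N \<subseteq> R_norm n q N'" by (auto simp: R_norm_eq)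
  show "R_norm n q N \<noteq> R_norm n q N'" using norm_inj[OF assms(1-4)] assms(5) by blast
qed

lemma norm_less_rees:
  assumes "1 \<le> q" "q \<le> n" "normal N (sym_group q)" shows "R_norm n q N \<subset> R_rees n q"
proof
  show "R_norm n q N \<subseteq> R_rees n q"
    using nu_ranks[OF assms(2,3)] assms(1) by (fastforce simp: R_norm_eq R_rees_eq I_iff)
  have "\<not> q \<le> q - 1" using assms(1) by simp
  then show "R_norm n q N \<noteq> R_rees n q" using norm_e_iff[OF assms(2,1,2,3)] rees_e_iff[OF assms(2), of q] by auto
qed

section \<open>The chain above R_{S_2}\<close>

lemma chain_layer_2: "chain_layer n 2 = [xi n RR CS2, R_rees n 2]"
  by (simp add: chain_layer_def)

lemma chain_layer_set:
  assumes "2 \<le> q"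
  shows "set (chain_layer n q) = {R_norm n q N | N. nontriv_normal q N} \<union> {R_rees n q}"
proof (cases "q = 2")
  case True then show ?thesis using nontriv_normal_2 by (auto simp: chain_layer_def)
next
  case False
  then have q: "3 \<le> q" using assms by simp
  show ?thesis unfolding nontriv_normal_iff[OF q] using False by (auto simp: chain_layer_def)
qed

lemma chain_layer_sorted:
  assumes "2 \<le> q" "q \<le> n"
  shows "sorted_wrt (\<subset>) (chain_layer n q)"
proof (cases "q = 2")
  case True
  then show ?thesis using norm_less_rees[of 2 "carrier (sym_group 2)"] assms normal_sym by (simp add: chain_layer_def)
next
  case False
  have q1: "1 \<le> q" using assms by simp
  have a: "R_norm n q (carrier (alt_group q)) \<subset> R_norm n q (carrier (sym_group q))"
    using norm_less_norm[OF q1 assms(2) normal_alt normal_sym] alt_proper[OF assms(1)] by blast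
  have b: "R_norm n q (carrier (sym_group q)) \<subset> R_rees n q" by (rule norm_less_rees[OF q1 assms(2) normal_sym])
  have k: "R_norm n q Klein4 \<subset> R_norm n q (carrier (alt_group q))" if "q = 4"
    using norm_less_norm[OF q1 assms(2) _ normal_alt] normal_Klein4 Klein4_proper that by blast
  show ?thesis using False a b k by (auto simp: chain_layer_def)
qed

text \<open>The upper bound \<open>R_rees n m\<close> is carried along so that the next layer can be
  attached: all its members lie strictly above that bound.\<close>

lemma chain_props:
  assumes "2 \<le> m" "m \<le> n"
  defines "ch \<equiv> concat (map (chain_layer n) [2..<Suc m])"
  shows "sorted_wrt (\<subset>) ch \<and> ch \<noteq> [] \<and> last ch = R_rees n m \<and> hd ch = xi n RR CS2 \<and>
    (\<forall>r\<in>set ch. r \<subseteq> R_rees n m)"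
  using assms(1,2) unfolding ch_def
proof (induction m rule: nat_induct_at_least)
  case base
  then show ?case using norm_less_rees[of 2 "carrier (sym_group 2)"] normal_sym by (auto simp: chain_layer_2)
next
  case (Suc m)
  let ?c = "concat (map (chain_layer n) [2..<Suc m])" and ?l = "chain_layer n (Suc m)"
  have c: "concat (map (chain_layer n) [2..<Suc (Suc m)]) = ?c @ ?l" using Suc.hyps by simp
  have mn: "Suc m \<le> n" "2 \<le> Suc m" "1 \<le> Suc m" using Suc by auto
  have IH: "sorted_wrt (\<subset>) ?c" "?c \<noteq> []" "hd ?c = xi n RR CS2" "\<forall>r\<in>set ?c. r \<subseteq> R_rees n m" using Suc by auto
  note ls = chain_layer_set[OF mn(2)]
  have low: "R_rees n m \<subset> r" if "r \<in> set ?l" for r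
  proof -
    have "R_rees n m \<subset> R_norm n (Suc m) N" if "nontriv_normal (Suc m) N" for N
      using rees_less_norm[OF mn(3,1) that] by simp
    moreover from this[of "carrier (sym_group (Suc m))"] have "R_rees n m \<subset> R_rees n (Suc m)"
      using norm_less_rees[OF mn(3,1) normal_sym] nontriv_normal_iff[of "Suc m"] Suc.hyps by auto
    ultimately show ?thesis using that unfolding ls by blast
  qed
  have up: "r \<subseteq> R_rees n (Suc m)" if "r \<in> set ?l" for r
    using that norm_less_rees[OF mn(3,1)] unfolding ls nontriv_normal_def by blast
  have "sorted_wrt (\<subset>) (?c @ ?l)"
    unfolding sorted_wrt_append using IH(1,4) chain_layer_sorted[OF mn(2,1)] low by blast
  moreover have "?l \<noteq> []" "last ?l = R_rees n (Suc m)" by (auto simp: chain_layer_def)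
  moreover have "\<forall>r\<in>set (?c @ ?l). r \<subseteq> R_rees n (Suc m)"
  proof -
    have "R_rees n m \<subseteq> R_rees n (Suc m)" by (auto simp: R_rees_eq I_iff)
    then show ?thesis using IH(4) up by auto
  qed
  moreover have "hd (?c @ ?l) = hd ?c" by (rule hd_append2[OF IH(2)])
  moreover have "last (?c @ ?l) = last ?l" by (rule last_appendR) (simp add: chain_layer_def)
  moreover have "?c @ ?l \<noteq> []" using IH(2) by blast
  ultimately show ?case unfolding c IH(3)[symmetric] by (simp only: simp_thms)
qed

lemma upper_chain_set:
  "set (upper_chain n) = {R_rees n q | q. 2 \<le> q \<and> q \<le> n} \<union> {R_norm n q N | q N. 2 \<le> q \<and> q \<le> n \<and> nontriv_normal q N}"
proof -
  have "{2..<Suc n} = {2..n}" by auto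
  then have "set (upper_chain n) = (\<Union>q\<in>{2..n}. set (chain_layer n q))" unfolding upper_chain_def by (simp del: upt_Suc)
  also have "\<dots> = (\<Union>q\<in>{2..n}. {R_norm n q N | N. nontriv_normal q N} \<union> {R_rees n q})"
    by (intro SUP_cong refl chain_layer_set) simp
  also have "\<dots> = {R_rees n q | q. 2 \<le> q \<and> q \<le> n} \<union> {R_norm n q N | q N. 2 \<le> q \<and> q \<le> n \<and> nontriv_normal q N}"
    by auto
  finally show ?thesis .
qed

text \<open>Two test elements for the diamond: \<open>z\<close> differs from \<open>e 0\<close> in
  the upper kernel only, and \<open>flip z\<close> in the lower kernel only.\<close>

lemma zU12:
  assumes "2 \<le> n"
  defines "z \<equiv> zU {(1, 2)}"
  shows "z \<in> I 0" "flip z \<in> I 0" "agree Lambda z (e 0)" "\<not> agree Rho z (e 0)"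
    "agree Rho (flip z) (e 0)" "\<not> agree Lambda (flip z) (e 0)"
proof -
  have zQ: "z \<in> Q" by (simp add: z_def)
  have s: "sat z A B \<longleftrightarrow> (1 \<in> A \<longleftrightarrow> 2 \<in> A)" for A B unfolding z_def using assms(1) by (simp add: sat_zU)
  have ze: "z \<odot> e 0 = z" by (rule Q_eqI) (use zQ in \<open>auto simp: sat_mult s\<close>)
  show z0: "z \<in> I 0" using e0_I0(1)[OF zQ] ze by simp
  then show "flip z \<in> I 0" by (simp add: I_iff)
  have ez: "e 0 \<odot> z = e 0" using e0_mid[OF zQ] zQ ze by (simp add: mult_assoc)
  then show "agree Lambda z (e 0)" by simp
  have "\<not> sat z {1} {}" by (simp add: s)
  then have ne: "z \<noteq> e 0" using sat_e0 by metis
  then show "\<not> agree Rho z (e 0)" using ze by simp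
  have f: "flip z \<odot> e 0 = flip (e 0 \<odot> z)" "e 0 \<odot> flip z = flip (z \<odot> e 0)" using zQ by (simp_all add: flip_mult)
  show "agree Rho (flip z) (e 0)" using f(1) ez by simp
  have "flip z \<noteq> e 0" using ne zQ flip_flip flip_e[OF le0] by metis
  then show "\<not> agree Lambda (flip z) (e 0)" using f(2) ze by simp
qed

lemma xi_I0_iff:
  assumes "2 \<le> n" "a \<in> I 0" "b \<in> I 0" shows "(a, b) \<in> xi n x i \<longleftrightarrow> agree x a b"
proof -
  have "a \<in> Q" "a \<in> I (lev i)" "b \<in> I (lev i)" using assms by (auto simp: I_iff)
  moreover have "(a, b) \<notin> nu P (Sbar 2)" using nu_ranks(3)[OF assms(1) normal_full] assms(2) by (fastforce simp: I_iff)
  ultimately show ?thesis using agree_refl by (auto simp: xi_eq[OF assms(1)])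
qed

text \<open>An inclusion is tested on a few pairs: the elements of \<open>zU12\<close> against
  \<open>e 0\<close> for the diamond, (\<open>e 1\<close>, \<open>e 0\<close>) for the step from 0
  to 1, and the transposition in rank 2 for the step to S_2.\<close>

lemma xi_subset_iff:
  assumes "2 \<le> n"
  shows "xi n x i \<subseteq> xi n y j \<longleftrightarrow> le_diamond x y \<and> le_chain3 i j"
proof
  assume sub: "xi n x i \<subseteq> xi n y j"
  let ?z = "zU {(1, 2)}"
  note z = zU12[OF assms]
  have e0: "e 0 \<in> I 0" by (simp add: I_iff)
  have "agree x ?z (e 0) \<Longrightarrow> agree y ?z (e 0)" "agree x (flip ?z) (e 0) \<Longrightarrow> agree y (flip ?z) (e 0)"
    using sub xi_I0_iff[OF assms z(1) e0] xi_I0_iff[OF assms z(2) e0] by blast+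
  then have "le_diamond x y" using z(3-6) by (cases x; cases y) (auto simp: le_diamond_def)
  moreover have "le_chain3 i j"
  proof -
    have 1: "1 \<le> lev i \<Longrightarrow> 1 \<le> lev j" using sub xi_e_iff[OF assms, of 1] assms by auto
    define \<tau> where "\<tau> = transpose 1 (2::nat)"
    have t: "\<tau> permutes {1..2}" using permutes_2 by (simp add: \<tau>_def)
    have "\<tau> 1 \<noteq> id 1" by (simp add: \<tau>_def)
    then have ne: "\<tau> \<noteq> id" by metis
    have 2: "j = CS2" if "i = CS2"
    proof (rule ccontr)
      assume j: "j \<noteq> CS2"
      have "(e 2, bar n 2 \<tau>) \<in> xi n x i"
        using nu_e_bar[OF assms normal_full t] t that by (simp add: xi_eq[OF assms])
      then have "(e 2, bar n 2 \<tau>) \<in> xi n y j" using sub by blast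
      moreover have "e 2 \<notin> I (lev j)" using assms by (cases j) (auto simp: I_iff)
      ultimately have "e 2 = bar n 2 \<tau>" using j by (auto simp: xi_eq[OF assms])
      then show False using bar_inj[OF permutes_id t] ne by blast
    qed
    show ?thesis using 1 2 by (cases i; cases j) auto
  qed
  ultimately show "le_diamond x y \<and> le_chain3 i j" by blast
next
  assume h: "le_diamond x y \<and> le_chain3 i j"
  have "agree y a b" if "agree x a b" for a b using that h agree_mono[of a b y] by (auto simp: le_diamond_def)
  moreover have "I (lev i) \<subseteq> I (lev j)" using h I0_subset by (cases i; cases j) auto
  moreover have "i = CS2 \<Longrightarrow> j = CS2" using h by auto
  ultimately show "xi n x i \<subseteq> xi n y j" unfolding xi_eq[OF assms] by auto
qed

text \<open>An element of the minimal ideal is determined by its two products with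
  \<open>e 0\<close>.\<close>

lemma xi_Mu_C0: "2 \<le> n \<Longrightarrow> xi n Mu C0 = Id_on Q"
proof -
  assume n2: "2 \<le> n"
  have "a = b" if ab: "a \<in> I 0" "b \<in> I 0" "agree Mu a b" for a b
  proof -
    have Q: "a \<in> Q" "b \<in> Q" using ab by (auto simp: I_iff)
    have "a = a \<odot> e 0 \<odot> a" using rank0_hat[OF ab(1)] by simp
    also have "\<dots> = b \<odot> (e 0 \<odot> a)" using ab(3) Q by (simp add: mult_assoc)
    also have "\<dots> = b \<odot> e 0 \<odot> b" using ab(3) Q by (simp add: mult_assoc)
    also have "\<dots> = b" using rank0_hat[OF ab(2)] .
    finally show ?thesis .
  qed
  then show ?thesis unfolding xi_eq[OF n2] by (auto simp: I_iff)
qed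

lemma xi_inj:
  assumes "2 \<le> n" "xi n x i = xi n y j" shows "x = y \<and> i = j"
  using xi_subset_iff[OF assms(1), of x i y j] xi_subset_iff[OF assms(1), of y j x i] assms(2)
  by (cases i; cases j) (auto simp: le_diamond_def)

section \<open>The complete list of congruences\<close>

lemma classify:
  assumes "2 \<le> n" "\<xi> \<in> congruences P"
  obtains q where "2 \<le> q" "q \<le> n" "\<xi> = R_rees n q"
    | q N where "3 \<le> q" "q \<le> n" "nontriv_normal q N" "\<xi> = R_norm n q N"
    | x i where "\<xi> = xi n x i"
proof (cases "\<exists>q\<ge>2. drops \<xi> q")
  case True
  then show ?thesis using classify_high[OF assms(2)] that(1,2) by metis
next
  case False
  then show ?thesis using classify_low[OF assms(2,1)] that(3) by (metis not_le)
qed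

lemma upper_not_xi:
  assumes "2 \<le> n" "(e 2, e 0) \<in> r" shows "r \<noteq> xi n x i"
proof -
  have "lev i < 2" by (cases i) auto
  then show ?thesis using xi_e_iff[OF assms(1), of 2 x i] assms by auto
qed

lemma upper_congruences:
  assumes "2 \<le> n"
  shows "insert (xi n RR CS2) (congruences P - {xi n x i | x i. True}) = set (upper_chain n)"
proof (intro equalityI subsetI)
  fix r assume r: "r \<in> insert (xi n RR CS2) (congruences P - {xi n x i | x i. True})"
  show "r \<in> set (upper_chain n)"
  proof (cases "r = xi n RR CS2")
    case True
    then have "r = R_norm n 2 (carrier (sym_group 2))" by simp
    then show ?thesis using nontriv_normal_2 assms unfolding upper_chain_set by blast
  next
    case False
    then have "r \<in> congruences P" "\<And>x i. r \<noteq> xi n x i" using r by blast+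
    then show ?thesis
    proof (cases rule: classify[OF assms \<open>r \<in> congruences P\<close>, case_names rees norm xi])
      case (rees q) then show ?thesis unfolding upper_chain_set by blast
    next
      case (norm q N)
      then have "2 \<le> q" by simp
      then show ?thesis unfolding upper_chain_set using norm by blast
    qed blast
  qed
next
  fix r assume "r \<in> set (upper_chain n)"
  then consider q where "2 \<le> q" "q \<le> n" "r = R_rees n q" | q N where "2 \<le> q" "q \<le> n" "nontriv_normal q N" "r = R_norm n q N"
    unfolding upper_chain_set by blast
  then show "r \<in> insert (xi n RR CS2) (congruences P - {xi n x i | x i. True})"
  proof cases
    case 1
    then have "(e 2, e 0) \<in> r" using rees_e_iff[OF assms] by simp
    then show ?thesis using upper_not_xi[OF assms] R_rees_congruence 1(3) by blast
  next
    case 2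
    have N: "normal N (sym_group q)" using 2 by (simp add: nontriv_normal_def)
    show ?thesis
    proof (cases "q = 2")
      case True
      then show ?thesis using 2 nontriv_normal_2 by simp
    next
      case False
      then have "2 \<le> q - 1" "1 \<le> q" using 2 by auto
      then have "(e 2, e 0) \<in> r" using norm_e_iff[OF assms _ 2(2) N] 2(4) by simp
      moreover have "r \<in> congruences P" using R_norm_congruence[OF \<open>1 \<le> q\<close> 2(2) N] 2(4) by simp
      ultimately show ?thesis using upper_not_xi[OF assms] by blast
    qed
  qed
qed

lemma cong_of_bij:
  assumes n2: "2 \<le> n" shows "bij_betw (cong_of n) (cong_names n) (congruences P)"
proof -
  have names: "nm \<in> cong_names n \<longleftrightarrow> (\<exists>q\<le>n. nm = Rees q) \<or>
      (\<exists>q N. 2 \<le> q \<and> q \<le> n \<and> nontriv_normal q N \<and> nm = Norm q N) \<or> (\<exists>x i. x \<noteq> RR \<and> nm = Retr x i)" for nm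
  proof -
    have "x \<in> {Mu, Lambda, Rho} \<longleftrightarrow> x \<noteq> RR" for x by (cases x) auto
    then show ?thesis unfolding cong_names_def by blast
  qed
  \<comment> \<open>Collapsing the whole minimal ideal is what separates the \<open>Rees\<close> and
    \<open>Norm\<close> names from the \<open>Retr\<close> names.\<close>
  have rr: "x = RR" if "I 0 \<times> I 0 \<subseteq> xi n x i" for x i
  proof -
    have e0: "e 0 \<in> I 0" by (simp add: I_iff)
    have "agree x (zU {(1, 2)}) (e 0)" "agree x (flip (zU {(1, 2)})) (e 0)"
      using that xi_I0_iff[OF n2] zU12(1,2)[OF n2] e0 by blast+
    then show ?thesis using zU12(4,6)[OF n2] by (cases x) auto
  qed
  have low: "I 0 \<times> I 0 \<subseteq> R_rees n q" "I 0 \<times> I 0 \<subseteq> R_norm n q N" for q N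
    by (auto simp: R_rees_eq R_norm_eq I_iff)
  have rees_inj: "p = q" if "p \<le> n" "q \<le> n" "R_rees n p = R_rees n q" for p q
    using rees_e_iff[OF that(1), of q] rees_e_iff[OF that(2), of p] rees_e_iff[OF that(1), of p]
      rees_e_iff[OF that(2), of q] that(3) by auto
  have nn: "q = q' \<and> N = N'" if "2 \<le> q" "q \<le> n" "nontriv_normal q N" "2 \<le> q'" "q' \<le> n" "nontriv_normal q' N'"
    "R_norm n q N = R_norm n q' N'" for q N q' N'
  proof -
    have N: "normal N (sym_group q)" "normal N' (sym_group q')" using that(3,6) by (auto simp: nontriv_normal_def)
    have 1: "1 \<le> q" "1 \<le> q'" using that by auto
    have key: "p \<le> q - 1 \<longleftrightarrow> p \<le> q' - 1" if "p \<le> n" for p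
      using norm_e_iff[OF that 1(1) \<open>q \<le> n\<close> N(1)] norm_e_iff[OF that 1(2) \<open>q' \<le> n\<close> N(2)] \<open>R_norm n q N = _\<close> by simp
    have "q - 1 \<le> q' - 1" using key[of "q - 1"] that(2) by simp
    moreover have "q' - 1 \<le> q - 1" using key[of "q' - 1"] that(5) by simp
    ultimately have "q = q'" using 1 by linarith
    then show ?thesis using norm_inj[OF 1(1) that(2) N(1)] N(2) that(7) by simp
  qed
  have rn: "R_rees n p \<noteq> R_norm n q N" if "p \<le> n" "2 \<le> q" "q \<le> n" "nontriv_normal q N" for p q N
  proof
    \<comment> \<open>Comparing the collapsed ranks gives p = q - 1, where the inclusion is known to
      be strict.\<close>
    assume eq: "R_rees n p = R_norm n q N"
    have N: "normal N (sym_group q)" and q1: "1 \<le> q" using that by (auto simp: nontriv_normal_def)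
    have "m \<le> p \<longleftrightarrow> m \<le> q - 1" if "m \<le> n" for m
      using rees_e_iff[OF that, of p] norm_e_iff[OF that q1 \<open>q \<le> n\<close> N] eq by simp
    from this[of p] this[of "q - 1"] have "p = q - 1" using that by simp
    then show False using rees_less_norm[OF q1 that(3,4)] eq by simp
  qed
  have inj: "inj_on (cong_of n) (cong_names n)"
  proof (rule inj_onI)
    fix a b assume ab: "a \<in> cong_names n" "b \<in> cong_names n" and eq: "cong_of n a = cong_of n b"
    show "a = b"
    proof (cases a)
      case (Rees p)
      then have p: "p \<le> n" using ab(1) by (auto simp: names)
      show ?thesis
      proof (cases b)
        case (Rees q) then show ?thesis using \<open>a = Rees p\<close> eq rees_inj p ab(2) by (auto simp: names)
      next
        case (Norm q N) then show ?thesis using \<open>a = Rees p\<close> eq rn[OF p] ab(2) by (auto simp: names)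
      next
        case (Retr x i) then show ?thesis using \<open>a = Rees p\<close> eq rr low(1)[of p] ab(2) by (auto simp: names)
      qed
    next
      case (Norm p M)
      then have p: "2 \<le> p" "p \<le> n" "nontriv_normal p M" using ab(1) by (auto simp: names)
      show ?thesis
      proof (cases b)
        case (Rees q) then show ?thesis using \<open>a = Norm p M\<close> eq rn[of q p M] p ab(2) by (auto simp: names)
      next
        case (Norm q N) then show ?thesis using \<open>a = Norm p M\<close> eq nn[OF p] ab(2) by (auto simp: names)
      next
        case (Retr x i) then show ?thesis using \<open>a = Norm p M\<close> eq rr low(2)[of p M] ab(2) by (auto simp: names)
      qed
    next
      case (Retr x i)
      then have x: "x \<noteq> RR" using ab(1) by (auto simp: names)
      show ?thesis
      proof (cases b)
        case (Rees q)
        then have "I 0 \<times> I 0 \<subseteq> xi n x i" using \<open>a = Retr x i\<close> eq low(1)[of q] by simp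
        then show ?thesis using rr x by blast
      next
        case (Norm q N)
        then have "I 0 \<times> I 0 \<subseteq> xi n x i" using \<open>a = Retr x i\<close> eq low(2)[where q = q and N = N] by simp
        then show ?thesis using rr x by blast
      next
        case (Retr y j) then show ?thesis using \<open>a = Retr x i\<close> eq xi_inj[OF n2] by auto
      qed
    qed
  qed
  have "cong_of n ` cong_names n = congruences P"
  proof (intro equalityI subsetI)
    fix r assume "r \<in> cong_of n ` cong_names n"
    then obtain nm where nm: "nm \<in> cong_names n" "r = cong_of n nm" by blast
    from nm(1) consider q where "nm = Rees q" | q N where "2 \<le> q" "q \<le> n" "nontriv_normal q N" "nm = Norm q N"
      | x i where "nm = Retr x i" unfolding names by blast
    then show "r \<in> congruences P"
    proof cases
      case 1 then show ?thesis using nm(2) R_rees_congruence by simp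
    next
      case 2
      then have "1 \<le> q" "normal N (sym_group q)" by (auto simp: nontriv_normal_def)
      then show ?thesis using nm(2) R_norm_congruence 2 by simp
    next
      case 3 then show ?thesis using nm(2) xi_congruence[OF n2] by simp
    qed
  next
    fix r assume r: "r \<in> congruences P"
    have "\<exists>nm\<in>cong_names n. r = cong_of n nm"
    proof (rule classify[OF n2 r])
      fix q assume "q \<le> n" "r = R_rees n q"
      then show ?thesis by (intro bexI[of _ "Rees q"]) (auto simp: names)
    next
      fix q N assume "3 \<le> q" "q \<le> n" "nontriv_normal q N" "r = R_norm n q N"
      then show ?thesis by (intro bexI[of _ "Norm q N"]) (auto simp: names)
    next
      fix x i assume xi: "r = xi n x i"
      show ?thesis
      proof (cases "x = RR")
        case False
        then show ?thesis using xi by (intro bexI[of _ "Retr x i"]) (auto simp: names)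
      next
        \<comment> \<open>For \<open>RR\<close> the three levels already have names:
          \<open>Rees 0\<close>, \<open>Rees 1\<close>, and \<open>Norm 2\<close> with the full
          group.\<close>
        case True
        show ?thesis
        proof (cases i)
          case C0
          then show ?thesis using xi True by (intro bexI[of _ "Rees 0"]) (auto simp: names)
        next
          case C1
          have "r = cong_of n (Rees 1)" using xi True C1 by simp
          moreover have "Rees 1 \<in> cong_names n" unfolding names using n2 by auto
          ultimately show ?thesis by blast
        next
          case CS2
          then show ?thesis using xi True n2 nontriv_normal_2
            by (intro bexI[of _ "Norm 2 (carrier (sym_group 2))"]) (auto simp: names)
        qed
      qed
    qed
    then show "r \<in> cong_of n ` cong_names n" by blast
  qed
  then show ?thesis using inj by (simp add: bij_betw_def)
qed

end

theorem theorem5p4: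
  fixes n :: nat
  assumes "n \<ge> 2"
  shows
    "({I. sg_ideal (part_monoid n) I} = {I_ideal n q | q. q \<le> n}) \<and>
    ({(I, M). proper_IN_pair (part_monoid n) I M \<and> (\<exists>q\<le>n. le_S_bar n q M)} =
       {(I_ideal n (q - 1), bar n q ` N) | q N. 2 \<le> q \<and> q \<le> n \<and> nontriv_normal q N}) \<and>
    ({(I, M). retractable_IN_pair (part_monoid n) I M \<and> (\<exists>q\<le>n. le_S_bar n q M)} =
       {C_pair n C0, C_pair n C1, C_pair n CS2}) \<and>
    (bij_betw (cong_of n) (cong_names n) (congruences (part_monoid n))) \<and>
    (\<forall>x y i j. xi n x i \<subseteq> xi n y j \<longleftrightarrow> le_diamond x y \<and> le_chain3 i j) \<and>
    (xi n Mu C0 = Id_on (carrier (part_monoid n))) \<and>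
    (\<forall>r \<in> congruences (part_monoid n) - {xi n x i | x i. True}. xi n RR CS2 \<subseteq> r) \<and>
    (insert (xi n RR CS2) (congruences (part_monoid n) - {xi n x i | x i. True}) =
       set (upper_chain n)) \<and>
    (sorted_wrt (\<subset>) (upper_chain n)) \<and>
    (hd (upper_chain n) = xi n RR CS2) \<and>
    (last (upper_chain n) = R_rees n n) \<and>
    (R_rees n n = carrier (part_monoid n) \<times> carrier (part_monoid n))"
proof -
  interpret partition_monoid n .
  have ch: "sorted_wrt (\<subset>) (upper_chain n)" "upper_chain n \<noteq> []" "last (upper_chain n) = R_rees n n"
    "hd (upper_chain n) = xi n RR CS2"
    using chain_props[OF assms le_refl] unfolding upper_chain_def by blast+
  show ?thesis
  proof (intro conjI)
    show "{I. sg_ideal P I} = {I q | q. q \<le> n}" using sg_ideal_iff by blast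
    show "{(I, M). proper_IN_pair P I M \<and> (\<exists>q\<le>n. le_S_bar n q M)} =
         {(I (q - 1), bar n q ` N) | q N. 2 \<le> q \<and> q \<le> n \<and> nontriv_normal q N}" by (rule proper_IN_pairs)
    show "{(I, M). retractable_IN_pair P I M \<and> (\<exists>q\<le>n. le_S_bar n q M)} = {C_pair n C0, C_pair n C1, C_pair n CS2}"
      by (rule retractable_IN_pairs[OF assms])
    show "bij_betw (cong_of n) (cong_names n) (congruences P)" by (rule cong_of_bij[OF assms])
    show "\<forall>x y i j. xi n x i \<subseteq> xi n y j \<longleftrightarrow> le_diamond x y \<and> le_chain3 i j" using xi_subset_iff[OF assms] by blast
    show "xi n Mu C0 = Id_on Q" by (rule xi_Mu_C0[OF assms])
    show "insert (xi n RR CS2) (congruences P - {xi n x i | x i. True}) = set (upper_chain n)"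
      by (rule upper_congruences[OF assms])
    show "\<forall>r\<in>congruences P - {xi n x i | x i. True}. xi n RR CS2 \<subseteq> r"
    proof
      fix r assume "r \<in> congruences P - {xi n x i | x i. True}"
      then have "r \<in> set (upper_chain n)" using upper_congruences[OF assms] by blast
      then show "xi n RR CS2 \<subseteq> r" using ch(1,2,4) by (cases "upper_chain n") auto
    qed
    show "sorted_wrt (\<subset>) (upper_chain n)" "hd (upper_chain n) = xi n RR CS2" "last (upper_chain n) = R_rees n n"
      by (rule ch)+
    show "R_rees n n = Q \<times> Q" by (rule R_rees_n)
  qed
qed

end
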